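(* Let $m\ge 0$ be an integer, let $g$ be an entire function on $\mathbb{C}$, and let $0<p,q<\infty$. Consider the Volterra-type operator $V_gf(z)=\int_0^z f(w)g'(w)\,dw$. (1) If $0<p\le q<\infty$, then $V_g:\mathcal{F}_{\psi_m}^p\to\mathcal{F}_{\psi_m}^q$ is (a) bounded if and only if $g(z)=az^2+bz+c$ for some $a,b,c\in\mathbb{C}$; (b) compact if and only if $g(z)=az+b$ for some $a,b\in\mathbb{C}$. (2) If $0<q<p<\infty$, then the following statements are equivalent: (a) $V_g:\mathcal{F}_{\psi_m}^p\to\mathcal{F}_{\psi_m}^q$ is bounded; (b) $V_g:\mathcal{F}_{\psi_m}^p\to\mathcal{F}_{\psi_m}^q$ is compact; (c) in the case $\frac{q}{2}>\frac{p-q}{p}$, $g(z)=az+b$ for some $a,b\in\mathbb{C}$; and in the case $\frac{q}{2}\le\frac{p-q}{p}$, $g$ is constant. (3) Let $0<p<\infty$. If $V_g$ is compact on $\mathcal{F}_{\psi_m}^2$, then $V_g$ belongs to the Schatten class $\mathcal{S}_p(\mathcal{F}_{\psi_m}^2)$ for all $p>2$. On the other hand, if $0<p<2$, then $V_g$ belongs to $\mathcal{S}_p(\mathcal{F}_{\psi_m}^2)$ if and only if $g$ is a constant function.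
   Context: For an integer $m\ge 0$ let $\psi_m(z)=\frac12|z|^2-m\log(1+|z|)$, $z\in\mathbb{C}$. For $0<p<\infty$, the Fock--Sobolev space $\mathcal{F}_{\psi_m}^p$ is the space of all entire functions $f$ with $\|f\|_{(p,m)}^p:=\int_{\mathbb{C}}|f(z)|^pe^{-p\psi_m(z)}\,dA(z)<\infty$, where $dA$ is Lebesgue area measure on $\mathbb{C}$. $\mathcal{F}_{\psi_m}^2$ is a Hilbert space, and $\mathcal{S}_p(\mathcal{F}_{\psi_m}^2)$ denotes the Schatten $p$-class of compact operators on it (those whose singular values are $\ell^p$-summable). *)

theory Defs
  imports "HOL-Complex_Analysis.Complex_Analysis"
begin

definition psi :: "nat \<Rightarrow> complex \<Rightarrow> real" where
  "psi m z = (cmod z)^2 / 2 - real m * ln (1 + cmod z)"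

definition fs_integral :: "real \<Rightarrow> nat \<Rightarrow> (complex \<Rightarrow> complex) \<Rightarrow> ennreal" where
  "fs_integral p m f = (\<integral>\<^sup>+ z. ennreal (cmod (f z) powr p * exp (- p * psi m z)) \<partial>lborel)"

definition FS :: "real \<Rightarrow> nat \<Rightarrow> (complex \<Rightarrow> complex) set" where
  "FS p m = {f. f holomorphic_on UNIV \<and> fs_integral p m f < \<infinity>}"

definition fs_norm :: "real \<Rightarrow> nat \<Rightarrow> (complex \<Rightarrow> complex) \<Rightarrow> real" where
  "fs_norm p m f = enn2real (fs_integral p m f) powr (1 / p)"

definition fs_inner :: "nat \<Rightarrow> (complex \<Rightarrow> complex) \<Rightarrow> (complex \<Rightarrow> complex) \<Rightarrow> complex" where
  "fs_inner m f h = (LINT z|lborel. f z * cnj (h z) * complex_of_real (exp (- 2 * psi m z)))"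

definition Volterra :: "(complex \<Rightarrow> complex) \<Rightarrow> (complex \<Rightarrow> complex) \<Rightarrow> complex \<Rightarrow> complex" where
  "Volterra g f z = contour_integral (linepath 0 z) (\<lambda>w. f w * deriv g w)"

definition Vol_bounded :: "nat \<Rightarrow> real \<Rightarrow> real \<Rightarrow> (complex \<Rightarrow> complex) \<Rightarrow> bool" where
  "Vol_bounded m p q g \<longleftrightarrow>
     (\<exists>C. \<forall>f \<in> FS p m. Volterra g f \<in> FS q m \<and> fs_norm q m (Volterra g f) \<le> C * fs_norm p m f)"

definition Vol_compact :: "nat \<Rightarrow> real \<Rightarrow> real \<Rightarrow> (complex \<Rightarrow> complex) \<Rightarrow> bool" where
  "Vol_compact m p q g \<longleftrightarrow>
     (\<forall>f \<in> FS p m. Volterra g f \<in> FS q m) \<and>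
     (\<forall>fs :: nat \<Rightarrow> complex \<Rightarrow> complex.
        (\<forall>n. fs n \<in> FS p m \<and> fs_norm p m (fs n) \<le> 1) \<longrightarrow>
        (\<exists>r h. strict_mono r \<and> h \<in> FS q m \<and>
           (\<lambda>n. fs_norm q m (\<lambda>z. Volterra g (fs (r n)) z - h z)) \<longlonglongrightarrow> 0))"

definition fs_orthonormal :: "nat \<Rightarrow> (nat \<Rightarrow> complex \<Rightarrow> complex) \<Rightarrow> bool" where
  "fs_orthonormal m e \<longleftrightarrow> (\<forall>i. e i \<in> FS 2 m) \<and>
     (\<forall>i j. fs_inner m (e i) (e j) = (if i = j then 1 else 0))"

text \<open>V_g in the Schatten class S_p(F^2_{psi_m}): V_g has a singular value (Schmidt)
  decomposition V_g f = sum_n s_n <f, e_n> sigma_n (convergent in F^2) with orthonormal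
  sequences e, sigma and singular values s_n >= 0 that are p-summable.\<close>
definition Vol_Schatten :: "nat \<Rightarrow> real \<Rightarrow> (complex \<Rightarrow> complex) \<Rightarrow> bool" where
  "Vol_Schatten m p g \<longleftrightarrow>
     (\<forall>f \<in> FS 2 m. Volterra g f \<in> FS 2 m) \<and>
     (\<exists>(s :: nat \<Rightarrow> real) e \<sigma>. fs_orthonormal m e \<and> fs_orthonormal m \<sigma> \<and>
        (\<forall>n. s n \<ge> 0) \<and> summable (\<lambda>n. s n powr p) \<and>
        (\<forall>f \<in> FS 2 m. (\<lambda>N. fs_norm 2 m (\<lambda>z. Volterra g f z -
             (\<Sum>n<N. complex_of_real (s n) * fs_inner m f (e n) * \<sigma> n z))) \<longlonglongrightarrow> 0))"

end

theory Submission
  imports Defs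
begin

text \<open>
  Everything rests on the two-sided estimate
  \<open>\<parallel>F\<parallel>\<^sub>q \<approx> \<parallel>F' / (1 + |z|)\<parallel>\<^sub>q\<close> for entire \<open>F\<close> with \<open>F 0 = 0\<close>, valid for all \<open>q > 0\<close>. The upper
  bound for \<open>F'\<close> is Cauchy's inequality on discs of radius \<open>1 / (1 + |z|)\<close>, on which the weight is
  essentially constant. For the converse, move \<open>z\<close> radially inwards to the point \<open>z'\<close> with
  \<open>|z'|\<^sup>2 = |z|\<^sup>2 - 2 s\<close>: the weight at \<open>z\<close> is smaller than at \<open>z'\<close> by a factor of about
  \<open>exp (- s)\<close>, and in the coordinates \<open>(|z|\<^sup>2, arg z)\<close> the map is a translation, hence
  measure preserving; for large \<open>s\<close> the contribution of \<open>F z'\<close> is absorbed into the left-hand side.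

  Thus \<open>V\<^sub>g\<close> behaves like multiplication by \<open>g' / (1 + |z|)\<close>. Kernel functions concentrated at a
  point \<open>w\<close> give \<open>|g' w| \<le> C (1 + |w|)\<close>, with \<open>o(1)\<close> in place of \<open>C\<close> in the compact case, so that
  \<open>g\<close> is quadratic or affine by Liouville's theorem. For \<open>q < p\<close> the multiplier has to be
  \<open>r\<close>-integrable with \<open>r = p q / (p - q)\<close>; the test functions are sums of monomials
  \<open>z^(\<rho>\<^sup>2)\<close>, each of which is concentrated on the annulus of width 1 around \<open>|z| = \<rho>\<close>. In the
  Hilbert space case the normalised monomials are an orthonormal basis on which, for affine \<open>g\<close>,
  \<open>V\<^sub>g\<close> is a weighted shift with weights of size \<open>n^(-1/2)\<close>.
\<close>

section \<open>Planar Lebesgue measure: rotations and polar coordinates\<close>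

text \<open>For exponents below 1 there is neither Minkowski's inequality nor duality, so estimates
  rest on local area means of \<open>|f|^p\<close> and on elementary inequalities valid for every
  exponent. Absorbing a term into the left-hand side requires a finite quantity, and finiteness is
  not known in advance; hence the truncation to discs, which inward shifts respect. For
  \<open>q < p\<close> radially concentrated tests are conclusive because boundedness has already
  made \<open>g\<close> quadratic: unless \<open>g\<close> is constant,
  \<open>|g'| / (1 + |z|)\<close> is comparable near infinity to a power of \<open>1 + |z|\<close>.
  The threshold is that of the plane: \<open>(1 + |z|)^(-r)\<close> is integrable exactly for
  \<open>r > 2\<close>, that is for \<open>q / 2 > (p - q) / p\<close>, while a nonzero constant
  never is. The degree \<open>\<rho>^2\<close> comes from the weight:
  \<open>n ln t - t^2 / 2\<close> has its maximum at \<open>t = sqrt n\<close>, with second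
  derivative -2 there, so the width of the annulus is independent of \<rho>. The Schatten part
  handles Schmidt expansions directly: for affine \<open>g\<close> the monomials provide one, and
  for \<open>p < 2\<close> the square summable singular values bound the sum of all squared matrix
  entries, against the divergence of the harmonic series.\<close>

lemma nn_integral_lborel_translate:
  fixes f :: "'a::euclidean_space \<Rightarrow> ennreal"
  assumes [measurable]: "f \<in> borel_measurable borel"
  shows "(\<integral>\<^sup>+x. f (a + x) \<partial>lborel) = (\<integral>\<^sup>+x. f x \<partial>lborel)"
proof -
  have "(\<integral>\<^sup>+x. f x \<partial>lborel) = (\<integral>\<^sup>+x. f x \<partial>distr lborel borel ((+) a))"
    by (simp add: lborel_distr_plus)
  also have "\<dots> = (\<integral>\<^sup>+x. f (a + x) \<partial>lborel)"
    by (subst nn_integral_distr) auto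
  finally show ?thesis by simp
qed

lemma emeasure_lborel_ball_complex:
  assumes "r \<ge> 0"
  shows "emeasure lborel (ball (c::complex) r) = ennreal (pi * r\<^sup>2)"
    "emeasure lborel (cball (c::complex) r) = ennreal (pi * r\<^sup>2)"
  using assms by (simp_all add: emeasure_ball emeasure_cball unit_ball_vol_numeral eval_unit_ball_vol)

text \<open>
  Both orders of integration of \<open>f (c x) 1\<^sub>B (y - c x)\<close>, with \<open>B\<close> the unit disc, are evaluated by
  translation invariance alone.
\<close>

lemma nn_integral_lborel_rotate:
  fixes f :: "complex \<Rightarrow> ennreal" and c :: complex
  assumes [measurable]: "f \<in> borel_measurable borel" and c: "cmod c = 1"
  shows "(\<integral>\<^sup>+x. f (c * x) \<partial>lborel) = (\<integral>\<^sup>+x. f x \<partial>lborel)"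
proof -
  define B :: "complex \<Rightarrow> ennreal" where "B = indicator (ball 0 1)"
  have [measurable]: "B \<in> borel_measurable borel" unfolding B_def by (simp add: borel_measurable_indicator)
  let ?L = "lborel :: complex measure"
  have cB: "(\<integral>\<^sup>+x. B x \<partial>?L) = ennreal pi"
    by (simp add: B_def emeasure_lborel_ball_complex)
  have c0: "c \<noteq> 0" using c by auto
  have meas1 [measurable]: "(\<lambda>(x,y). f (c * x) * B (y - c * x)) \<in> borel_measurable (?L \<Otimes>\<^sub>M ?L)"
    unfolding case_prod_beta by measurable
  have meas2 [measurable]: "(\<lambda>(x,y). f (y + c * x) * B x) \<in> borel_measurable (?L \<Otimes>\<^sub>M ?L)"
    unfolding case_prod_beta by measurable
  have "(\<integral>\<^sup>+x. f (c * x) \<partial>?L) * pi = (\<integral>\<^sup>+x. (\<integral>\<^sup>+y. f (c * x) * B (y - c * x) \<partial>?L) \<partial>?L)"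
  proof -
    have "(\<integral>\<^sup>+y. f (c * x) * B (y - c * x) \<partial>?L) = f (c * x) * pi" for x
    proof -
      have "(\<integral>\<^sup>+y. B (y - c * x) \<partial>?L) = ennreal pi"
        using nn_integral_lborel_translate[of B "- (c * x)"]
        by (simp add: cB)
      then show ?thesis by (simp add: nn_integral_cmult)
    qed
    then show ?thesis by (simp add: nn_integral_multc)
  qed
  also have "\<dots> = (\<integral>\<^sup>+y. (\<integral>\<^sup>+x. f (c * x) * B (y - c * x) \<partial>?L) \<partial>?L)"
    by (rule lborel_pair.Fubini'[OF meas1, symmetric])
  also have "\<dots> = (\<integral>\<^sup>+y. (\<integral>\<^sup>+x. f (y + c * x) * B x \<partial>?L) \<partial>?L)"
  proof (rule nn_integral_cong)
    fix y
    have "(\<integral>\<^sup>+x. f (c * x) * B (y - c * x) \<partial>?L) =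
          (\<integral>\<^sup>+x. f (c * (y / c + x)) * B (y - c * (y / c + x)) \<partial>?L)"
      by (rule nn_integral_lborel_translate[symmetric, where f="\<lambda>x. f (c * x) * B (y - c * x)"]) measurable
    \<comment> \<open>After the substitution the argument of \<open>B\<close> is
      \<open>- (c * x)\<close>, and \<open>B\<close> is invariant under rotations. What remains of
      \<open>y\<close> stands in \<open>f\<close> alone, as a translation.\<close>
    also have "\<dots> = (\<integral>\<^sup>+x. f (y + c * x) * B x \<partial>?L)"
      using c0 c by (intro nn_integral_cong) (auto simp: algebra_simps B_def indicator_def norm_mult)
    finally show "(\<integral>\<^sup>+x. f (c * x) * B (y - c * x) \<partial>?L) = (\<integral>\<^sup>+x. f (y + c * x) * B x \<partial>?L)" .
  qed
  also have "\<dots> = (\<integral>\<^sup>+x. (\<integral>\<^sup>+y. f (y + c * x) * B x \<partial>?L) \<partial>?L)"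
    by (rule lborel_pair.Fubini'[OF meas2])
  also have "\<dots> = (\<integral>\<^sup>+x. (\<integral>\<^sup>+y. f y \<partial>?L) * B x \<partial>?L)"
    using nn_integral_lborel_translate[of f]
    by (intro nn_integral_cong) (simp add: nn_integral_multc add.commute[of _ "c * _"])
  also have "\<dots> = (\<integral>\<^sup>+y. f y \<partial>?L) * pi"
    by (simp add: nn_integral_cmult cB)
  finally show ?thesis
    by (simp add: mult.commute[of _ "ennreal pi"] ennreal_mult_cancel_left)
qed

text \<open>The image of planar measure under \<open>|z|^2\<close> and \<open>pi\<close> times
  Lebesgue measure on \<open>{0..}\<close> agree on all half-lines \<open>{..a}\<close>, by the area
  of a disc, and half-lines generate the Borel sets.\<close>

lemma nn_integral_lborel_radial:
  fixes h :: "real \<Rightarrow> ennreal"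
  assumes [measurable]: "h \<in> borel_measurable borel"
  shows "(\<integral>\<^sup>+z. h ((cmod z)\<^sup>2) \<partial>lborel) = ennreal pi * (\<integral>\<^sup>+t. h t * indicator {0..} t \<partial>lborel)"
proof -
  let ?M = "distr lborel borel (\<lambda>z::complex. (cmod z)\<^sup>2)"
  let ?N = "density lborel (\<lambda>t::real. ennreal pi * indicator {0..} t)"
  have emM: "emeasure ?M {..a} = ennreal (pi * max 0 a)" for a
  proof -
    have "(\<lambda>z::complex. (cmod z)\<^sup>2) -` {..a} \<inter> space lborel = (if a < 0 then {} else cball 0 (sqrt a))"
      by (auto simp: real_le_rsqrt) (smt (verit) zero_le_power2, metis abs_norm_cancel real_sqrt_abs real_sqrt_le_iff)
    then show ?thesis
      by (simp add: emeasure_distr emeasure_lborel_ball_complex max_def)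
  qed
  have emN: "emeasure ?N {..a} = ennreal (pi * max 0 a)" for a
  proof -
    have "emeasure ?N {..a} = (\<integral>\<^sup>+t. ennreal pi * indicator {0..a} t \<partial>lborel)"
      by (subst emeasure_density) (auto intro!: nn_integral_cong simp: indicator_def)
    also have "\<dots> = ennreal pi * emeasure lborel {0..a}"
      by (simp add: nn_integral_cmult)
    also have "\<dots> = ennreal (pi * max 0 a)"
      by (cases "a \<ge> 0") (auto simp: ennreal_mult max_def)
    finally show ?thesis .
  qed
  have "?M = ?N"
  proof (rule measure_eqI_generator_eq[where \<Omega>=UNIV and E="range atMost" and A="\<lambda>n. {..real n}"])
    show "Int_stable (range (atMost :: real \<Rightarrow> _))"
      by (auto simp: Int_stable_def)
    show "sets ?M = sigma_sets UNIV (range atMost)" "sets ?N = sigma_sets UNIV (range atMost)"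
      by (simp_all add: borel_eq_atMost)
    show "(\<Union>i. {..real i}) = UNIV"
      by (auto intro: real_arch_simple)
    show "emeasure ?M {..real i} \<noteq> \<infinity>" for i
      unfolding emM by simp
  qed (auto simp: emM emN)
  have "(\<integral>\<^sup>+z. h ((cmod z)\<^sup>2) \<partial>lborel) = (\<integral>\<^sup>+t. h t \<partial>?M)"
    by (subst nn_integral_distr) auto
  also have "\<dots> = (\<integral>\<^sup>+t. h t \<partial>?N)" by (simp only: \<open>?M = ?N\<close>)
  also have "\<dots> = (\<integral>\<^sup>+t. ennreal pi * (h t * indicator {0..} t) \<partial>lborel)"
    by (subst nn_integral_density) (auto intro!: nn_integral_cong simp: ac_simps)
  finally show ?thesis by (simp add: nn_integral_cmult)
qed

text \<open>The part of the shifted period that lies beyond \<open>c\<close> is moved back by one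
  period and fills \<open>{0..<a}\<close>.\<close>

lemma nn_integral_periodic_shift:
  fixes f :: "real \<Rightarrow> ennreal"
  assumes [measurable]: "f \<in> borel_measurable borel" and per: "\<And>x. f (x + c) = f x"
    and a: "0 \<le> a" "a \<le> c"
  shows "(\<integral>\<^sup>+x. f (a + x) * indicator {0..<c} x \<partial>lborel) = (\<integral>\<^sup>+x. f x * indicator {0..<c} x \<partial>lborel)"
proof -
  have "(\<integral>\<^sup>+x. f (a + x) * indicator {0..<c} x \<partial>lborel)
      = (\<integral>\<^sup>+x. f (a + x) * indicator {a..<a+c} (a + x) \<partial>lborel)"
    by (intro nn_integral_cong) (auto simp: indicator_def)
  also have "\<dots> = (\<integral>\<^sup>+x. f x * indicator {a..<a+c} x \<partial>lborel)"
    by (rule nn_integral_lborel_translate[where f="\<lambda>x. f x * indicator {a..<a+c} x"]) measurable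
  also have "\<dots> = (\<integral>\<^sup>+x. f x * indicator {a..<c} x + f x * indicator {c..<a+c} x \<partial>lborel)"
    using a by (intro nn_integral_cong) (auto simp: indicator_def)
  also have "\<dots> = (\<integral>\<^sup>+x. f x * indicator {a..<c} x \<partial>lborel) + (\<integral>\<^sup>+x. f x * indicator {c..<a+c} x \<partial>lborel)"
    by (rule nn_integral_add) auto
  also have "(\<integral>\<^sup>+x. f x * indicator {c..<a+c} x \<partial>lborel) =
      (\<integral>\<^sup>+x. f (c + x) * indicator {c..<a+c} (c + x) \<partial>lborel)"
    by (rule nn_integral_lborel_translate[symmetric, where f="\<lambda>x. f x * indicator {c..<a+c} x"]) measurable
  also have "\<dots> = (\<integral>\<^sup>+x. f x * indicator {0..<a} x \<partial>lborel)"
    by (intro nn_integral_cong) (auto simp: indicator_def per add.commute[of c])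
  also have "(\<integral>\<^sup>+x. f x * indicator {a..<c} x \<partial>lborel) + \<dots> =
     (\<integral>\<^sup>+x. f x * indicator {a..<c} x + f x * indicator {0..<a} x \<partial>lborel)"
    by (rule nn_integral_add[symmetric]) auto
  also have "\<dots> = (\<integral>\<^sup>+x. f x * indicator {0..<c} x \<partial>lborel)"
    using a by (intro nn_integral_cong) (auto simp: indicator_def)
  finally show ?thesis .
qed

text \<open>No Jacobian enters: averaging \<open>f\<close> over all rotations leaves its integral
  unchanged, and the average \<open>K\<close> depends on \<open>|z|\<close> only, so the radial
  formula applies. In the coordinates \<open>t = |z|^2\<close> and \<theta> area is half of the
  product measure, hence the factor 2.\<close>

lemma nn_integral_lborel_polar:
  fixes f :: "complex \<Rightarrow> ennreal"
  assumes [measurable]: "f \<in> borel_measurable borel"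
  shows "2 * (\<integral>\<^sup>+z. f z \<partial>lborel) =
    (\<integral>\<^sup>+t. (\<integral>\<^sup>+\<theta>. f (of_real (sqrt t) * cis \<theta>) * indicator {0..<2*pi} \<theta> \<partial>lborel) * indicator {0..} t \<partial>lborel)"
proof -
  let ?I = "indicator {0..<2*pi} :: real \<Rightarrow> ennreal"
  define K where "K z = (\<integral>\<^sup>+\<theta>. f (z * cis \<theta>) * ?I \<theta> \<partial>lborel)" for z
  have cis_meas [measurable]: "cis \<in> borel_measurable borel"
    by (intro borel_measurable_continuous_onI continuous_intros)
  have meas [measurable]: "(\<lambda>(\<theta>,z). f (z * cis \<theta>) * ?I \<theta>) \<in> borel_measurable (lborel \<Otimes>\<^sub>M lborel)"
    unfolding case_prod_beta by measurable
  \<comment> \<open>Turning by \<open>Arg2pi z\<close> shifts the integrand in \<theta>, and an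
    integral over a full period does not see the shift.\<close>
  have radial: "K z = K (of_real (cmod z))" for z
  proof -
    have "0 \<le> Arg2pi z" "Arg2pi z \<le> 2 * pi" using Arg2pi[of z] by auto
    then have "(\<integral>\<^sup>+\<theta>. f (of_real (cmod z) * cis (Arg2pi z + \<theta>)) * ?I \<theta> \<partial>lborel) = K (of_real (cmod z))"
      unfolding K_def
      by (intro nn_integral_periodic_shift[where f="\<lambda>\<theta>. f (of_real (cmod z) * cis \<theta>)"])
        (measurable, simp_all add: cis_mult[symmetric])
    moreover have "of_real (cmod z) * cis (Arg2pi z + \<theta>) = z * cis \<theta>" for \<theta>
    proof -
      have "of_real (cmod z) * cis (Arg2pi z) = z"
        using Arg2pi_eq[of z] by (simp add: cis_conv_exp)
      then show ?thesis by (metis cis_mult mult.assoc)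
    qed
    ultimately show ?thesis unfolding K_def by simp
  qed
  have Kmeas [measurable]: "(\<lambda>t. K (of_real (sqrt t))) \<in> borel_measurable borel"
  proof -
    have [measurable]: "(\<lambda>(z,\<theta>). f (z * cis \<theta>) * ?I \<theta>) \<in> borel_measurable (borel \<Otimes>\<^sub>M lborel)"
      unfolding case_prod_beta by measurable
    have [measurable]: "K \<in> borel_measurable borel"
      unfolding K_def by (rule sigma_finite_measure.borel_measurable_nn_integral) (auto intro: sigma_finite_lborel)
    show ?thesis by measurable
  qed
  have "ennreal (2 * pi) * (\<integral>\<^sup>+z. f z \<partial>lborel) = (\<integral>\<^sup>+\<theta>. (\<integral>\<^sup>+z. f z \<partial>lborel) * ?I \<theta> \<partial>lborel)"
    by (simp add: nn_integral_cmult mult.commute)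
  also have "\<dots> = (\<integral>\<^sup>+\<theta>. (\<integral>\<^sup>+z. f (z * cis \<theta>) * ?I \<theta> \<partial>lborel) \<partial>lborel)"
  proof (rule nn_integral_cong)
    fix \<theta> :: real
    have "(\<integral>\<^sup>+z. f (z * cis \<theta>) \<partial>lborel) = (\<integral>\<^sup>+z. f z \<partial>lborel)"
      using nn_integral_lborel_rotate[of f "cis \<theta>"] by (simp add: mult.commute)
    then show "(\<integral>\<^sup>+z. f z \<partial>lborel) * ?I \<theta> = (\<integral>\<^sup>+z. f (z * cis \<theta>) * ?I \<theta> \<partial>lborel)"
      by (simp add: nn_integral_multc)
  qed
  also have "\<dots> = (\<integral>\<^sup>+z. K z \<partial>lborel)"
    unfolding K_def by (rule lborel_pair.Fubini'[OF meas, symmetric])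
  also have "\<dots> = (\<integral>\<^sup>+z. K (of_real (sqrt ((cmod z)\<^sup>2))) \<partial>lborel)"
    by (intro nn_integral_cong) (metis radial abs_norm_cancel real_sqrt_abs)
  also have "\<dots> = ennreal pi * (\<integral>\<^sup>+t. K (of_real (sqrt t)) * indicator {0..} t \<partial>lborel)"
    by (rule nn_integral_lborel_radial) measurable
  finally have "ennreal pi * (2 * (\<integral>\<^sup>+z. f z \<partial>lborel)) = ennreal pi * (\<integral>\<^sup>+t. K (of_real (sqrt t)) * indicator {0..} t \<partial>lborel)"
    by (simp add: ennreal_mult' mult.assoc mult.left_commute)
  then have "2 * (\<integral>\<^sup>+z. f z \<partial>lborel) = (\<integral>\<^sup>+t. K (of_real (sqrt t)) * indicator {0..} t \<partial>lborel)"
    by (simp add: ennreal_mult_cancel_left)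
  then show ?thesis unfolding K_def by simp
qed

text \<open>Fubini and the symmetry of \<open>w \<in> ball z r\<close> in its two points. This is
  how estimates by integrals over discs of fixed radius become global.\<close>

lemma nn_integral_ball_average:
  fixes H :: "complex \<Rightarrow> ennreal"
  assumes [measurable]: "H \<in> borel_measurable borel" and r: "r \<ge> 0"
  shows "(\<integral>\<^sup>+z. (\<integral>\<^sup>+w. H w * indicator (ball z r) w \<partial>lborel) \<partial>lborel)
     = ennreal (pi * r\<^sup>2) * (\<integral>\<^sup>+z. H z \<partial>lborel)"
proof -
  have meas: "(\<lambda>(z,w). H w * indicator (ball 0 r) (w - z)) \<in> borel_measurable (lborel \<Otimes>\<^sub>M lborel)"
    unfolding case_prod_beta indicator_def mem_ball_0 by measurable
  have ind: "(indicator (ball 0 r) (w - z) :: ennreal) = indicator (ball z r) w" for z w :: complex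
    by (auto simp: indicator_def dist_norm norm_minus_commute)
  have "(\<integral>\<^sup>+z. (\<integral>\<^sup>+w. H w * indicator (ball z r) w \<partial>lborel) \<partial>lborel)
     = (\<integral>\<^sup>+w. (\<integral>\<^sup>+z. H w * indicator (ball z r) w \<partial>lborel) \<partial>lborel)"
    by (rule lborel_pair.Fubini'[OF meas, symmetric, unfolded ind])
  also have "\<dots> = (\<integral>\<^sup>+w. (\<integral>\<^sup>+z. H w * indicator (ball w r) z \<partial>lborel) \<partial>lborel)"
    by (intro nn_integral_cong) (auto simp: indicator_def dist_commute)
  also have "\<dots> = (\<integral>\<^sup>+w. H w * ennreal (pi * r\<^sup>2) \<partial>lborel)"
    using r by (intro nn_integral_cong)
      (simp add: nn_integral_cmult_indicator emeasure_lborel_ball_complex)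
  finally show ?thesis by (simp add: nn_integral_multc mult.commute)
qed

section \<open>Sub-mean value property for powers of holomorphic functions\<close>

lemma indicator_ball_measurable [measurable]:
  "(indicator (ball w r) :: complex \<Rightarrow> ennreal) \<in> borel_measurable borel"
  by (rule borel_measurable_indicator) auto

lemma distr_lborel_rotate:
  assumes "cmod c = 1"
  shows "distr lborel borel ((*) c) = (lborel :: complex measure)"
proof (rule measure_eqI)
  fix A :: "complex set" assume "A \<in> sets (distr lborel borel ((*) c))"
  then have A: "A \<in> sets borel" by simp
  have "emeasure (distr lborel borel ((*) c)) A = (\<integral>\<^sup>+z. indicator A z \<partial>distr lborel borel ((*) c))"
    using A by simp
  also have "\<dots> = (\<integral>\<^sup>+z. indicator A (c * z) \<partial>lborel)"
    using A by (subst nn_integral_distr) auto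
  also have "\<dots> = (\<integral>\<^sup>+z. indicator A z \<partial>lborel)"
    using A assms by (intro nn_integral_lborel_rotate) auto
  finally show "emeasure (distr lborel borel ((*) c)) A = emeasure lborel A" using A by simp
qed simp

lemma integral_lborel_rotate:
  fixes f :: "complex \<Rightarrow> complex"
  assumes [measurable]: "f \<in> borel_measurable borel" and "cmod c = 1"
  shows "(LINT z|lborel. f (c * z)) = (LINT z|lborel. f z)"
proof -
  have "(LINT z|lborel. f z) = (LINT z|distr lborel borel ((*) c). f z)"
    by (simp add: distr_lborel_rotate assms)
  also have "\<dots> = (LINT z|lborel. f (c * z))"
    by (subst integral_distr) auto
  finally show ?thesis by simp
qed

text \<open>Rotation by a \<open>c\<close> with \<open>c ^ k * cnj c ^ n = -1\<close> turns the
  integral into its own negative.\<close>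

lemma integral_monomials_radial:
  fixes W :: "complex \<Rightarrow> complex"
  assumes [measurable]: "W \<in> borel_measurable borel"
    and W: "\<And>c z. cmod c = 1 \<Longrightarrow> W (c * z) = W z" and "k \<noteq> n"
  shows "(LINT z|lborel. z ^ k * cnj z ^ n * W z) = 0"
proof -
  define c where "c = cis (pi / (real k - real n))"
  let ?I = "LINT z|lborel. z ^ k * cnj z ^ n * W z"
  have c: "cmod c = 1" by (simp add: c_def)
  have [measurable]: "cnj \<in> borel_measurable borel"
    by (intro borel_measurable_continuous_onI continuous_intros)
  have "c ^ k * cnj c ^ n = cis (real k * (pi / (real k - real n)) - real n * (pi / (real k - real n)))"
    by (simp only: c_def Complex.DeMoivre cis_cnj cis_mult mult_minus_right add_uminus_conv_diff)
  also have "real k * (pi / (real k - real n)) - real n * (pi / (real k - real n)) = pi"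
    using \<open>k \<noteq> n\<close> by (simp only: left_diff_distrib[symmetric]) simp
  finally have m1: "c ^ k * cnj c ^ n = -1" by simp
  have "?I = (LINT z|lborel. (c * z) ^ k * cnj (c * z) ^ n * W (c * z))"
    by (rule integral_lborel_rotate[symmetric, OF _ c]) measurable
  also have "\<dots> = (LINT z|lborel. (c ^ k * cnj c ^ n) * (z ^ k * cnj z ^ n * W z))"
    unfolding W[OF c] by (simp add: power_mult_distrib mult_ac)
  also have "\<dots> = - ?I" by (simp add: m1)
  finally show ?thesis by simp
qed

lemma entire_power_series:
  assumes "f holomorphic_on UNIV"
  shows "(\<lambda>n. (deriv ^^ n) f 0 / fact n * z ^ n) sums f z"
  using holomorphic_power_series[of f 0 "cmod z + 1" z] assms holomorphic_on_subset by force

lemma entire_power_series_abs_summable: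
  assumes "f holomorphic_on UNIV"
  shows "summable (\<lambda>n. cmod ((deriv ^^ n) f 0 / fact n) * R ^ n)"
proof -
  have "summable (\<lambda>n. (deriv ^^ n) f 0 / fact n * (of_real (\<bar>R\<bar> + 1)) ^ n)"
    using entire_power_series[OF assms] sums_summable by blast
  then have "summable (\<lambda>n. cmod ((deriv ^^ n) f 0 / fact n * (of_real R) ^ n))"
    by (rule powser_insidea) (auto simp: norm_of_real)
  then have *: "summable (\<lambda>n. cmod ((deriv ^^ n) f 0 / fact n) * \<bar>R\<bar> ^ n)"
    by (simp only: norm_mult norm_power norm_of_real)
  show ?thesis
    by (rule summable_comparison_test'[OF *, of 0]) (simp add: abs_mult power_abs)
qed

text \<open>Orthogonality of the monomials, applied term by term to the Taylor series; on a bounded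
  disc dominated convergence justifies the exchange. It is used twice: with \<open>n = 0\<close> and
  \<open>W = 1\<close> for the mean value property, and with the weight of the Hilbert space, on
  growing discs, for inner products with monomials.\<close>

lemma integral_disc_coefficient:
  fixes W :: "complex \<Rightarrow> complex"
  assumes f: "f holomorphic_on UNIV" and W_cont: "continuous_on UNIV W"
    and W: "\<And>c z. cmod c = 1 \<Longrightarrow> W (c * z) = W z"
  shows "(LINT z:ball 0 R|lborel. f z * cnj z ^ n * W z) =
    (deriv ^^ n) f 0 / fact n * (LINT z:ball 0 R|lborel. z ^ n * cnj z ^ n * W z)"
proof -
  define a where "a n = (deriv ^^ n) f 0 / fact n" for n
  \<comment> \<open>The indicator of the disc is moved into the weight, which stays radial, so that
    \<open>integral_monomials_radial\<close> applies on the whole plane.\<close>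
  define WB where "WB z = W z * indicator (ball 0 R) z" for z
  have [measurable]: "W \<in> borel_measurable borel"
    by (rule borel_measurable_continuous_onI[OF W_cont])
  have [measurable]: "cnj \<in> borel_measurable borel"
    by (intro borel_measurable_continuous_onI continuous_intros)
  have [measurable]: "f \<in> borel_measurable borel"
    by (rule borel_measurable_continuous_onI) (rule holomorphic_on_imp_continuous_on[OF f])
  have WBm [measurable]: "WB \<in> borel_measurable borel"
    unfolding WB_def by (intro borel_measurable_times borel_measurable_indicator) auto
  have WBr: "WB (c * z) = WB z" if "cmod c = 1" for c z
    using W[OF that] that by (auto simp: WB_def indicator_def norm_mult)
  have "compact (W ` cball 0 R)"
    using W_cont by (intro compact_continuous_image) (auto intro: continuous_on_subset)
  then obtain B where B: "\<And>z. z \<in> cball 0 R \<Longrightarrow> cmod (W z) \<le> B"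
    by (metis bounded_iff compact_imp_bounded imageI)
  have B': "cmod (W z) \<le> \<bar>B\<bar>" if "cmod z < R" for z
    using B[of z] that by simp
  have ind_int: "integrable lborel (\<lambda>z::complex. indicator (ball 0 R) z * C)" for C :: real
    by (cases "R > 0") (auto simp: emeasure_lborel_ball_complex ball_empty)
  have term_int: "integrable lborel (\<lambda>z. z ^ k * cnj z ^ n * WB z)" for k
  proof (rule Bochner_Integration.integrable_bound[OF ind_int[of "R ^ k * R ^ n * \<bar>B\<bar>"]])
    show "AE x in lborel. cmod (x ^ k * cnj x ^ n * WB x) \<le> norm (indicator (ball 0 R) x * (R ^ k * R ^ n * \<bar>B\<bar>))"
      using B' by (intro AE_I2) (auto simp: WB_def indicator_def norm_mult norm_power abs_mult power_abs
          intro!: mult_mono power_mono)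
  qed measurable
  define S where "S N z = (\<Sum>k<N. a k * z ^ k) * cnj z ^ n * WB z" for N z
  \<comment> \<open>\<open>M\<close> bounds every Taylor partial sum on the disc, which makes a
    constant dominating function possible.\<close>
  define M where "M = (\<Sum>k. cmod (a k) * R ^ k)"
  have "(\<lambda>N. LINT z|lborel. S N z) \<longlonglongrightarrow> (LINT z|lborel. f z * cnj z ^ n * WB z)"
  proof (rule integral_dominated_convergence[where w="\<lambda>z. indicator (ball 0 R) z * (M * R ^ n * \<bar>B\<bar>)"])
    show "integrable lborel (\<lambda>z::complex. indicator (ball 0 R) z * (M * R ^ n * \<bar>B\<bar>))"
      by (rule ind_int)
    show "AE z in lborel. (\<lambda>N. S N z) \<longlonglongrightarrow> f z * cnj z ^ n * WB z"
      unfolding S_def using entire_power_series[OF f]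
      by (intro AE_I2 tendsto_mult tendsto_const) (simp add: sums_def a_def)
    show "AE z in lborel. cmod (S N z) \<le> indicator (ball 0 R) z * (M * R ^ n * \<bar>B\<bar>)" for N
    proof (intro AE_I2)
      fix z
      show "cmod (S N z) \<le> indicator (ball 0 R) z * (M * R ^ n * \<bar>B\<bar>)"
      proof (cases "cmod z < R")
        case True
        have R: "R \<ge> 0" using True by (meson dual_order.trans less_imp_le norm_ge_zero)
        have "cmod (\<Sum>k<N. a k * z ^ k) \<le> (\<Sum>k<N. cmod (a k) * R ^ k)"
          using True by (intro order.trans[OF norm_sum] sum_mono) (auto simp: norm_mult norm_power intro!: mult_left_mono power_mono)
        also have "\<dots> \<le> M"
          unfolding M_def a_def using R
          by (intro sum_le_suminf entire_power_series_abs_summable[OF f]) auto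
        finally have 1: "cmod (\<Sum>k<N. a k * z ^ k) \<le> M" .
        have 2: "cmod (cnj z ^ n) \<le> R ^ n" using True by (auto simp: norm_power intro!: power_mono)
        have "cmod (S N z) \<le> M * R ^ n * \<bar>B\<bar>"
          unfolding S_def norm_mult using 1 2 B'[OF True] True R
          by (intro mult_mono mult_nonneg_nonneg) (auto simp: WB_def intro: order.trans[OF norm_ge_zero])
        then show ?thesis using True by simp
      qed (simp add: S_def WB_def)
    qed
  qed (auto simp: S_def)
  moreover have "(\<lambda>N. LINT z|lborel. S N z) \<longlonglongrightarrow> a n * (LINT z|lborel. z ^ n * cnj z ^ n * WB z)"
  proof (rule tendsto_eventually, rule eventually_mono[OF eventually_gt_at_top[of n]])
    fix N assume N: "n < N"
    have "(LINT z|lborel. S N z) = (LINT z|lborel. (\<Sum>k<N. a k * (z ^ k * cnj z ^ n * WB z)))"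
      unfolding S_def by (simp add: sum_distrib_right mult.assoc)
    also have "\<dots> = (\<Sum>k<N. a k * (LINT z|lborel. z ^ k * cnj z ^ n * WB z))"
      by (subst Bochner_Integration.integral_sum) (auto simp: term_int)
    also have "\<dots> = (\<Sum>k<N. if k = n then a n * (LINT z|lborel. z ^ n * cnj z ^ n * WB z) else 0)"
      using integral_monomials_radial[OF WBm WBr] by (intro sum.cong) auto
    also have "\<dots> = a n * (LINT z|lborel. z ^ n * cnj z ^ n * WB z)"
      using N by simp
    finally show "(LINT z|lborel. S N z) = a n * (LINT z|lborel. z ^ n * cnj z ^ n * WB z)" .
  qed
  ultimately have "(LINT z|lborel. f z * cnj z ^ n * WB z) = a n * (LINT z|lborel. z ^ n * cnj z ^ n * WB z)"
    using LIMSEQ_unique by blast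
  moreover have "indicator (ball 0 R) z *\<^sub>R (v * W z) = v * WB z" for v z
    by (auto simp: WB_def indicator_def)
  ultimately show ?thesis
    unfolding set_lebesgue_integral_def a_def by simp
qed

text \<open>The translate \<open>F\<close> has constant Taylor coefficient \<open>f w\<close>, which
  \<open>integral_disc_coefficient\<close> extracts with \<open>n = 0\<close> and
  \<open>W = 1\<close>.\<close>

lemma area_mean_value_le:
  assumes f: "f holomorphic_on UNIV" and d: "d > 0"
  shows "ennreal (pi * d\<^sup>2 * cmod (f w)) \<le> (\<integral>\<^sup>+z. ennreal (cmod (f z)) * indicator (ball w d) z \<partial>lborel)"
proof -
  define F where "F z = f (w + z)" for z
  have F: "F holomorphic_on UNIV"
  proof -
    have "(f \<circ> (\<lambda>z. w + z)) holomorphic_on UNIV"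
      by (rule holomorphic_on_compose_gen[OF _ f]) (auto intro!: holomorphic_intros)
    then show ?thesis unfolding F_def o_def .
  qed
  have Fc: "continuous_on UNIV F" by (rule holomorphic_on_imp_continuous_on[OF F])
  have [measurable]: "F \<in> borel_measurable borel" "f \<in> borel_measurable borel"
    using holomorphic_on_imp_continuous_on[OF f] Fc by (auto intro: borel_measurable_continuous_onI)
  have meas: "emeasure lborel (ball (0::complex) d) = ennreal (pi * d\<^sup>2)"
    using d by (simp add: emeasure_lborel_ball_complex)
  have "(LINT z:ball 0 d|lborel. F z) = F 0 * (LINT z:ball (0::complex) d|lborel. (1::complex))"
    using integral_disc_coefficient[OF F, of "\<lambda>_. 1" d 0] by simp
  also have "(LINT z:ball (0::complex) d|lborel. (1::complex)) = of_real (pi * d\<^sup>2)"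
    unfolding set_lebesgue_integral_def using meas
    by (simp add: measure_def scaleR_conv_of_real)
  finally have "cmod (LINT z:ball 0 d|lborel. F z) = pi * d\<^sup>2 * cmod (f w)"
    by (simp add: F_def norm_mult norm_power)
  then have "ennreal (pi * d\<^sup>2 * cmod (f w)) = ennreal (cmod (LINT z:ball 0 d|lborel. F z))" by simp
  also have "\<dots> \<le> (\<integral>\<^sup>+z. ennreal (cmod (indicator (ball 0 d) z *\<^sub>R F z)) \<partial>lborel)"
    unfolding set_lebesgue_integral_def
  proof (rule integral_norm_bound_ennreal)
    have "compact (F ` cball 0 d)"
      using Fc by (intro compact_continuous_image) (auto intro: continuous_on_subset)
    then obtain B where B: "\<And>z. z \<in> cball 0 d \<Longrightarrow> cmod (F z) \<le> B"
      by (metis bounded_iff compact_imp_bounded imageI)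
    show "integrable lborel (\<lambda>z. indicator (ball 0 d) z *\<^sub>R F z)"
    proof (rule Bochner_Integration.integrable_bound[of _ "\<lambda>z::complex. indicator (ball 0 d) z * \<bar>B\<bar>"])
      show "integrable lborel (\<lambda>z::complex. indicator (ball 0 d) z * \<bar>B\<bar>)"
        using meas by (auto simp: less_top)
      show "AE z in lborel. cmod (indicator (ball 0 d) z *\<^sub>R F z) \<le> norm (indicator (ball 0 d) z * \<bar>B\<bar>)"
      proof (intro AE_I2)
        fix z
        show "cmod (indicator (ball 0 d) z *\<^sub>R F z) \<le> norm (indicator (ball 0 d) z * \<bar>B\<bar>)"
          using B[of z] by (auto simp: indicator_def)
      qed
    qed (intro borel_measurable_scaleR borel_measurable_indicator, auto)
  qed
  also have "\<dots> = (\<integral>\<^sup>+z. ennreal (cmod (f (w + z))) * indicator (ball w d) (w + z) \<partial>lborel)"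
    by (intro nn_integral_cong) (auto simp: F_def indicator_def dist_norm)
  also have "\<dots> = (\<integral>\<^sup>+z. ennreal (cmod (f z)) * indicator (ball w d) z \<partial>lborel)"
    by (rule nn_integral_lborel_translate[where f="\<lambda>z. ennreal (cmod (f z)) * indicator (ball w d) z"])
      measurable
  finally show ?thesis .
qed

text \<open>
  The area mean value property gives the case \<open>p = 1\<close>. For \<open>p > 1\<close> it is combined with
  \<open>t \<le> l powr (1 - p) * t powr p + l\<close> for \<open>l = |f w| / 2\<close>, whose last term is absorbed.
\<close>

lemma power_submean_ge1:
  assumes f: "f holomorphic_on UNIV" and p: "p \<ge> 1"
  shows "ennreal (cmod (f w) powr p) \<le> ennreal (2 powr p) *
     (\<integral>\<^sup>+z. ennreal (cmod (f z) powr p) * indicator (ball w 1) z \<partial>lborel)" (is "_ \<le> _ * ?X")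
proof (cases "f w = 0 \<or> ?X = \<infinity>")
  case True
  then show ?thesis by (auto simp: ennreal_mult_top)
next
  case False
  then obtain x where x: "?X = ennreal x" "x \<ge> 0" by (cases ?X) auto
  define l where "l = cmod (f w) / 2"
  have l: "l > 0" using False by (simp add: l_def)
  have [measurable]: "f \<in> borel_measurable borel"
    using holomorphic_on_imp_continuous_on[OF f] by (auto intro: borel_measurable_continuous_onI)
  have key: "t \<le> l powr (1 - p) * t powr p + l" if "t \<ge> 0" for t
  proof (cases "t \<le> l")
    case False
    have "t powr (1 - p) \<le> l powr (1 - p)"
      using False l p by (intro powr_mono2') auto
    then have "t powr (1 - p) * t powr p \<le> l powr (1 - p) * t powr p"
      by (intro mult_right_mono) auto
    moreover have "t powr (1 - p) * t powr p = t"
      using False l by (simp add: powr_add[symmetric])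
    ultimately show ?thesis using l by linarith
  qed (use that l in \<open>auto intro: add_increasing\<close>)
  have "ennreal (pi * cmod (f w)) \<le> (\<integral>\<^sup>+z. ennreal (cmod (f z)) * indicator (ball w 1) z \<partial>lborel)"
    using area_mean_value_le[OF f, of 1 w] by simp
  also have "\<dots> \<le> (\<integral>\<^sup>+z. ennreal (l powr (1 - p)) * (ennreal (cmod (f z) powr p) * indicator (ball w 1) z)
      + ennreal l * indicator (ball w 1) z \<partial>lborel)"
    using l key by (intro nn_integral_mono) (auto simp: indicator_def ennreal_mult[symmetric] ennreal_plus[symmetric] simp del: ennreal_plus)
  also have "\<dots> = ennreal (l powr (1 - p)) * ?X + ennreal l * ennreal pi"
    using l by (simp add: nn_integral_add nn_integral_cmult emeasure_lborel_ball_complex)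
  also have "\<dots> = ennreal (l powr (1 - p) * x + l * pi)"
    using l x by (simp add: ennreal_mult)
  finally have "pi * cmod (f w) \<le> l powr (1 - p) * x + l * pi"
    using l x by (subst (asm) ennreal_le_iff) auto
  then have "pi * l \<le> l powr (1 - p) * x" by (simp add: l_def field_simps)
  then have "pi * l * l powr (p - 1) \<le> l powr (1 - p) * x * l powr (p - 1)"
    by (rule mult_right_mono) simp
  also have "\<dots> = x" using l by (simp add: powr_add[symmetric] mult.assoc mult.left_commute)

  finally have "pi * (l * l powr (p - 1)) \<le> x" by (simp add: mult.assoc)
  moreover have "l * l powr (p - 1) = l powr p" using l by (simp add: powr_mult_base)
  ultimately have "pi * l powr p \<le> x" by simp
  then have "l powr p \<le> x"
    using pi_ge_two mult_right_mono[of 1 pi "l powr p"] by (simp add: order.trans)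
  then have "2 powr p * l powr p \<le> 2 powr p * x" by simp
  moreover have "2 powr p * l powr p = cmod (f w) powr p"
    using l by (simp add: powr_mult[symmetric] l_def)
  ultimately show ?thesis using x by (simp add: ennreal_mult[symmetric])
qed

text \<open>
  Hardy and Littlewood's argument: at a point where \<open>|f|^p\<close> times the squared distance to the
  boundary of the disc is maximal, \<open>|f|\<close> dominates, up to a constant, its values on the disc
  reaching half-way to the boundary.
\<close>

lemma power_submean_less1:
  assumes f: "f holomorphic_on UNIV" and p: "0 < p" "p < 1"
  shows "ennreal (cmod (f w) powr p) \<le> ennreal (4 powr (1/p)) *
     (\<integral>\<^sup>+z. ennreal (cmod (f z) powr p) * indicator (ball w 1) z \<partial>lborel)" (is "_ \<le> _ * ?X")
proof -
  \<comment> \<open>The exponent 2 matches the area of the disc of radius \<open>D / 2\<close> used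
    below, so that the mean value inequality at the maximum point reassembles to
    \<open>Q z0\<close>.\<close>
  define Q where "Q z = cmod (f z) powr p * (1 - cmod (z - w))\<^sup>2" for z
  have fc: "continuous_on UNIV f" by (rule holomorphic_on_imp_continuous_on[OF f])
  have "continuous_on (cball w 1) Q"
    unfolding Q_def using p by (intro continuous_intros continuous_on_powr' continuous_on_subset[OF fc]) auto
  then obtain z0 where z0: "z0 \<in> cball w 1" "\<And>z. z \<in> cball w 1 \<Longrightarrow> Q z \<le> Q z0"
    using continuous_attains_sup[of "cball w 1" Q] by auto
  have Qw: "cmod (f w) powr p = Q w" by (simp add: Q_def)
  show ?thesis
  proof (cases "Q z0 \<le> 0 \<or> ?X = \<infinity>")
    case True
    moreover have "cmod (f w) powr p \<le> Q z0" using z0(2)[of w] Qw by simp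
    ultimately show ?thesis
      by (auto simp: ennreal_mult_top ennreal_neg dest: order.trans)
  next
    case False
    then obtain x where x: "?X = ennreal x" "x \<ge> 0" by (cases ?X) auto
    define D where "D = 1 - cmod (z0 - w)"
    define a where "a = cmod (f z0)"
    have D: "D > 0" and a: "a > 0"
      using False z0(1) by (auto simp: Q_def D_def a_def dist_norm norm_minus_commute less_le)
    have sub: "ball z0 (D/2) \<subseteq> ball w 1"
    proof
      fix z assume "z \<in> ball z0 (D/2)"
      then have "cmod (z - z0) < D / 2" by (simp add: dist_norm norm_minus_commute)
      then show "z \<in> ball w 1"
        using norm_triangle_ineq[of "z - z0" "z0 - w"] D by (simp add: dist_norm norm_minus_commute D_def)
    qed
    \<comment> \<open>Halving the distance to the boundary costs a factor 4 in \<open>Q\<close>, so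
      \<open>|f|\<close> is at most \<open>4 powr (1/p) * a\<close> on this disc; this bound then
      replaces the factor \<open>|f| powr (1 - p)\<close> of \<open>|f|\<close>.\<close>
    have key: "cmod (f z) \<le> (4 powr (1/p) * a) powr (1 - p) * cmod (f z) powr p" if z: "z \<in> ball z0 (D/2)" for z
    proof -
      have "cmod (z - z0) < D / 2" using z by (simp add: dist_norm norm_minus_commute)
      then have "D / 2 \<le> 1 - cmod (z - w)"
        using norm_triangle_ineq[of "z - z0" "z0 - w"] by (simp add: D_def)
      then have "(D/2)\<^sup>2 \<le> (1 - cmod (z - w))\<^sup>2" using D by (intro power_mono) auto
      then have "cmod (f z) powr p * (D/2)\<^sup>2 \<le> Q z"
        unfolding Q_def by (intro mult_left_mono) auto
      also have "\<dots> \<le> Q z0" using z sub by (intro z0(2)) (use ball_subset_cball in blast)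
      also have "\<dots> = (4 * a powr p) * (D/2)\<^sup>2" by (simp add: Q_def a_def D_def power2_eq_square)
      finally have "cmod (f z) powr p \<le> 4 * a powr p" using D by simp
      then have "(cmod (f z) powr p) powr (1/p) \<le> (4 * a powr p) powr (1/p)"
        using p by (intro powr_mono2) auto
      then have *: "cmod (f z) \<le> 4 powr (1/p) * a"
        using p a by (simp add: powr_powr powr_mult)
      have "cmod (f z) = cmod (f z) powr (1 - p) * cmod (f z) powr p"
        by (cases "f z = 0") (simp_all add: powr_add[symmetric])
      also have "\<dots> \<le> (4 powr (1/p) * a) powr (1 - p) * cmod (f z) powr p"
        using * p by (intro mult_right_mono powr_mono2) auto
      finally show ?thesis .
    qed
    let ?c = "(4 powr (1/p) * a) powr (1 - p)"
    have [measurable]: "f \<in> borel_measurable borel"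
      using fc by (auto intro: borel_measurable_continuous_onI)
    have "ennreal (pi * (D/2)\<^sup>2 * a) \<le> (\<integral>\<^sup>+z. ennreal (cmod (f z)) * indicator (ball z0 (D/2)) z \<partial>lborel)"
      unfolding a_def using area_mean_value_le[OF f, of "D/2" z0] D by simp
    also have "\<dots> \<le> (\<integral>\<^sup>+z. ennreal ?c * (ennreal (cmod (f z) powr p) * indicator (ball w 1) z) \<partial>lborel)"
      using key sub by (intro nn_integral_mono) (auto simp: indicator_def ennreal_mult[symmetric])
    also have "\<dots> = ennreal (?c * x)"
      using x by (simp add: nn_integral_cmult ennreal_mult)
    finally have "pi * (D/2)\<^sup>2 * a \<le> ?c * x"
      using x by (subst (asm) ennreal_le_iff) auto
    also have "?c = 4 powr (1/p - 1) * a powr (1 - p)"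
      using p a by (simp add: powr_mult powr_powr field_simps)
    finally have "pi * (D/2)\<^sup>2 * a * a powr (p - 1) \<le> 4 powr (1/p - 1) * a powr (1 - p) * x * a powr (p - 1)"
      by (rule mult_right_mono) simp
    also have "\<dots> = 4 powr (1/p - 1) * x * (a powr (1 - p) * a powr (p - 1))" by simp
    also have "\<dots> = 4 powr (1/p - 1) * x" using a by (simp add: powr_add[symmetric])
    also have "pi * (D/2)\<^sup>2 * a * a powr (p - 1) = pi * (D/2)\<^sup>2 * a powr p"
      using a by (simp add: powr_mult_base mult.assoc)
    also have "\<dots> = pi * (Q z0 / 4)" by (simp add: Q_def a_def D_def power2_eq_square)
    finally have "pi * Q z0 \<le> 4 * (4 powr (1/p - 1) * x)" by simp
    also have "4 * (4 powr (1/p - 1) * x) = 4 powr (1/p) * x"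
      by (simp add: powr_diff)
    finally have "pi * Q z0 \<le> 4 powr (1/p) * x" .
    moreover have "1 * Q z0 \<le> pi * Q z0"
      using False pi_ge_two by (intro mult_right_mono) auto
    ultimately have "cmod (f w) powr p \<le> 4 powr (1/p) * x"
      using z0(2)[of w] Qw by simp
    then show ?thesis using x by (simp add: ennreal_mult[symmetric])
  qed
qed

lemma power_submean:
  assumes "p > 0"
  obtains C where "C > 0" "\<And>f w. f holomorphic_on UNIV \<Longrightarrow> ennreal (cmod (f w) powr p) \<le> ennreal C *
     (\<integral>\<^sup>+z. ennreal (cmod (f z) powr p) * indicator (ball w 1) z \<partial>lborel)"
proof (cases "p \<ge> 1")
  case True
  with power_submean_ge1 that[of "2 powr p"] show ?thesis by simp
next
  case False
  with power_submean_less1 that[of "4 powr (1/p)"] assms show ?thesis by simp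
qed

section \<open>Local estimates in the weighted spaces\<close>

text \<open>This is \<open>exp (- psi m z)\<close> with the logarithm resolved into a power, as
  \<open>exp_psi\<close> shows.\<close>

definition wt :: "nat \<Rightarrow> complex \<Rightarrow> real" where
  "wt m z = exp (- (cmod z)\<^sup>2 / 2) * (1 + cmod z) ^ m"

lemma wt_pos [simp]: "wt m z > 0"
  unfolding wt_def by (intro mult_pos_pos zero_less_power) (auto intro: add_pos_nonneg)

lemma wt_nonneg [simp]: "wt m z \<ge> 0"
  using wt_pos[of m z] by linarith

lemma continuous_on_wt [continuous_intros]: "continuous_on S f \<Longrightarrow> continuous_on S (\<lambda>z. wt m (f z))"
  unfolding wt_def by (intro continuous_intros) auto

lemma borel_measurable_wt [measurable]: "wt m \<in> borel_measurable borel"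
  by (intro borel_measurable_continuous_onI continuous_intros)

abbreviation fw :: "nat \<Rightarrow> real \<Rightarrow> (complex \<Rightarrow> complex) \<Rightarrow> complex \<Rightarrow> ennreal" where
  "fw m p f z \<equiv> ennreal ((cmod (f z) * wt m z) powr p)"

text \<open>For the derivative of an entire function vanishing at 0 this is the integrand of the
  equivalent norm. For a function itself it is, up to a constant, what an operator with affine
  symbol makes of it.\<close>

abbreviation dw :: "nat \<Rightarrow> real \<Rightarrow> (complex \<Rightarrow> complex) \<Rightarrow> complex \<Rightarrow> ennreal" where
  "dw m p f z \<equiv> ennreal ((cmod (f z) * wt m z / (1 + cmod z)) powr p)"

lemma exp_psi: "exp (- p * psi m z) = wt m z powr p"
proof -
  have "exp (- psi m z) = wt m z"
  proof -
    have "- psi m z = - (cmod z)\<^sup>2 / 2 + real m * ln (1 + cmod z)" by (simp add: psi_def)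
    moreover have "exp (real m * ln (1 + cmod z)) = (1 + cmod z) ^ m"
      by (simp add: exp_of_nat_mult add_pos_nonneg)
    ultimately show ?thesis by (simp only: exp_add wt_def)
  qed
  then have "wt m z powr p = exp (- psi m z) powr p" by simp
  also have "\<dots> = exp (- p * psi m z)" by (simp add: exp_powr_real)
  finally show ?thesis by simp
qed

lemma fs_integral_wt: "fs_integral p m f = (\<integral>\<^sup>+z. fw m p f z \<partial>lborel)"
  unfolding fs_integral_def exp_psi by (simp add: powr_mult)

lemma entire_measurable: "f holomorphic_on UNIV \<Longrightarrow> f \<in> borel_measurable borel"
  by (rule borel_measurable_continuous_onI[OF holomorphic_on_imp_continuous_on])

text \<open>Polynomial factors at two points can thus be exchanged at a cost depending only on their
  distance.\<close>

lemma one_plus_norm_le: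
  fixes z w :: complex
  shows "1 + cmod z \<le> (1 + cmod (z - w)) * (1 + cmod w)"
proof -
  have "cmod z \<le> cmod (z - w) + cmod w" using norm_triangle_ineq[of "z - w" w] by simp
  moreover have "0 \<le> cmod (z - w) * cmod w" by simp
  ultimately show ?thesis unfolding distrib_left distrib_right mult_1 mult_1_right by linarith
qed

text \<open>On a unit disc around \<open>w\<close> the Gaussian varies by factors that are unbounded
  in \<open>w\<close>, so the unweighted estimate is applied to
  \<open>f z * exp (- cnj w * z)\<close> instead. Completing the square, the modulus of this
  exponential times \<open>exp ((cmod w)\<^sup>2 / 2)\<close> is the Gaussian at \<open>z\<close>
  times \<open>exp ((cmod (z - w))\<^sup>2 / 2)\<close>, and the last factor is bounded on the disc.
  Hence \<open>C\<close> does not depend on \<open>w\<close>.\<close>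

lemma pointwise_local:
  assumes p: "p > 0"
  obtains C where "C > 0" "\<And>f w. f holomorphic_on UNIV \<Longrightarrow>
     fw m p f w \<le> ennreal C *
     (\<integral>\<^sup>+z. fw m p f z * indicator (ball w 1) z \<partial>lborel)"
proof -
  obtain C where C: "C > 0" "\<And>f w. f holomorphic_on UNIV \<Longrightarrow> ennreal (cmod (f w) powr p) \<le> ennreal C *
     (\<integral>\<^sup>+z. ennreal (cmod (f z) powr p) * indicator (ball w 1) z \<partial>lborel)"
    using power_submean[OF p] by blast
  define E where "E = (exp (1/2) * 2 ^ m :: real)"
  have E: "E > 0" by (simp add: E_def)
  show thesis
  proof (rule that[of "C * E powr p"])
    show "C * E powr p > 0" using C E by simp
  next
    fix f w assume f: "f holomorphic_on UNIV"
    define F where "F z = f z * exp (- cnj w * z)" for z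
    define \<kappa> where "\<kappa> = exp ((cmod w)\<^sup>2 / 2) * (1 + cmod w) ^ m"
    have F: "F holomorphic_on UNIV" unfolding F_def by (intro holomorphic_intros f)
    note [measurable] = entire_measurable[OF f] entire_measurable[OF F]
    have k0: "\<kappa> > 0" unfolding \<kappa>_def by (intro mult_pos_pos zero_less_power) (auto intro: add_pos_nonneg)
    have sq: "- Re (cnj w * z) = (cmod (z - w))\<^sup>2 / 2 - (cmod z)\<^sup>2 / 2 - (cmod w)\<^sup>2 / 2" for z
      unfolding cmod_power2 by (simp add: power2_eq_square field_simps)
    have FK: "cmod (F z) * \<kappa> = cmod (f z) * (exp ((cmod (z - w))\<^sup>2 / 2) * exp (- (cmod z)\<^sup>2 / 2)) * (1 + cmod w) ^ m" for z
    proof -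
      have "exp (- Re (cnj w * z)) * exp ((cmod w)\<^sup>2 / 2) = exp ((cmod (z - w))\<^sup>2 / 2) * exp (- (cmod z)\<^sup>2 / 2)"
        unfolding exp_add[symmetric] sq by simp
      moreover have "cmod (F z) = cmod (f z) * exp (- Re (cnj w * z))"
        by (simp add: F_def norm_mult norm_exp_eq_Re)
      ultimately show ?thesis unfolding \<kappa>_def by (simp add: mult.assoc)
    qed
    have FK1: "cmod (F w) * \<kappa> = cmod (f w) * wt m w" unfolding FK by (simp add: wt_def)
    have FK2: "cmod (F z) * \<kappa> \<le> E * (cmod (f z) * wt m z)" if z: "z \<in> ball w 1" for z
    proof -
      have z1: "cmod (z - w) \<le> 1" using z by (simp add: dist_norm norm_minus_commute)
      have a: "exp ((cmod (z - w))\<^sup>2 / 2) \<le> exp (1/2)"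
        using z1 by (simp add: power_le_one)
      have "1 + cmod w \<le> (1 + cmod (w - z)) * (1 + cmod z)" by (rule one_plus_norm_le)
      also have "\<dots> \<le> 2 * (1 + cmod z)"
        using z1 by (intro mult_right_mono) (auto simp: norm_minus_commute)
      finally have "(1 + cmod w) ^ m \<le> (2 * (1 + cmod z)) ^ m" by (intro power_mono) auto
      then have b: "(1 + cmod w) ^ m \<le> 2 ^ m * (1 + cmod z) ^ m" by (simp only: power_mult_distrib)
      have "cmod (F z) * \<kappa> \<le> cmod (f z) * (exp (1/2) * exp (- (cmod z)\<^sup>2 / 2)) * (2 ^ m * (1 + cmod z) ^ m)"
        unfolding FK using a b by (intro mult_mono) auto
      then show ?thesis by (simp add: E_def wt_def mult_ac)
    qed
    have "fw m p f w = ennreal (\<kappa> powr p) * ennreal (cmod (F w) powr p)"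
      unfolding FK1[symmetric] using k0 by (simp add: powr_mult ennreal_mult mult.commute)
    also have "\<dots> \<le> ennreal (\<kappa> powr p) * (ennreal C * (\<integral>\<^sup>+z. ennreal (cmod (F z) powr p) * indicator (ball w 1) z \<partial>lborel))"
      by (intro mult_left_mono C(2) F) auto
    also have "\<dots> = ennreal C * (\<integral>\<^sup>+z. ennreal (\<kappa> powr p) * (ennreal (cmod (F z) powr p) * indicator (ball w 1) z) \<partial>lborel)"
      by (simp add: nn_integral_cmult mult.left_commute)
    also have "\<dots> \<le> ennreal C * (\<integral>\<^sup>+z. ennreal (E powr p) * (fw m p f z * indicator (ball w 1) z) \<partial>lborel)"
    proof (intro mult_left_mono nn_integral_mono)
      fix z
      have "\<kappa> powr p * cmod (F z) powr p \<le> E powr p * (cmod (f z) * wt m z) powr p" if "z \<in> ball w 1"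
      proof -
        have "(cmod (F z) * \<kappa>) powr p \<le> (E * (cmod (f z) * wt m z)) powr p"
          using FK2[OF that] k0 p by (intro powr_mono2) auto
        then show ?thesis using k0 E by (simp add: powr_mult mult.commute)
      qed
      then show "ennreal (\<kappa> powr p) * (ennreal (cmod (F z) powr p) * indicator (ball w 1) z)
        \<le> ennreal (E powr p) * (fw m p f z * indicator (ball w 1) z)"
        by (auto simp: indicator_def ennreal_mult[symmetric])
    qed simp
    also have "\<dots> = ennreal (C * E powr p) * (\<integral>\<^sup>+z. fw m p f z * indicator (ball w 1) z \<partial>lborel)"
      using C by (simp add: nn_integral_cmult ennreal_mult mult.assoc)
    finally show "fw m p f w \<le> ennreal (C * E powr p) *
       (\<integral>\<^sup>+z. fw m p f z * indicator (ball w 1) z \<partial>lborel)" .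
  qed
qed

text \<open>Cauchy's inequality leads to a point \<open>v\<close> where \<open>|f|\<close> is
  maximal on the small disc. There \<open>|v|^2 \<le> |w|^2 + 2\<close>, so the weight at
  \<open>w\<close> exceeds that at \<open>v\<close> by a bounded factor only, and
  \<open>pointwise_local\<close> applies at \<open>v\<close>; its unit disc lies in
  \<open>ball w 2\<close>.\<close>

lemma deriv_local:
  assumes q: "q > 0"
  obtains C where "C > 0" "\<And>f w. f holomorphic_on UNIV \<Longrightarrow>
     dw m q (deriv f) w \<le> ennreal C *
     (\<integral>\<^sup>+z. fw m q f z * indicator (ball w 2) z \<partial>lborel)"
proof -
  obtain C where C: "C > 0" "\<And>f w. f holomorphic_on UNIV \<Longrightarrow>
     fw m q f w \<le> ennreal C *
     (\<integral>\<^sup>+z. fw m q f z * indicator (ball w 1) z \<partial>lborel)"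
    using pointwise_local[OF q] by blast
  define E where "E = (exp 1 * 2 ^ m :: real)"
  have E: "E > 0" by (simp add: E_def)
  show thesis
  proof (rule that[of "E powr q * C"])
    show "E powr q * C > 0" using C E by simp
  next
    fix f w assume f: "f holomorphic_on UNIV"
    define r where "r = 1 / (1 + cmod w)"
    have w1: "1 + cmod w > 0" by (simp add: add_pos_nonneg)
    have r: "r > 0" "r \<le> 1" using w1 by (auto simp: r_def)
    have fc: "continuous_on UNIV f" by (rule holomorphic_on_imp_continuous_on[OF f])
    have "continuous_on (cball w r) (\<lambda>z. cmod (f z))"
      by (intro continuous_intros continuous_on_subset[OF fc]) auto
    then obtain v where v: "v \<in> cball w r" "\<And>z. z \<in> cball w r \<Longrightarrow> cmod (f z) \<le> cmod (f v)"
      using continuous_attains_sup[of "cball w r" "\<lambda>z. cmod (f z)"] r by auto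
    have "cmod ((deriv ^^ 1) f w) \<le> fact 1 * cmod (f v) / r ^ 1"
    proof (rule Cauchy_inequality)
      show "f holomorphic_on ball w r" using f holomorphic_on_subset by blast
      show "continuous_on (cball w r) f" using fc continuous_on_subset by blast
      show "cmod (f x) \<le> cmod (f v)" if "cmod (w - x) = r" for x
        using that by (intro v(2)) (simp add: dist_norm)
    qed (use r in auto)
    then have d: "cmod (deriv f w) \<le> cmod (f v) * (1 + cmod w)" by (simp add: r_def)
    have vw: "cmod (v - w) \<le> r" using v(1) by (simp add: dist_norm norm_minus_commute)
    have wv: "wt m w \<le> E * wt m v"
    proof -
      have "cmod v \<le> cmod w + r" using norm_triangle_ineq[of "v - w" w] vw by simp
      then have "(cmod v)\<^sup>2 \<le> (cmod w + r)\<^sup>2" by (intro power_mono) auto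
      also have "\<dots> = (cmod w)\<^sup>2 + 2 * (cmod w * r) + r * r" by (simp add: power2_eq_square algebra_simps)
      also have "\<dots> \<le> (cmod w)\<^sup>2 + 2"
      proof -
        have "2 * (cmod w * r) + r * r \<le> 2 * (cmod w * r) + 2 * r" using r by (simp add: mult_le_one)
        also have "\<dots> = 2 * ((1 + cmod w) * r)" by (simp add: algebra_simps)
        also have "(1 + cmod w) * r = 1" using w1 by (simp add: r_def)
        finally show ?thesis by simp
      qed
      finally have "exp (- (cmod w)\<^sup>2 / 2) \<le> exp (1 + - (cmod v)\<^sup>2 / 2)" by simp
      then have a: "exp (- (cmod w)\<^sup>2 / 2) \<le> exp 1 * exp (- (cmod v)\<^sup>2 / 2)" by (simp only: exp_add)
      have "1 + cmod w \<le> (1 + cmod (w - v)) * (1 + cmod v)" by (rule one_plus_norm_le)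
      also have "\<dots> \<le> 2 * (1 + cmod v)"
        using vw r by (intro mult_right_mono) (auto simp: norm_minus_commute)
      finally have "(1 + cmod w) ^ m \<le> (2 * (1 + cmod v)) ^ m" by (intro power_mono) auto
      then have b: "(1 + cmod w) ^ m \<le> 2 ^ m * (1 + cmod v) ^ m" by (simp only: power_mult_distrib)
      have "wt m w \<le> (exp 1 * exp (- (cmod v)\<^sup>2 / 2)) * (2 ^ m * (1 + cmod v) ^ m)"
        unfolding wt_def using a b by (intro mult_mono) auto
      then show ?thesis by (simp add: E_def wt_def mult_ac)
    qed
    have "cmod (deriv f w) * wt m w / (1 + cmod w) \<le> cmod (f v) * wt m w"
      using d mult_right_mono[OF d, of "wt m w"] w1 by (simp add: field_simps)
    also have "\<dots> \<le> cmod (f v) * (E * wt m v)" by (intro mult_left_mono wv) auto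
    finally have "(cmod (deriv f w) * wt m w / (1 + cmod w)) powr q \<le> (E * (cmod (f v) * wt m v)) powr q"
      using q w1 by (intro powr_mono2) (auto simp: mult_ac)
    also have "\<dots> = E powr q * (cmod (f v) * wt m v) powr q" using E by (simp add: powr_mult)
    finally have "dw m q (deriv f) w
        \<le> ennreal (E powr q) * fw m q f v"
      by (simp add: ennreal_mult[symmetric])
    also have "\<dots> \<le> ennreal (E powr q) * (ennreal C *
        (\<integral>\<^sup>+z. fw m q f z * indicator (ball v 1) z \<partial>lborel))"
      by (intro mult_left_mono C(2) f) auto
    also have "\<dots> \<le> ennreal (E powr q) * (ennreal C *
        (\<integral>\<^sup>+z. fw m q f z * indicator (ball w 2) z \<partial>lborel))"
    proof (intro mult_left_mono nn_integral_mono)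
      fix z
      show "(indicator (ball v 1) z :: ennreal) \<le> indicator (ball w 2) z"
        using vw r norm_triangle_ineq[of "z - v" "v - w"]
        by (auto simp: indicator_def dist_norm norm_minus_commute)
    qed auto
    also have "\<dots> = ennreal (E powr q * C) *
        (\<integral>\<^sup>+z. fw m q f z * indicator (ball w 2) z \<partial>lborel)"
      using C by (simp add: ennreal_mult mult.assoc)
    finally show "dw m q (deriv f) w \<le> ennreal (E powr q * C) *
     (\<integral>\<^sup>+z. fw m q f z * indicator (ball w 2) z \<partial>lborel)" .
  qed
qed

lemma deriv_norm_le:
  assumes q: "q > 0"
  obtains C where "C > 0" "\<And>f. f holomorphic_on UNIV \<Longrightarrow>
     (\<integral>\<^sup>+z. dw m q (deriv f) z \<partial>lborel) \<le> ennreal C * fs_integral q m f"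
proof -
  obtain C where C: "C > 0" "\<And>f w. f holomorphic_on UNIV \<Longrightarrow>
     dw m q (deriv f) w \<le> ennreal C *
     (\<integral>\<^sup>+z. fw m q f z * indicator (ball w 2) z \<partial>lborel)"
    using deriv_local[OF q] by blast
  show thesis
  proof (rule that[of "C * (pi * 2\<^sup>2)"])
    fix f :: "complex \<Rightarrow> complex" assume f: "f holomorphic_on UNIV"
    note [measurable] = entire_measurable[OF f]
    let ?H = "\<lambda>z. fw m q f z"
    have m: "(\<lambda>(w,z). ?H z * indicator (ball 0 2) (z - w)) \<in> borel_measurable (lborel \<Otimes>\<^sub>M lborel)"
      unfolding case_prod_beta indicator_def mem_ball_0 by measurable
    have eq: "(indicator (ball 0 2) (z - w) :: ennreal) = indicator (ball w 2) z" for z w :: complex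
      by (auto simp: indicator_def dist_norm norm_minus_commute)
    have [measurable]: "(\<lambda>w. \<integral>\<^sup>+z. ?H z * indicator (ball w 2) z \<partial>lborel) \<in> borel_measurable lborel"
      using lborel.borel_measurable_nn_integral[OF m] by (simp add: eq)
    have "(\<integral>\<^sup>+z. dw m q (deriv f) z \<partial>lborel)
      \<le> (\<integral>\<^sup>+w. ennreal C * (\<integral>\<^sup>+z. ?H z * indicator (ball w 2) z \<partial>lborel) \<partial>lborel)"
      by (intro nn_integral_mono C(2) f)
    also have "\<dots> = ennreal C * (ennreal (pi * 2\<^sup>2) * (\<integral>\<^sup>+z. ?H z \<partial>lborel))"
      by (subst nn_integral_cmult) (auto simp: nn_integral_ball_average)
    finally show "(\<integral>\<^sup>+z. dw m q (deriv f) z \<partial>lborel)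
        \<le> ennreal (C * (pi * 2\<^sup>2)) * fs_integral q m f"
      using C by (simp add: fs_integral_wt ennreal_mult mult.assoc)
  qed (use C in simp)
qed

text \<open>With fixed argument, \<open>|z|^2\<close> is translated by \<open>- c\<close>. The image
  of the ring is the disc \<open>|z|^2 \<le> T - c\<close>, contained in
  \<open>|z|^2 \<le> T\<close>; this inclusion is what allows absorption after truncation.\<close>

lemma nn_integral_radial_shift:
  fixes \<Phi> :: "complex \<Rightarrow> ennreal"
  assumes [measurable]: "\<Phi> \<in> borel_measurable borel" and c: "c > 0"
  shows "(\<integral>\<^sup>+z. \<Phi> (z * of_real (sqrt (1 - c / (cmod z)\<^sup>2))) * indicator {c..T} ((cmod z)\<^sup>2) \<partial>lborel)
    = (\<integral>\<^sup>+z. \<Phi> z * indicator {0..T - c} ((cmod z)\<^sup>2) \<partial>lborel)" (is "?L = ?R")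
proof -
  let ?I = "indicator {0..<2*pi} :: real \<Rightarrow> ennreal"
  have [measurable]: "cis \<in> borel_measurable borel"
    by (intro borel_measurable_continuous_onI continuous_intros)
  have "2 * ?L = (\<integral>\<^sup>+t. (\<integral>\<^sup>+\<theta>. (\<Phi> (of_real (sqrt t) * cis \<theta> * of_real (sqrt (1 - c / (cmod (of_real (sqrt t) * cis \<theta>))\<^sup>2))) *
       indicator {c..T} ((cmod (of_real (sqrt t) * cis \<theta>))\<^sup>2)) * ?I \<theta> \<partial>lborel) * indicator {0..} t \<partial>lborel)"
    by (rule nn_integral_lborel_polar) measurable
  also have "\<dots> = (\<integral>\<^sup>+t. (\<integral>\<^sup>+\<theta>. \<Phi> (of_real (sqrt (t - c)) * cis \<theta>) * ?I \<theta> \<partial>lborel) * indicator {0..T - c} (t - c) \<partial>lborel)"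
  proof (intro nn_integral_cong)
    fix t :: real
    show "(\<integral>\<^sup>+\<theta>. (\<Phi> (of_real (sqrt t) * cis \<theta> * of_real (sqrt (1 - c / (cmod (of_real (sqrt t) * cis \<theta>))\<^sup>2))) *
       indicator {c..T} ((cmod (of_real (sqrt t) * cis \<theta>))\<^sup>2)) * ?I \<theta> \<partial>lborel) * indicator {0..} t
      = (\<integral>\<^sup>+\<theta>. \<Phi> (of_real (sqrt (t - c)) * cis \<theta>) * ?I \<theta> \<partial>lborel) * indicator {0..T - c} (t - c)"
    proof (cases "c \<le> t \<and> t \<le> T")
      case True
      then have t: "t > 0" using c by linarith
      have E: "of_real (sqrt t) * cis \<theta> * of_real (sqrt (1 - c / t)) = of_real (sqrt (t - c)) * cis \<theta>" for \<theta>
      proof -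
        have "sqrt t * sqrt (1 - c / t) = sqrt (t - c)"
          using t by (simp add: real_sqrt_mult[symmetric] algebra_simps)
        then show ?thesis by (metis mult.commute mult.left_commute of_real_mult)
      qed
      show ?thesis using True t by (simp add: norm_mult E)
    next
      case False
      then show ?thesis using c by (auto simp: norm_mult indicator_def abs_if)
    qed
  qed
  also have "\<dots> = (\<integral>\<^sup>+t. (\<integral>\<^sup>+\<theta>. \<Phi> (of_real (sqrt t) * cis \<theta>) * ?I \<theta> \<partial>lborel) * indicator {0..T - c} t \<partial>lborel)"
  proof -
    have [measurable]: "(\<lambda>(t,\<theta>). \<Phi> (of_real (sqrt t) * cis \<theta>) * ?I \<theta>) \<in> borel_measurable (borel \<Otimes>\<^sub>M lborel)"
      unfolding case_prod_beta by measurable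
    have [measurable]: "(\<lambda>t. \<integral>\<^sup>+\<theta>. \<Phi> (of_real (sqrt t) * cis \<theta>) * ?I \<theta> \<partial>lborel) \<in> borel_measurable borel"
      by (rule sigma_finite_measure.borel_measurable_nn_integral) (auto intro: sigma_finite_lborel)
    show ?thesis
      using nn_integral_lborel_translate[of "\<lambda>t. (\<integral>\<^sup>+\<theta>. \<Phi> (of_real (sqrt t) * cis \<theta>) * ?I \<theta> \<partial>lborel) * indicator {0..T - c} t" "- c"]
      by simp
  qed
  also have "\<dots> = (\<integral>\<^sup>+t. (\<integral>\<^sup>+\<theta>. (\<Phi> (of_real (sqrt t) * cis \<theta>) * indicator {0..T - c} ((cmod (of_real (sqrt t) * cis \<theta>))\<^sup>2)) * ?I \<theta> \<partial>lborel) * indicator {0..} t \<partial>lborel)"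
    by (intro nn_integral_cong) (auto simp: norm_mult indicator_def)
  also have "\<dots> = 2 * ?R"
    by (rule nn_integral_lborel_polar[symmetric]) measurable
  finally show ?thesis by (simp add: ennreal_mult_cancel_left)
qed

section \<open>Norms in terms of the derivative\<close>

text \<open>A radial step of size \<open>s\<close> gains \<open>exp (- s)\<close> and loses
  \<open>(1 + sqrt (2 * s)) ^ m\<close> through the polynomial factor of the weight; for large
  \<open>s\<close> the gain wins.\<close>

lemma exists_weight_decay:
  fixes \<epsilon> :: real
  assumes "\<epsilon> > 0"
  obtains s :: real where "s \<ge> 1" "exp (- s) * (1 + sqrt (2 * s)) ^ m \<le> \<epsilon>"
proof -
  have "((\<lambda>s. 3 ^ m * (s ^ m / exp s)) \<longlongrightarrow> 3 ^ m * (0::real)) at_top"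
    by (intro tendsto_intros tendsto_power_div_exp_0)
  then have "eventually (\<lambda>s. 3 ^ m * (s ^ m / exp s) < \<epsilon>) at_top"
    using assms by (simp add: order_tendsto_iff)
  then obtain s where s: "s \<ge> 1" "3 ^ m * (s ^ m / exp s) < \<epsilon>"
    using eventually_conj[OF eventually_ge_at_top[of 1]] eventually_happens'[OF trivial_limit_at_top_linorder]
    by (metis (mono_tags, lifting))
  have "2 * s \<le> (2 * s)\<^sup>2" using s by (intro self_le_power) auto
  then have "sqrt (2 * s) \<le> 2 * s" using s by (metis real_le_lsqrt mult_nonneg_nonneg zero_le_numeral order.trans zero_le_one)
  then have "1 + sqrt (2 * s) \<le> 3 * s" using s by linarith
  then have "(1 + sqrt (2 * s)) ^ m \<le> (3 * s) ^ m" using s by (intro power_mono) auto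
  then have "exp (- s) * (1 + sqrt (2 * s)) ^ m \<le> exp (- s) * (3 * s) ^ m" by simp
  also have "\<dots> = 3 ^ m * (s ^ m / exp s)" by (simp add: power_mult_distrib exp_minus field_simps)
  finally show thesis using s that by simp
qed

lemma wt_shift_le:
  assumes "cmod z \<le> cmod w + \<tau>" "\<tau> \<ge> 0"
  shows "wt m z \<le> exp (((cmod w)\<^sup>2 - (cmod z)\<^sup>2) / 2) * (1 + \<tau>) ^ m * wt m w"
proof -
  have "0 \<le> \<tau> * cmod w" using assms by simp
  then have "1 + cmod z \<le> (1 + \<tau>) * (1 + cmod w)"
    using assms unfolding distrib_left distrib_right mult_1 mult_1_right by linarith
  then have "(1 + cmod z) ^ m \<le> ((1 + \<tau>) * (1 + cmod w)) ^ m" by (intro power_mono) auto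
  then have a: "(1 + cmod z) ^ m \<le> (1 + \<tau>) ^ m * (1 + cmod w) ^ m" by (simp only: power_mult_distrib)
  have "wt m z \<le> exp (- (cmod z)\<^sup>2 / 2) * ((1 + \<tau>) ^ m * (1 + cmod w) ^ m)"
    unfolding wt_def using a by (intro mult_left_mono) auto
  also have "exp (- (cmod z)\<^sup>2 / 2) = exp (((cmod w)\<^sup>2 - (cmod z)\<^sup>2) / 2) * exp (- (cmod w)\<^sup>2 / 2)"
    by (simp add: exp_add[symmetric] field_simps)
  finally show ?thesis by (simp add: wt_def mult_ac)
qed

text \<open>A substitute for the triangle inequality that works for exponents above and below 1
  alike.\<close>

lemma powr_add_le:
  fixes x y q :: real
  assumes "x \<ge> 0" "y \<ge> 0" "q > 0"
  shows "(x + y) powr q \<le> 2 powr q * (x powr q + y powr q)"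
proof -
  have "(x + y) powr q \<le> (2 * max x y) powr q" using assms by (intro powr_mono2) auto
  also have "\<dots> = 2 powr q * (max x y) powr q" using assms by (simp add: powr_mult)
  also have "\<dots> \<le> 2 powr q * (x powr q + y powr q)"
    by (intro mult_left_mono) (auto simp: max_def)
  finally show ?thesis .
qed

text \<open>The maximum of \<open>|f'|\<close> on the segment is attained, which yields a definite
  point at which a local estimate for \<open>deriv f\<close> can be used.\<close>

lemma mean_value_segment:
  assumes f: "f holomorphic_on UNIV"
  obtains \<zeta> where "\<zeta> \<in> closed_segment z' z" "cmod (f z - f z') \<le> cmod (deriv f \<zeta>) * cmod (z - z')"
proof -
  have "deriv f holomorphic_on UNIV" using f by (intro holomorphic_deriv) auto
  then have "continuous_on (closed_segment z' z) (\<lambda>z. cmod (deriv f z))"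
    by (intro continuous_intros continuous_on_subset[OF holomorphic_on_imp_continuous_on]) auto
  then obtain v where v: "v \<in> closed_segment z' z" "\<And>y. y \<in> closed_segment z' z \<Longrightarrow> cmod (deriv f y) \<le> cmod (deriv f v)"
    using continuous_attains_sup[of "closed_segment z' z" "\<lambda>z. cmod (deriv f z)"] by auto
  have "cmod (f z - f z') \<le> cmod (deriv f v) * cmod (z - z')"
  proof (rule field_differentiable_bound[where f=f and S="closed_segment z' z" and f'="deriv f"])
    show "(f has_field_derivative deriv f y) (at y within closed_segment z' z)" for y
      by (rule has_field_derivative_at_within, rule holomorphic_derivI[OF f]) auto
  qed (use v in auto)
  with v that show thesis by blast
qed

text \<open>The \<open>max\<close> sends all \<open>z\<close> with \<open>|z|^2 < 2 * s\<close> to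
  0, where the functions considered vanish. Since \<open>|z|^2\<close> drops by at most
  \<open>2 * s\<close>, the distance moved is of order \<open>1 / (1 + |z|)\<close>: this is the
  origin of the divisor in \<open>dw\<close>.\<close>

lemma radial_retraction_bounds:
  fixes z :: complex and s :: real
  assumes s: "s \<ge> 1"
  defines "z' \<equiv> z * of_real (sqrt (max 0 (1 - 2 * s / (cmod z)\<^sup>2)))"
  shows "cmod (z - z') * (1 + cmod z) \<le> 4 * s" "cmod (z - z') \<le> sqrt (2 * s)"
    "\<zeta> \<in> closed_segment z' z \<Longrightarrow> cmod \<zeta> \<le> cmod z"
    "(cmod z)\<^sup>2 < 2 * s \<Longrightarrow> z' = 0"
    "(cmod z)\<^sup>2 \<ge> 2 * s \<Longrightarrow> (cmod z')\<^sup>2 = (cmod z)\<^sup>2 - 2 * s \<and> z' = z * of_real (sqrt (1 - 2 * s / (cmod z)\<^sup>2))"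
proof -
  define r where "r = cmod z"
  define k where "k = sqrt (max 0 (1 - 2 * s / r\<^sup>2))"
  have r0: "r \<ge> 0" by (simp add: r_def)
  have z': "z' = z * of_real k" by (simp add: z'_def k_def r_def)
  have k: "0 \<le> k" "k \<le> 1"
    unfolding k_def using s by (auto simp: real_sqrt_le_1_iff)
  have nz': "cmod z' = r * k" using k by (simp add: z' norm_mult r_def)
  have dz: "cmod (z - z') = r * (1 - k)"
  proof -
    have "z - z' = z * of_real (1 - k)" by (simp add: z' algebra_simps)
    then show ?thesis using k by (simp add: norm_mult r_def del: of_real_diff)
  qed
  have tau: "sqrt (2 * s) \<ge> 1" using s by simp
  \<comment> \<open>At \<open>z = 0\<close> the quotient is 0 by convention and the square root is
    1; the factor \<open>z\<close> still makes \<open>z'\<close> vanish.\<close>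
  show small: "(cmod z)\<^sup>2 < 2 * s \<Longrightarrow> z' = 0"
    by (cases "z = 0") (auto simp: z'_def max_def field_simps)
  have big: "k\<^sup>2 = 1 - 2 * s / r\<^sup>2 \<and> r > 0 \<and> k = sqrt (1 - 2 * s / r\<^sup>2)" if "(cmod z)\<^sup>2 \<ge> 2 * s"
  proof -
    have "r\<^sup>2 > 0" using that s unfolding r_def by linarith
    then have "r > 0" using r0 by (metis less_eq_real_def power_zero_numeral less_irrefl)
    moreover have "1 - 2 * s / r\<^sup>2 \<ge> 0" using that \<open>r\<^sup>2 > 0\<close> by (simp add: r_def field_simps)
    ultimately show ?thesis by (simp add: k_def)
  qed
  show "(cmod z')\<^sup>2 = (cmod z)\<^sup>2 - 2 * s \<and> z' = z * of_real (sqrt (1 - 2 * s / (cmod z)\<^sup>2))" if "(cmod z)\<^sup>2 \<ge> 2 * s"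
  proof
    show "(cmod z')\<^sup>2 = (cmod z)\<^sup>2 - 2 * s"
      unfolding nz' power_mult_distrib conjunct1[OF big[OF that]]
      using big[OF that] by (simp add: r_def right_diff_distrib)
    show "z' = z * of_real (sqrt (1 - 2 * s / (cmod z)\<^sup>2))"
      using big[OF that] by (simp add: z' r_def)
  qed
  have main: "cmod (z - z') * (1 + cmod z) \<le> 4 * s \<and> cmod (z - z') \<le> sqrt (2 * s)"
  proof (cases "(cmod z)\<^sup>2 < 2 * s")
    case True
    have lt: "r < sqrt (2 * s)" using True by (simp add: r_def real_less_rsqrt)
    have "r * (1 + r) \<le> sqrt (2 * s) * (sqrt (2 * s) + sqrt (2 * s))"
      by (intro mult_mono) (use lt tau r0 in linarith)+
    also have "\<dots> = 4 * s" using s by (simp add: distrib_left)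
    finally show ?thesis using small[OF True] lt by (simp add: r_def)
  next
    case False
    then have b: "k\<^sup>2 = 1 - 2 * s / r\<^sup>2" "r > 0" using big by auto
    have "sqrt (2 * s) \<le> r" using False by (simp add: r_def real_le_lsqrt)
    have "k\<^sup>2 \<le> k" using k by (simp add: power2_eq_square mult_left_le)
    then have "r * (1 - k) \<le> r * (2 * s / r\<^sup>2)" using b by (intro mult_left_mono) auto
    also have "\<dots> = 2 * s / r" using b by (simp add: power2_eq_square)
    finally have 1: "r * (1 - k) \<le> 2 * s / r" .
    have "r * (1 - k) * (1 + r) \<le> 2 * s / r * (2 * r)"
    proof (intro mult_mono 1)
      show "1 + r \<le> 2 * r" "0 \<le> 1 + r" using \<open>sqrt (2 * s) \<le> r\<close> tau by linarith+
      show "0 \<le> 2 * s / r" using s b by simp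
    qed
    also have "\<dots> = 4 * s" using b by simp
    finally have 2: "r * (1 - k) * (1 + r) \<le> 4 * s" .
    have "2 * s = sqrt (2 * s) * sqrt (2 * s)" using s by simp
    also have "\<dots> \<le> sqrt (2 * s) * r" using \<open>sqrt (2 * s) \<le> r\<close> s by (intro mult_left_mono) auto
    finally have "2 * s / r \<le> sqrt (2 * s)" using b by (simp add: field_simps)
    then show ?thesis using 1 2 dz by (simp add: r_def)
  qed
  then show "cmod (z - z') * (1 + cmod z) \<le> 4 * s" "cmod (z - z') \<le> sqrt (2 * s)" by auto
  show "cmod \<zeta> \<le> cmod z" if "\<zeta> \<in> closed_segment z' z"
  proof -
    have "cmod z' \<le> cmod z" using k r0 by (simp add: nz' r_def mult_left_le)
    then have "closed_segment z' z \<subseteq> cball 0 (cmod z)"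
      by (intro closed_segment_subset) auto
    then show ?thesis using that by auto
  qed
qed

text \<open>A pointwise Littlewood-Paley estimate: \<open>f z\<close> is split into
  \<open>f z'\<close> and \<open>f z - f z'\<close>. The first part carries the small factor gained
  from the weight. The second is at most \<open>|f' v|\<close> times
  \<open>|z - z'| \<le> 4 * s / (1 + |z|)\<close> for some \<open>v\<close> on the segment, and
  \<open>pointwise_local\<close> for \<open>deriv f\<close> at \<open>v\<close> replaces it by an
  integral over a disc around \<open>z\<close>.\<close>

lemma LP_pointwise:
  assumes q: "q > 0" and s: "s \<ge> 1"
  obtains C where "C > 0" "\<And>f z. f holomorphic_on UNIV \<Longrightarrow> f 0 = 0 \<Longrightarrow>
    fw m q f z \<le>
      ennreal (2 powr q * (exp (- s) * (1 + sqrt (2 * s)) ^ m) powr q) *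
        (ennreal ((cmod (f (z * of_real (sqrt (1 - 2 * s / (cmod z)\<^sup>2)))) * wt m (z * of_real (sqrt (1 - 2 * s / (cmod z)\<^sup>2)))) powr q)
         * indicator {2 * s..} ((cmod z)\<^sup>2)) +
      ennreal C * (\<integral>\<^sup>+w. dw m q (deriv f) w
         * indicator (ball z (1 + sqrt (2 * s))) w \<partial>lborel)"
proof -
  obtain C where C: "C > 0" "\<And>f w. f holomorphic_on UNIV \<Longrightarrow>
     fw m q f w \<le> ennreal C *
     (\<integral>\<^sup>+z. fw m q f z * indicator (ball w 1) z \<partial>lborel)"
    using pointwise_local[OF q] by blast
  define \<tau> where "\<tau> = sqrt (2 * s)"
  define K where "K = 4 * s * (1 + \<tau>) ^ m"
  have tau: "\<tau> \<ge> 1" using s by (simp add: \<tau>_def)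
  have K: "K > 0" using s tau by (simp add: K_def)
  define C2 where "C2 = 2 powr q * (K powr q * (C * (2 + \<tau>) powr q))"
  show thesis
  proof (rule that[of C2])
    show "C2 > 0" using C K tau by (simp add: C2_def)
  next
    fix f z assume f: "f holomorphic_on UNIV" and f0: "f 0 = 0"
    have df: "deriv f holomorphic_on UNIV" using f by (intro holomorphic_deriv) auto
    note [measurable] = entire_measurable[OF f] entire_measurable[OF df]
    define z' where "z' = z * of_real (sqrt (max 0 (1 - 2 * s / (cmod z)\<^sup>2)))"
    note rr = radial_retraction_bounds[OF s, where z=z, folded z'_def, folded \<tau>_def]
    obtain v where v: "v \<in> closed_segment z' z" "cmod (f z - f z') \<le> cmod (deriv f v) * cmod (z - z')"
      using mean_value_segment[OF f] by blast
    have z1: "1 + cmod z > 0" by (simp add: add_pos_nonneg)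
    have vz: "cmod (z - v) \<le> \<tau>"
      using segment_bound(2)[OF v(1)] rr(2) by (simp add: norm_minus_commute)
    have "cmod z \<le> cmod v + \<tau>" using vz norm_triangle_ineq[of "z - v" v] by simp
    then have "wt m z \<le> exp (((cmod v)\<^sup>2 - (cmod z)\<^sup>2) / 2) * (1 + \<tau>) ^ m * wt m v"
      using tau by (intro wt_shift_le) auto
    also have "\<dots> \<le> 1 * (1 + \<tau>) ^ m * wt m v"
      using rr(3)[OF v(1)] tau by (intro mult_right_mono) (auto intro: power_mono)
    finally have wv: "wt m z \<le> (1 + \<tau>) ^ m * wt m v" by simp
    have dzz: "cmod (z - z') \<le> 4 * s / (1 + cmod z)"
      using rr(1) z1 by (simp add: field_simps)
    have B: "cmod (f z - f z') * wt m z \<le> K * (cmod (deriv f v) * wt m v / (1 + cmod z))"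
    proof -
      have "cmod (f z - f z') * wt m z \<le> (cmod (deriv f v) * (4 * s / (1 + cmod z))) * ((1 + \<tau>) ^ m * wt m v)"
        using v(2) dzz wv s by (intro mult_mono order.trans[OF v(2)] mult_left_mono) auto
      then show ?thesis by (simp add: K_def field_simps)
    qed
    have "cmod (f z) \<le> cmod (f z') + cmod (f z - f z')"
      using norm_triangle_ineq[of "f z'" "f z - f z'"] by simp
    then have "cmod (f z) * wt m z \<le> (cmod (f z') + cmod (f z - f z')) * wt m z"
      by (intro mult_right_mono) auto
    then have "(cmod (f z) * wt m z) powr q \<le> (cmod (f z') * wt m z + cmod (f z - f z') * wt m z) powr q"
      using q by (intro powr_mono2) (auto simp: distrib_right)
    also have "\<dots> \<le> 2 powr q * ((cmod (f z') * wt m z) powr q + (cmod (f z - f z') * wt m z) powr q)"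
      using q by (intro powr_add_le) auto
    finally have split: "fw m q f z \<le>
       ennreal (2 powr q) * ennreal ((cmod (f z') * wt m z) powr q) + ennreal (2 powr q) * ennreal ((cmod (f z - f z') * wt m z) powr q)"
      by (simp add: ennreal_mult[symmetric] ennreal_plus[symmetric] distrib_left del: ennreal_plus)
    \<comment> \<open>Without the \<open>max\<close> this is the map of
      \<open>nn_integral_radial_shift\<close>; it agrees with \<open>z'\<close> wherever the
      indicator below is not 0.\<close>
    let ?z = "z * of_real (sqrt (1 - 2 * s / (cmod z)\<^sup>2))"
    have first: "ennreal ((cmod (f z') * wt m z) powr q) \<le> ennreal ((exp (- s) * (1 + \<tau>) ^ m) powr q) *
       (ennreal ((cmod (f ?z) * wt m ?z) powr q) * indicator {2 * s..} ((cmod z)\<^sup>2))"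
    proof (cases "(cmod z)\<^sup>2 < 2 * s")
      case True
      then show ?thesis using rr(4) f0 q by simp
    next
      case False
      then have z': "(cmod z')\<^sup>2 = (cmod z)\<^sup>2 - 2 * s" "z' = ?z" using rr(5) by auto
      have "cmod z \<le> cmod z' + \<tau>" using rr(2) norm_triangle_ineq[of "z - z'" z'] by simp
      then have "wt m z \<le> exp (((cmod z')\<^sup>2 - (cmod z)\<^sup>2) / 2) * (1 + \<tau>) ^ m * wt m z'"
        using tau by (intro wt_shift_le) auto
      also have "((cmod z')\<^sup>2 - (cmod z)\<^sup>2) / 2 = - s" using z' by simp
      finally have "cmod (f z') * wt m z \<le> cmod (f z') * (exp (- s) * (1 + \<tau>) ^ m * wt m z')"
        by (intro mult_left_mono) auto
      then have "(cmod (f z') * wt m z) powr q \<le> ((exp (- s) * (1 + \<tau>) ^ m) * (cmod (f z') * wt m z')) powr q"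
        using q by (intro powr_mono2) (auto simp: mult_ac)
      also have "\<dots> = (exp (- s) * (1 + \<tau>) ^ m) powr q * (cmod (f z') * wt m z') powr q"
        using tau by (intro powr_mult)
      finally show ?thesis using False
        by (simp add: ennreal_mult[symmetric] z'(2)[symmetric])
    qed
    have second: "ennreal ((cmod (f z - f z') * wt m z) powr q) \<le> ennreal (K powr q * (C * (2 + \<tau>) powr q)) *
      (\<integral>\<^sup>+w. dw m q (deriv f) w * indicator (ball z (1 + \<tau>)) w \<partial>lborel)"
    proof -
      have "(cmod (f z - f z') * wt m z) powr q \<le> (K * (cmod (deriv f v) * wt m v / (1 + cmod z))) powr q"
        using B q by (intro powr_mono2) auto
      also have "\<dots> = K powr q * ((1 / (1 + cmod z)) powr q * (cmod (deriv f v) * wt m v) powr q)"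
        using K z1 by (simp add: powr_mult powr_divide)
      finally have "ennreal ((cmod (f z - f z') * wt m z) powr q) \<le>
        ennreal (K powr q) * (ennreal ((1 / (1 + cmod z)) powr q) * fw m q (deriv f) v)"
        by (simp add: ennreal_mult[symmetric])
      also have "\<dots> \<le> ennreal (K powr q) * (ennreal ((1 / (1 + cmod z)) powr q) * (ennreal C *
          (\<integral>\<^sup>+w. fw m q (deriv f) w * indicator (ball v 1) w \<partial>lborel)))"
        by (intro mult_left_mono C(2) df) auto
      also have "\<dots> = ennreal (K powr q) * (ennreal C *
          (\<integral>\<^sup>+w. ennreal ((1 / (1 + cmod z)) powr q) * (fw m q (deriv f) w * indicator (ball v 1) w) \<partial>lborel))"
        by (simp add: nn_integral_cmult mult.left_commute)
      also have "\<dots> \<le> ennreal (K powr q) * (ennreal C *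
          (\<integral>\<^sup>+w. ennreal ((2 + \<tau>) powr q) * (dw m q (deriv f) w * indicator (ball z (1 + \<tau>)) w) \<partial>lborel))"
      proof (intro mult_left_mono nn_integral_mono)
        fix w
        show "ennreal ((1 / (1 + cmod z)) powr q) * (fw m q (deriv f) w * indicator (ball v 1) w)
          \<le> ennreal ((2 + \<tau>) powr q) * (dw m q (deriv f) w * indicator (ball z (1 + \<tau>)) w)"
        proof (cases "w \<in> ball v 1")
          case True
          have "cmod (w - z) < 1 + \<tau>"
            using True vz norm_triangle_ineq[of "w - v" "v - z"] by (simp add: dist_norm norm_minus_commute)
          moreover have "1 + cmod w \<le> (1 + cmod (w - z)) * (1 + cmod z)" by (rule one_plus_norm_le)
          moreover have "(1 + cmod (w - z)) * (1 + cmod z) \<le> (2 + \<tau>) * (1 + cmod z)"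
            using calculation(1) by (intro mult_right_mono) auto
          ultimately have le: "1 / (1 + cmod z) \<le> (2 + \<tau>) / (1 + cmod w)" and wz: "w \<in> ball z (1 + \<tau>)"
            using z1 by (auto simp: field_simps dist_norm norm_minus_commute add_pos_nonneg)
          have "(1 / (1 + cmod z) * (cmod (deriv f w) * wt m w)) powr q \<le> ((2 + \<tau>) / (1 + cmod w) * (cmod (deriv f w) * wt m w)) powr q"
            using le q by (intro powr_mono2 mult_right_mono) auto
          then have "(1 / (1 + cmod z)) powr q * (cmod (deriv f w) * wt m w) powr q
            \<le> (2 + \<tau>) powr q * (cmod (deriv f w) * wt m w / (1 + cmod w)) powr q"
            using tau z1 by (simp add: powr_mult powr_divide)
          then show ?thesis using True wz by (simp add: ennreal_mult[symmetric])
        qed simp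
      qed auto
      also have "\<dots> = ennreal (K powr q * (C * (2 + \<tau>) powr q)) *
          (\<integral>\<^sup>+w. dw m q (deriv f) w * indicator (ball z (1 + \<tau>)) w \<partial>lborel)"
        using C by (simp add: nn_integral_cmult ennreal_mult mult.assoc)
      finally show ?thesis .
    qed
    have "fw m q f z \<le>
       ennreal (2 powr q) * (ennreal ((exp (- s) * (1 + \<tau>) ^ m) powr q) *
       (ennreal ((cmod (f ?z) * wt m ?z) powr q) * indicator {2 * s..} ((cmod z)\<^sup>2)))
      + ennreal (2 powr q) * (ennreal (K powr q * (C * (2 + \<tau>) powr q)) *
      (\<integral>\<^sup>+w. dw m q (deriv f) w * indicator (ball z (1 + \<tau>)) w \<partial>lborel))"
      using split first second by (meson add_mono mult_left_mono order.trans zero_le)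
    then show "fw m q f z \<le>
      ennreal (2 powr q * (exp (- s) * (1 + sqrt (2 * s)) ^ m) powr q) *
        (ennreal ((cmod (f ?z) * wt m ?z) powr q) * indicator {2 * s..} ((cmod z)\<^sup>2)) +
      ennreal C2 * (\<integral>\<^sup>+w. dw m q (deriv f) w
         * indicator (ball z (1 + sqrt (2 * s))) w \<partial>lborel)"
      unfolding C2_def \<tau>_def[symmetric] using C by (simp add: ennreal_mult mult.assoc)
  qed
qed

lemma norm_le_deriv_norm:
  assumes q: "q > 0"
  obtains C where "C > 0" "\<And>f. f holomorphic_on UNIV \<Longrightarrow> f 0 = 0 \<Longrightarrow>
    fs_integral q m f \<le> ennreal C *
      (\<integral>\<^sup>+z. dw m q (deriv f) z \<partial>lborel)"
proof -
  \<comment> \<open>Chosen so that \<open>2 powr q * \<epsilon> powr q = 1 / 2\<close>: the shifted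
    term then carries a factor of at most one half.\<close>
  define \<epsilon> :: real where "\<epsilon> = (1 / 2) powr (1 / q) / 2"
  have "\<epsilon> > 0" by (simp add: \<epsilon>_def)
  then obtain s where s: "s \<ge> 1" "exp (- s) * (1 + sqrt (2 * s)) ^ m \<le> \<epsilon>"
    using exists_weight_decay by blast
  let ?\<kappa> = "2 powr q * (exp (- s) * (1 + sqrt (2 * s)) ^ m) powr q"
  have "?\<kappa> \<le> 2 powr q * \<epsilon> powr q"
    using s q by (intro mult_left_mono powr_mono2) auto
  also have "\<dots> = 1 / 2"
    using q unfolding \<epsilon>_def by (simp add: powr_mult[symmetric] powr_powr)
  finally have kappa: "?\<kappa> \<le> 1 / 2" .
  obtain C where C: "C > 0" "\<And>f z. f holomorphic_on UNIV \<Longrightarrow> f 0 = 0 \<Longrightarrow>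
    fw m q f z \<le>
      ennreal ?\<kappa> *
        (ennreal ((cmod (f (z * of_real (sqrt (1 - 2 * s / (cmod z)\<^sup>2)))) * wt m (z * of_real (sqrt (1 - 2 * s / (cmod z)\<^sup>2)))) powr q)
         * indicator {2 * s..} ((cmod z)\<^sup>2)) +
      ennreal C * (\<integral>\<^sup>+w. dw m q (deriv f) w
         * indicator (ball z (1 + sqrt (2 * s))) w \<partial>lborel)"
    using LP_pointwise[OF q s(1)] by blast
  define \<rho> where "\<rho> = 1 + sqrt (2 * s)"
  have rho: "\<rho> > 0" using s by (simp add: \<rho>_def add_pos_nonneg)
  show thesis
  proof (rule that[of "2 * (C * (pi * \<rho>\<^sup>2))"])
    show "2 * (C * (pi * \<rho>\<^sup>2)) > 0" using C rho by simp
  next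
    fix f assume f: "f holomorphic_on UNIV" and f0: "f 0 = 0"
    have df: "deriv f holomorphic_on UNIV" using f by (intro holomorphic_deriv) auto
    note [measurable] = entire_measurable[OF f] entire_measurable[OF df]
    define \<Phi> where "\<Phi> z = fw m q f z" for z
    define G where "G z = dw m q (deriv f) z" for z
    define I where "I T z = (indicator {..T} ((cmod z)\<^sup>2) :: ennreal)" for T :: real and z :: complex
    let ?z = "\<lambda>z::complex. z * of_real (sqrt (1 - 2 * s / (cmod z)\<^sup>2))"
    have [measurable]: "\<Phi> \<in> borel_measurable borel" "G \<in> borel_measurable borel" "I T \<in> borel_measurable borel" for T
      unfolding \<Phi>_def G_def I_def by measurable
    have Gm: "(\<lambda>(z,w). G w * indicator (ball 0 \<rho>) (w - z)) \<in> borel_measurable (lborel \<Otimes>\<^sub>M lborel)"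
      unfolding case_prod_beta indicator_def mem_ball_0 by measurable
    have ind: "(indicator (ball 0 \<rho>) (w - z) :: ennreal) = indicator (ball z \<rho>) w" for z w :: complex
      by (auto simp: indicator_def dist_norm norm_minus_commute)
    have [measurable]: "(\<lambda>z. \<integral>\<^sup>+w. G w * indicator (ball z \<rho>) w \<partial>lborel) \<in> borel_measurable borel"
      using lborel.borel_measurable_nn_integral[OF Gm] by (simp add: ind)
    let ?N = "\<integral>\<^sup>+z. G z \<partial>lborel"
    have step: "(\<integral>\<^sup>+z. \<Phi> z * I T z \<partial>lborel) \<le> ennreal (2 * (C * (pi * \<rho>\<^sup>2))) * ?N" for T
    proof -
      \<comment> \<open>The truncation to \<open>|z|\<^sup>2 \<le> T\<close> makes this finite, so that it can be absorbed.\<close>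
      define X where "X = (\<integral>\<^sup>+z. \<Phi> z * I T z \<partial>lborel)"
      have "continuous_on (cball 0 (sqrt \<bar>T\<bar>)) (\<lambda>z. (cmod (f z) * wt m z) powr q)"
        using q by (intro continuous_intros continuous_on_powr' continuous_on_subset[OF holomorphic_on_imp_continuous_on[OF f]]) auto
      then have "bounded ((\<lambda>z. (cmod (f z) * wt m z) powr q) ` cball 0 (sqrt \<bar>T\<bar>))"
        by (intro compact_imp_bounded compact_continuous_image) auto
      then obtain B where "\<forall>x\<in>(\<lambda>z. (cmod (f z) * wt m z) powr q) ` cball 0 (sqrt \<bar>T\<bar>). norm x \<le> B"
        unfolding bounded_iff by blast
      then have B: "(cmod (f z) * wt m z) powr q \<le> B" if "cmod z \<le> sqrt \<bar>T\<bar>" for z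
        using that by simp
      have "X \<le> (\<integral>\<^sup>+z. ennreal \<bar>B\<bar> * indicator (cball (0::complex) (sqrt \<bar>T\<bar>)) z \<partial>lborel)"
        unfolding X_def
      proof (intro nn_integral_mono)
        fix z :: complex
        have "cmod z \<le> sqrt \<bar>T\<bar>" if "(cmod z)\<^sup>2 \<le> T"
          using that by (intro real_le_rsqrt) auto
        then show "\<Phi> z * I T z \<le> ennreal \<bar>B\<bar> * indicator (cball (0::complex) (sqrt \<bar>T\<bar>)) z"
          using B[of z] by (auto simp: \<Phi>_def I_def indicator_def intro!: ennreal_leI)
      qed
      also have "\<dots> < \<infinity>"
        by (simp add: nn_integral_cmult_indicator emeasure_lborel_ball_complex ennreal_mult_less_top)
      finally have Xfin: "X < \<infinity>" .
      have "X \<le> (\<integral>\<^sup>+z. ennreal (1/2) * (\<Phi> (?z z) * indicator {2 * s..T} ((cmod z)\<^sup>2))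
         + ennreal C * (\<integral>\<^sup>+w. G w * indicator (ball z \<rho>) w \<partial>lborel) \<partial>lborel)"
        unfolding X_def
      proof (intro nn_integral_mono)
        fix z
        have "\<Phi> z * I T z \<le> (ennreal ?\<kappa> * (\<Phi> (?z z) * indicator {2 * s..} ((cmod z)\<^sup>2)) +
            ennreal C * (\<integral>\<^sup>+w. G w * indicator (ball z \<rho>) w \<partial>lborel)) * I T z"
          unfolding \<Phi>_def G_def \<rho>_def by (intro mult_right_mono C(2) f f0) auto
        also have "\<dots> \<le> ennreal ?\<kappa> * (\<Phi> (?z z) * indicator {2 * s..T} ((cmod z)\<^sup>2)) +
            ennreal C * (\<integral>\<^sup>+w. G w * indicator (ball z \<rho>) w \<partial>lborel)"
          by (auto simp: I_def indicator_def)
        also have "\<dots> \<le> ennreal (1/2) * (\<Phi> (?z z) * indicator {2 * s..T} ((cmod z)\<^sup>2))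
         + ennreal C * (\<integral>\<^sup>+w. G w * indicator (ball z \<rho>) w \<partial>lborel)"
          using kappa by (intro add_mono mult_right_mono ennreal_leI) auto
        finally show "\<Phi> z * I T z \<le> ennreal (1/2) * (\<Phi> (?z z) * indicator {2 * s..T} ((cmod z)\<^sup>2))
         + ennreal C * (\<integral>\<^sup>+w. G w * indicator (ball z \<rho>) w \<partial>lborel)" .
      qed
      also have "\<dots> = ennreal (1/2) * (\<integral>\<^sup>+z. \<Phi> (?z z) * indicator {2 * s..T} ((cmod z)\<^sup>2) \<partial>lborel)
         + ennreal C * (ennreal (pi * \<rho>\<^sup>2) * ?N)"
        using rho by (simp add: nn_integral_add nn_integral_cmult nn_integral_ball_average)
      also have "(\<integral>\<^sup>+z. \<Phi> (?z z) * indicator {2 * s..T} ((cmod z)\<^sup>2) \<partial>lborel)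
          = (\<integral>\<^sup>+z. \<Phi> z * indicator {0..T - 2 * s} ((cmod z)\<^sup>2) \<partial>lborel)"
        using s by (intro nn_integral_radial_shift) auto
      \<comment> \<open>After the shift the region is \<open>|z|^2 \<le> T - 2 * s\<close>, a part
        of the region that defines \<open>X\<close>.\<close>
      also have "\<dots> \<le> X"
        unfolding X_def using s by (intro nn_integral_mono) (auto simp: I_def indicator_def)
      finally have le: "X \<le> ennreal (1/2) * X + ennreal C * (ennreal (pi * \<rho>\<^sup>2) * ?N)"
        by (auto simp: add_right_mono mult_left_mono)
      show ?thesis
      proof (cases "?N = \<infinity>")
        case True
        then show ?thesis using C rho by (simp add: ennreal_mult_top)
      next
        case False
        then obtain n where n: "?N = ennreal n" "n \<ge> 0" by (cases ?N) auto
        obtain x where x: "X = ennreal x" "x \<ge> 0" using Xfin by (cases X) auto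
        have "ennreal (1/2) * X + ennreal C * (ennreal (pi * \<rho>\<^sup>2) * ?N) = ennreal (1/2 * x + C * (pi * \<rho>\<^sup>2 * n))"
          unfolding n x using n(2) x(2) C(1) by (simp only: ennreal_mult ennreal_plus mult_nonneg_nonneg zero_le_power2 pi_ge_zero less_imp_le)
        with le have "ennreal x \<le> ennreal (1/2 * x + C * (pi * \<rho>\<^sup>2 * n))" unfolding x(1) by metis
        moreover have "0 \<le> 1/2 * x + C * (pi * \<rho>\<^sup>2 * n)" using n(2) x(2) C(1) by simp
        ultimately have "x \<le> 1/2 * x + C * (pi * \<rho>\<^sup>2 * n)" using ennreal_le_iff by blast
        then have "x \<le> 2 * (C * (pi * \<rho>\<^sup>2)) * n" by (simp add: mult_ac)
        then show ?thesis using x n C by (simp add: X_def[symmetric] ennreal_mult[symmetric])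
      qed
    qed
    \<comment> \<open>The bound in \<open>step\<close> does not depend on \<open>T\<close>, so
      monotone convergence removes the truncation.\<close>
    have "(\<integral>\<^sup>+z. \<Phi> z \<partial>lborel) = (\<integral>\<^sup>+z. (SUP n. \<Phi> z * I (real n) z) \<partial>lborel)"
    proof (intro nn_integral_cong antisym)
      fix z
      obtain n where "(cmod z)\<^sup>2 \<le> real n" using real_arch_simple by blast
      then show "\<Phi> z \<le> (SUP n. \<Phi> z * I (real n) z)"
        by (intro SUP_upper2[of n]) (auto simp: I_def)
      show "(SUP n. \<Phi> z * I (real n) z) \<le> \<Phi> z"
        by (intro SUP_least) (auto simp: I_def indicator_def)
    qed
    also have "\<dots> = (SUP n. \<integral>\<^sup>+z. \<Phi> z * I (real n) z \<partial>lborel)"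
      by (intro nn_integral_monotone_convergence_SUP) (auto simp: incseq_def le_fun_def I_def indicator_def intro!: mult_left_mono)
    also have "\<dots> \<le> ennreal (2 * (C * (pi * \<rho>\<^sup>2))) * ?N"
      by (intro SUP_least step)
    finally show "fs_integral q m f \<le> ennreal (2 * (C * (pi * \<rho>\<^sup>2))) *
        (\<integral>\<^sup>+z. dw m q (deriv f) z \<partial>lborel)"
      unfolding fs_integral_wt \<Phi>_def G_def .
  qed
qed

section \<open>The Volterra operator and the spaces\<close>

text \<open>One primitive serves three purposes: it shows that the contour integral exists, it
  evaluates it, and it gives its derivative.\<close>

lemma Volterra_primitive:
  assumes f: "f holomorphic_on UNIV" and g: "g holomorphic_on UNIV"
  shows "\<exists>F. (\<forall>z. (F has_field_derivative f z * deriv g z) (at z)) \<and>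
    (\<forall>z. ((\<lambda>w. f w * deriv g w) has_contour_integral (F z - F 0)) (linepath 0 z)) \<and>
    (\<forall>z. Volterra g f z = F z - F 0)"
proof -
  have hol: "(\<lambda>w. f w * deriv g w) holomorphic_on UNIV"
    using f g by (intro holomorphic_intros holomorphic_deriv) auto
  obtain F where "\<And>z. z \<in> UNIV \<Longrightarrow> (F has_field_derivative f z * deriv g z) (at z within UNIV)"
    using holomorphic_convex_primitive'[OF convex_UNIV open_UNIV hol] by blast
  then have F: "(F has_field_derivative f z * deriv g z) (at z)" for z by simp
  have I: "((\<lambda>w. f w * deriv g w) has_contour_integral (F z - F 0)) (linepath 0 z)" for z
    using contour_integral_primitive[of UNIV F "\<lambda>w. f w * deriv g w" "linepath 0 z"] F by simp
  have "Volterra g f z = F z - F 0" for z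
    by (simp add: Volterra_def contour_integral_unique[OF I])
  with F I show ?thesis by (intro exI[of _ F]) simp
qed

lemma Volterra_entire:
  assumes f: "f holomorphic_on UNIV" and g: "g holomorphic_on UNIV"
  shows "Volterra g f holomorphic_on UNIV" "deriv (Volterra g f) z = f z * deriv g z" "Volterra g f 0 = 0"
proof -
  obtain F where F: "\<forall>z. (F has_field_derivative f z * deriv g z) (at z)" "\<forall>z. Volterra g f z = F z - F 0"
    using Volterra_primitive[OF f g] by (elim exE conjE)
  have eq: "Volterra g f = (\<lambda>z. F z - F 0)" using F(2) by auto
  have d: "(Volterra g f has_field_derivative f z * deriv g z) (at z)" for z
    unfolding eq using DERIV_diff[OF spec[OF F(1), of z] DERIV_const[of "F 0"]] by simp
  show "Volterra g f holomorphic_on UNIV"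
    unfolding holomorphic_on_open[OF open_UNIV] using d by blast
  show "deriv (Volterra g f) z = f z * deriv g z" by (rule DERIV_imp_deriv[OF d])
  show "Volterra g f 0 = 0" by (simp add: F(2))
qed

lemma Volterra_has_contour_integral:
  assumes f: "f holomorphic_on UNIV" and g: "g holomorphic_on UNIV"
  shows "((\<lambda>w. f w * deriv g w) has_contour_integral Volterra g f z) (linepath 0 z)"
proof -
  obtain F where "\<forall>z. ((\<lambda>w. f w * deriv g w) has_contour_integral (F z - F 0)) (linepath 0 z)"
    "\<forall>z. Volterra g f z = F z - F 0"
    using Volterra_primitive[OF f g] by (elim exE conjE)
  then show ?thesis by simp
qed

lemma Volterra_diff:
  assumes f: "f holomorphic_on UNIV" and h: "h holomorphic_on UNIV" and g: "g holomorphic_on UNIV"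
  shows "Volterra g (\<lambda>z. f z - h z) z = Volterra g f z - Volterra g h z"
proof -
  have "((\<lambda>w. (f w - h w) * deriv g w) has_contour_integral (Volterra g f z - Volterra g h z)) (linepath 0 z)"
    using has_contour_integral_diff[OF Volterra_has_contour_integral[OF f g, of z] Volterra_has_contour_integral[OF h g, of z]]
    by (simp only: left_diff_distrib)
  then show ?thesis unfolding Volterra_def[of g "\<lambda>z. f z - h z"] by (rule contour_integral_unique)
qed

lemma Volterra_scale:
  assumes f: "f holomorphic_on UNIV" and g: "g holomorphic_on UNIV"
  shows "Volterra g (\<lambda>z. c * f z) z = c * Volterra g f z"
proof -
  have "((\<lambda>w. c * f w * deriv g w) has_contour_integral (c * Volterra g f z)) (linepath 0 z)"
    using has_contour_integral_lmul[OF Volterra_has_contour_integral[OF f g, of z], of c]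
    by (simp only: mult.assoc)
  then show ?thesis unfolding Volterra_def[of g "\<lambda>z. c * f z"] by (rule contour_integral_unique)
qed

section \<open>Quasi-norms, pointwise bounds and inclusions\<close>

lemma FS_iff: "f \<in> FS p m \<longleftrightarrow> f holomorphic_on UNIV \<and> fs_integral p m f < \<infinity>"
  by (simp add: FS_def)

lemma fs_norm_nonneg [simp]: "fs_norm p m f \<ge> 0"
  by (simp add: fs_norm_def)

lemma fs_integral_eq_norm:
  assumes "f \<in> FS p m" "p > 0"
  shows "fs_integral p m f = ennreal (fs_norm p m f powr p)"
  using assms by (simp add: FS_def fs_norm_def powr_powr)

lemma fs_norm_leI:
  assumes "fs_integral p m f \<le> ennreal (B powr p)" "p > 0" "B \<ge> 0"
  shows "fs_norm p m f \<le> B"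
proof -
  have "enn2real (fs_integral p m f) \<le> B powr p"
    using assms(1) by (intro enn2real_leI) auto
  then have "fs_norm p m f \<le> (B powr p) powr (1 / p)"
    unfolding fs_norm_def using assms by (intro powr_mono2) auto
  then show ?thesis using assms by (simp add: powr_powr)
qed

lemma fs_integral_le_norm:
  assumes "f \<in> FS p m" "p > 0" "fs_norm p m f \<le> B"
  shows "fs_integral p m f \<le> ennreal (B powr p)"
  unfolding fs_integral_eq_norm[OF assms(1,2)] using assms by (intro ennreal_leI powr_mono2) auto

lemma fs_integral_scale: "fs_integral p m (\<lambda>z. c * f z) = ennreal (cmod c powr p) * fs_integral p m f"
  if "f holomorphic_on UNIV"
proof -
  note [measurable] = entire_measurable[OF that]
  have "fs_integral p m (\<lambda>z. c * f z) = (\<integral>\<^sup>+z. ennreal (cmod c powr p) * fw m p f z \<partial>lborel)"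
    unfolding fs_integral_wt
    by (intro nn_integral_cong) (simp add: norm_mult mult.assoc powr_mult ennreal_mult[symmetric])
  also have "\<dots> = ennreal (cmod c powr p) * fs_integral p m f"
    unfolding fs_integral_wt by (rule nn_integral_cmult) measurable
  finally show ?thesis .
qed

lemma FS_scale: "f \<in> FS p m \<Longrightarrow> (\<lambda>z. c * f z) \<in> FS p m"
  by (auto simp: FS_iff fs_integral_scale ennreal_mult_less_top intro!: holomorphic_intros)

lemma fs_norm_scale:
  assumes "f \<in> FS p m" "p > 0"
  shows "fs_norm p m (\<lambda>z. c * f z) = cmod c * fs_norm p m f"
  using assms unfolding fs_norm_def
  by (simp add: FS_iff fs_integral_scale enn2real_mult powr_mult powr_powr)

text \<open>For \<open>p < 1\<close> there is only a quasi-norm; the constant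
  \<open>2 powr p\<close> covers all exponents at once.\<close>

lemma fs_integral_diff_le:
  assumes f: "f holomorphic_on UNIV" and h: "h holomorphic_on UNIV" and p: "p > 0"
  shows "fs_integral p m (\<lambda>z. f z - h z) \<le> ennreal (2 powr p) * (fs_integral p m f + fs_integral p m h)"
proof -
  note [measurable] = entire_measurable[OF f] entire_measurable[OF h]
  have "fs_integral p m (\<lambda>z. f z - h z) \<le> (\<integral>\<^sup>+z. ennreal (2 powr p) *
     (fw m p f z + fw m p h z) \<partial>lborel)"
    unfolding fs_integral_wt
  proof (intro nn_integral_mono)
    fix z
    have "(cmod (f z - h z) * wt m z) powr p \<le> (cmod (f z) * wt m z + cmod (h z) * wt m z) powr p"
      using p by (intro powr_mono2) (auto simp: distrib_right[symmetric] norm_triangle_ineq4 intro!: mult_right_mono)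
    also have "\<dots> \<le> 2 powr p * ((cmod (f z) * wt m z) powr p + (cmod (h z) * wt m z) powr p)"
      using p by (intro powr_add_le) auto
    finally show "ennreal ((cmod (f z - h z) * wt m z) powr p) \<le> ennreal (2 powr p) *
     (fw m p f z + fw m p h z)"
      by (simp add: ennreal_mult[symmetric] ennreal_plus[symmetric] del: ennreal_plus)
  qed
  also have "\<dots> = ennreal (2 powr p) * (fs_integral p m f + fs_integral p m h)"
    unfolding fs_integral_wt by (subst nn_integral_cmult) (auto simp: nn_integral_add)
  finally show ?thesis .
qed

lemma FS_diff:
  assumes "f \<in> FS p m" "h \<in> FS p m" "p > 0"
  shows "(\<lambda>z. f z - h z) \<in> FS p m"
  using assms fs_integral_diff_le[of f h p m]
  by (auto simp: FS_iff ennreal_mult_less_top intro!: holomorphic_intros intro: order.strict_trans1)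

lemma pointwise_norm:
  assumes p: "p > 0"
  obtains C where "C > 0" "\<And>f z. f \<in> FS p m \<Longrightarrow> cmod (f z) * wt m z \<le> C * fs_norm p m f"
proof -
  obtain C where C: "C > 0" "\<And>f w. f holomorphic_on UNIV \<Longrightarrow>
     fw m p f w \<le> ennreal C *
     (\<integral>\<^sup>+z. fw m p f z * indicator (ball w 1) z \<partial>lborel)"
    using pointwise_local[OF p] by blast
  show thesis
  proof (rule that[of "C powr (1/p)"])
    fix f z assume f: "f \<in> FS p m"
    then have fh: "f holomorphic_on UNIV" by (simp add: FS_iff)
    have "fw m p f z \<le> ennreal C * fs_integral p m f"
      unfolding fs_integral_wt
      by (rule order.trans[OF C(2)[OF fh]]) (intro mult_left_mono nn_integral_mono, auto simp: indicator_def)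
    also have "\<dots> = ennreal (C * fs_norm p m f powr p)"
      using C by (simp add: fs_integral_eq_norm[OF f p] ennreal_mult)
    finally have "(cmod (f z) * wt m z) powr p \<le> C * fs_norm p m f powr p"
      using C by (subst (asm) ennreal_le_iff) auto
    then have "((cmod (f z) * wt m z) powr p) powr (1/p) \<le> (C * fs_norm p m f powr p) powr (1/p)"
      using p by (intro powr_mono2) auto
    then show "cmod (f z) * wt m z \<le> C powr (1/p) * fs_norm p m f"
      using p C by (simp add: powr_powr powr_mult)
  qed (use C in simp)
qed

lemma deriv_pointwise_norm:
  assumes p: "p > 0"
  obtains C where "C > 0" "\<And>f z. f \<in> FS p m \<Longrightarrow> cmod (deriv f z) * wt m z / (1 + cmod z) \<le> C * fs_norm p m f"
proof -
  obtain C where C: "C > 0" "\<And>f w. f holomorphic_on UNIV \<Longrightarrow>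
     dw m p (deriv f) w \<le> ennreal C *
     (\<integral>\<^sup>+z. fw m p f z * indicator (ball w 2) z \<partial>lborel)"
    using deriv_local[OF p] by blast
  show thesis
  proof (rule that[of "C powr (1/p)"])
    fix f z assume f: "f \<in> FS p m"
    then have fh: "f holomorphic_on UNIV" by (simp add: FS_iff)
    have "dw m p (deriv f) z \<le> ennreal C * fs_integral p m f"
      unfolding fs_integral_wt
      by (rule order.trans[OF C(2)[OF fh]]) (intro mult_left_mono nn_integral_mono, auto simp: indicator_def)
    also have "\<dots> = ennreal (C * fs_norm p m f powr p)"
      using C by (simp add: fs_integral_eq_norm[OF f p] ennreal_mult)
    finally have "(cmod (deriv f z) * wt m z / (1 + cmod z)) powr p \<le> C * fs_norm p m f powr p"
      using C by (subst (asm) ennreal_le_iff) auto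
    then have "((cmod (deriv f z) * wt m z / (1 + cmod z)) powr p) powr (1/p) \<le> (C * fs_norm p m f powr p) powr (1/p)"
      using p by (intro powr_mono2) auto
    then show "cmod (deriv f z) * wt m z / (1 + cmod z) \<le> C powr (1/p) * fs_norm p m f"
      using p C by (simp add: powr_powr powr_mult)
  qed (use C in simp)
qed

text \<open>Of the \<open>q\<close> factors in \<open>|f|^q\<close>, the excess \<open>q - p\<close>
  is estimated by the supremum from \<open>pointwise_norm\<close> and the rest is
  integrated.\<close>

lemma FS_embedding:
  assumes p: "0 < p" "p \<le> q"
  obtains C where "C > 0" "\<And>f. f \<in> FS p m \<Longrightarrow> f \<in> FS q m \<and> fs_norm q m f \<le> C * fs_norm p m f"
proof -
  obtain C where C: "C > 0" "\<And>f z. f \<in> FS p m \<Longrightarrow> cmod (f z) * wt m z \<le> C * fs_norm p m f"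
    using pointwise_norm[OF p(1)] by blast
  have q: "q > 0" using p by simp
  show thesis
  proof (rule that[of "C powr ((q - p) / q)"])
    fix f assume f: "f \<in> FS p m"
    then have fh: "f holomorphic_on UNIV" by (simp add: FS_iff)
    note [measurable] = entire_measurable[OF fh]
    define N where "N = fs_norm p m f"
    have N: "N \<ge> 0" by (simp add: N_def)
    have "fs_integral q m f \<le> (\<integral>\<^sup>+z. ennreal ((C * N) powr (q - p)) * fw m p f z \<partial>lborel)"
      unfolding fs_integral_wt
    proof (intro nn_integral_mono)
      fix z
      have "(cmod (f z) * wt m z) powr q = (cmod (f z) * wt m z) powr (q - p) * (cmod (f z) * wt m z) powr p"
        by (simp add: powr_add[symmetric])
      also have "\<dots> \<le> (C * N) powr (q - p) * (cmod (f z) * wt m z) powr p"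
        using C(2)[OF f, of z] p by (intro mult_right_mono powr_mono2) (auto simp: N_def)
      finally show "fw m q f z \<le> ennreal ((C * N) powr (q - p)) * fw m p f z"
        by (simp add: ennreal_mult[symmetric])
    qed
    also have "\<dots> = ennreal ((C * N) powr (q - p)) * fs_integral p m f"
      unfolding fs_integral_wt by (rule nn_integral_cmult) measurable
    also have "\<dots> = ennreal ((C * N) powr (q - p) * N powr p)"
      by (simp add: fs_integral_eq_norm[OF f p(1)] ennreal_mult N_def)
    also have "(C * N) powr (q - p) * N powr p = (C powr ((q - p) / q) * N) powr q"
      using N C p by (simp add: powr_mult powr_powr powr_add[symmetric] mult.assoc)
    finally have *: "fs_integral q m f \<le> ennreal ((C powr ((q - p) / q) * N) powr q)" .
    then have "f \<in> FS q m" using fh by (auto simp: FS_iff intro: order.strict_trans1)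
    moreover have "fs_norm q m f \<le> C powr ((q - p) / q) * N"
      using * q N by (intro fs_norm_leI) auto
    ultimately show "f \<in> FS q m \<and> fs_norm q m f \<le> C powr ((q - p) / q) * fs_norm p m f"
      by (simp add: N_def)
  qed (use C in simp)
qed

lemma Volterra_integral_le:
  assumes g: "g holomorphic_on UNIV" and q: "q > 0"
  obtains C where "C > 0" "\<And>f. f holomorphic_on UNIV \<Longrightarrow> fs_integral q m (Volterra g f) \<le> ennreal C *
      (\<integral>\<^sup>+z. ennreal ((cmod (f z) * wt m z * (cmod (deriv g z) / (1 + cmod z))) powr q) \<partial>lborel)"
proof -
  obtain C where C: "C > 0" "\<And>f. f holomorphic_on UNIV \<Longrightarrow> f 0 = 0 \<Longrightarrow>
    fs_integral q m f \<le> ennreal C *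
      (\<integral>\<^sup>+z. dw m q (deriv f) z \<partial>lborel)"
    using norm_le_deriv_norm[OF q] by blast
  show thesis
  proof (rule that[OF C(1)])
    fix f :: "complex \<Rightarrow> complex" assume f: "f holomorphic_on UNIV"
    show "fs_integral q m (Volterra g f) \<le> ennreal C *
      (\<integral>\<^sup>+z. ennreal ((cmod (f z) * wt m z * (cmod (deriv g z) / (1 + cmod z))) powr q) \<partial>lborel)"
      using C(2)[OF Volterra_entire(1,3)[OF f g]]
      by (simp add: Volterra_entire(2)[OF f g] norm_mult mult_ac)
  qed
qed

lemma Volterra_integral_ge:
  assumes g: "g holomorphic_on UNIV" and q: "q > 0"
  obtains C where "C > 0" "\<And>f. f holomorphic_on UNIV \<Longrightarrow>
      (\<integral>\<^sup>+z. ennreal ((cmod (f z) * wt m z * (cmod (deriv g z) / (1 + cmod z))) powr q) \<partial>lborel)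
      \<le> ennreal C * fs_integral q m (Volterra g f)"
proof -
  obtain C where C: "C > 0" "\<And>f. f holomorphic_on UNIV \<Longrightarrow>
     (\<integral>\<^sup>+z. dw m q (deriv f) z \<partial>lborel) \<le> ennreal C * fs_integral q m f"
    using deriv_norm_le[OF q] by blast
  show thesis
  proof (rule that[OF C(1)])
    fix f :: "complex \<Rightarrow> complex" assume f: "f holomorphic_on UNIV"
    show "(\<integral>\<^sup>+z. ennreal ((cmod (f z) * wt m z * (cmod (deriv g z) / (1 + cmod z))) powr q) \<partial>lborel)
      \<le> ennreal C * fs_integral q m (Volterra g f)"
      using C(2)[OF Volterra_entire(1)[OF f g]]
      by (simp add: Volterra_entire(2)[OF f g] norm_mult mult_ac)
  qed
qed

section \<open>Necessary conditions: reproducing-kernel-type test functions\<close>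

text \<open>The radial formula turns this into a one-dimensional integral with exponent
  \<open>r / 2 > 1\<close>. The number 2 is the dimension of the plane and the source of the
  dichotomy for \<open>q < p\<close>.\<close>

lemma nn_integral_power_decay:
  assumes r: "r > (2::real)"
  shows "(\<integral>\<^sup>+z. ennreal ((1 + cmod z) powr (- r)) \<partial>lborel) < \<infinity>"
proof -
  define a where "a = r / 2"
  have a: "a > 1" using r by (simp add: a_def)
  have "(\<integral>\<^sup>+z. ennreal ((1 + cmod z) powr (- r)) \<partial>lborel) \<le> (\<integral>\<^sup>+z. ennreal ((1 + (cmod z)\<^sup>2) powr (- a)) \<partial>lborel)"
  proof (intro nn_integral_mono ennreal_leI)
    fix z
    have "(1 + cmod z) powr (- r) = ((1 + cmod z)\<^sup>2) powr (- a)"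
      using powr_powr[of "1 + cmod z" 2 "- a"] by (simp add: a_def powr_numeral add_pos_nonneg)
    also have "\<dots> \<le> (1 + (cmod z)\<^sup>2) powr (- a)"
      using a by (intro powr_mono2') (auto simp: power2_eq_square algebra_simps intro: add_pos_nonneg)
    finally show "(1 + cmod z) powr (- r) \<le> (1 + (cmod z)\<^sup>2) powr (- a)" .
  qed
  also have "\<dots> = ennreal pi * (\<integral>\<^sup>+t. ennreal ((1 + t) powr (- a)) * indicator {0..} t \<partial>lborel)"
    by (rule nn_integral_lborel_radial) measurable
  also have "(\<integral>\<^sup>+t. ennreal ((1 + t) powr (- a)) * indicator {0..} t \<partial>lborel) = 0 - (1 + 0) powr (1 - a) / (1 - a)"
  proof (rule nn_integral_FTC_atLeast)
    show "((\<lambda>t. (1 + t) powr (1 - a) / (1 - a)) has_real_derivative (1 + t) powr (- a)) (at t)" if "0 \<le> t" for t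
      using that a by (auto intro!: derivative_eq_intros)
    show "((\<lambda>t. (1 + t) powr (1 - a) / (1 - a)) \<longlongrightarrow> 0) at_top"
    proof -
      have "((\<lambda>t. (1 + t) powr (1 - a)) \<longlongrightarrow> 0) at_top"
        using a by (intro tendsto_neg_powr filterlim_tendsto_add_at_top[OF tendsto_const] filterlim_ident) auto
      then show ?thesis by (rule tendsto_eq_intros) (use a in auto)
    qed
  qed auto
  finally show ?thesis by (rule order.strict_trans1) (simp add: ennreal_mult_less_top)
qed

lemma nn_integral_tail_small:
  fixes H :: "complex \<Rightarrow> ennreal"
  assumes [measurable]: "H \<in> borel_measurable borel" and fin: "(\<integral>\<^sup>+z. H z \<partial>lborel) < \<infinity>" and \<epsilon>: "\<epsilon> > 0"
  obtains R where "R \<ge> 0" "(\<integral>\<^sup>+z. H z * indicator {z. R < cmod z} z \<partial>lborel) < \<epsilon>"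
proof -
  have [measurable]: "{z. real n < cmod z} \<in> sets borel" for n
    by measurable
  have "(\<lambda>n. \<integral>\<^sup>+z. H z * indicator {z. real n < cmod z} z \<partial>lborel) \<longlonglongrightarrow> (\<integral>\<^sup>+z. 0 \<partial>(lborel :: complex measure))"
  proof (rule nn_integral_dominated_convergence[where w=H])
    show "AE z in lborel. (\<lambda>n. H z * indicator {z. real n < cmod z} z) \<longlonglongrightarrow> 0"
    proof (intro AE_I2 tendsto_eventually)
      fix z
      obtain N where "cmod z \<le> real N" using real_arch_simple by blast
      then show "\<forall>\<^sub>F n in sequentially. H z * indicator {z. real n < cmod z} z = 0"
        by (intro eventually_sequentiallyI[of N]) (auto simp: indicator_def)
    qed
    show "AE z in lborel. H z * indicator {z. real n < cmod z} z \<le> H z" for n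
      by (auto simp: indicator_def)
  qed (use fin in auto)
  then have "\<forall>\<^sub>F n in sequentially. (\<integral>\<^sup>+z. H z * indicator {z. real n < cmod z} z \<partial>lborel) < \<epsilon>"
    using \<epsilon> by (simp add: order_tendsto_iff)
  then obtain n where "(\<integral>\<^sup>+z. H z * indicator {z. real n < cmod z} z \<partial>lborel) < \<epsilon>"
    using eventually_happens'[OF sequentially_bot] by blast
  then show thesis using that[of "real n"] by simp
qed

text \<open>With \<open>j = k + n\<close> and \<open>x = |z|\<close>, the estimate
  \<open>(1 + x)^j \<le> exp (j x)\<close> leaves the exponent \<open>j x - x^2 / 2\<close>, whose
  maximum is \<open>j^2 / 2\<close>.\<close>

lemma wt_bound: "wt k z * (1 + cmod z) ^ n \<le> exp ((real (k + n))\<^sup>2 / 2)"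
proof -
  define x where "x = cmod z"
  have x: "x \<ge> 0" by (simp add: x_def)
  have "(1 + x) ^ (k + n) \<le> exp x ^ (k + n)"
    using x exp_ge_add_one_self[of x] by (intro power_mono) auto
  also have "\<dots> = exp (real (k + n) * x)" by (simp only: exp_of_nat_mult)
  finally have "wt k z * (1 + cmod z) ^ n \<le> exp (- x\<^sup>2 / 2) * exp (real (k + n) * x)"
    unfolding wt_def x_def[symmetric] by (simp add: power_add[symmetric] mult.assoc)
  also have "\<dots> = exp (- x\<^sup>2 / 2 + real (k + n) * x)" by (simp only: exp_add)
  also have "\<dots> \<le> exp ((real (k + n))\<^sup>2 / 2)"
  proof -
    have "0 \<le> (x - real (k + n))\<^sup>2" by simp
    also have "\<dots> = x\<^sup>2 - 2 * (real (k + n) * x) + (real (k + n))\<^sup>2"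
      by (simp add: power2_eq_square algebra_simps)
    finally show ?thesis by (subst exp_le_cancel_iff) simp
  qed
  finally show ?thesis .
qed

lemma nn_integral_wt_powr_finite:
  assumes p: "p > 0"
  shows "(\<integral>\<^sup>+z. ennreal (wt k z powr p) \<partial>lborel) < \<infinity>"
proof -
  obtain n :: nat where n: "3 / p \<le> real n" using real_arch_simple by blast
  have n3: "3 \<le> real n * p" using n p by (simp add: field_simps)
  define B where "B = exp ((real (k + n))\<^sup>2 / 2)"
  have B: "B > 0" by (simp add: B_def)
  have "(\<integral>\<^sup>+z. ennreal (wt k z powr p) \<partial>lborel) \<le> (\<integral>\<^sup>+z. ennreal (B powr p) * ennreal ((1 + cmod z) powr (- 3)) \<partial>lborel)"
  proof (intro nn_integral_mono)
    fix z
    have z1: "1 + cmod z > 0" by (simp add: add_pos_nonneg)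
    have "wt k z \<le> B * (1 + cmod z) powr (- real n)"
      using wt_bound[of k z n] z1 by (simp add: B_def powr_minus powr_realpow field_simps)
    then have "wt k z powr p \<le> (B * (1 + cmod z) powr (- real n)) powr p"
      using p by (intro powr_mono2) auto
    also have "\<dots> = B powr p * (1 + cmod z) powr (- (real n * p))"
      using B by (simp add: powr_mult powr_powr)
    also have "\<dots> \<le> B powr p * (1 + cmod z) powr (- 3)"
      using n3 z1 by (intro mult_left_mono powr_mono) auto
    finally show "ennreal (wt k z powr p) \<le> ennreal (B powr p) * ennreal ((1 + cmod z) powr (- 3))"
      by (simp add: ennreal_mult[symmetric])
  qed
  also have "\<dots> = ennreal (B powr p) * (\<integral>\<^sup>+z. ennreal ((1 + cmod z) powr (- 3)) \<partial>lborel)"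
    by (rule nn_integral_cmult) measurable
  also have "\<dots> < \<infinity>"
    using nn_integral_power_decay[of 3] by (simp add: ennreal_mult_less_top)
  finally show ?thesis .
qed

lemma monomial_in_FS:
  assumes p: "p > 0"
  shows "(\<lambda>z. z ^ n) \<in> FS p m"
proof -
  have "fs_integral p m (\<lambda>z. z ^ n) \<le> (\<integral>\<^sup>+z. ennreal (wt (n + m) z powr p) \<partial>lborel)"
    unfolding fs_integral_wt
  proof (intro nn_integral_mono ennreal_leI powr_mono2)
    fix z :: complex
    have "cmod z ^ n \<le> (1 + cmod z) ^ n" by (intro power_mono) auto
    then have "cmod z ^ n * wt m z \<le> (1 + cmod z) ^ n * wt m z" by (intro mult_right_mono) auto
    also have "\<dots> = wt (n + m) z" by (simp add: wt_def power_add)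
    finally show "cmod (z ^ n) * wt m z \<le> wt (n + m) z" by (simp add: norm_power)
  qed (use p in auto)
  also have "\<dots> < \<infinity>" by (rule nn_integral_wt_powr_finite[OF p])
  finally show ?thesis by (auto simp: FS_iff intro!: holomorphic_intros)
qed

text \<open>
  The normalised reproducing kernel of the classical Fock space, scaled so that its weighted
  modulus is 1 at \<open>w\<close>.
\<close>

definition kern :: "nat \<Rightarrow> complex \<Rightarrow> complex \<Rightarrow> complex" where
  "kern m w z = exp (cnj w * z - of_real ((cmod w)\<^sup>2 / 2)) / of_real ((1 + cmod w) ^ m)"

lemma kern_entire: "kern m w holomorphic_on UNIV"
  unfolding kern_def using add_pos_nonneg[of 1 "cmod w"]
  by (intro holomorphic_intros) (auto simp del: of_real_power of_real_add)

lemma norm_kern_wt: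
  "cmod (kern m w z) * wt m z = exp (- (cmod (z - w))\<^sup>2 / 2) * ((1 + cmod z) / (1 + cmod w)) ^ m"
proof -
  have w1: "1 + cmod w > 0" by (simp add: add_pos_nonneg)
  have sq: "Re (cnj w * z) - (cmod w)\<^sup>2 / 2 + - (cmod z)\<^sup>2 / 2 = - (cmod (z - w))\<^sup>2 / 2"
    unfolding cmod_power2 by (simp add: power2_eq_square field_simps)
  have "cmod (kern m w z) = exp (Re (cnj w * z) - (cmod w)\<^sup>2 / 2) / (1 + cmod w) ^ m"
    unfolding kern_def using w1 by (simp add: norm_divide norm_exp_eq_Re norm_power del: of_real_power of_real_add)
  then have "cmod (kern m w z) * wt m z
      = (exp (Re (cnj w * z) - (cmod w)\<^sup>2 / 2) * exp (- (cmod z)\<^sup>2 / 2)) * ((1 + cmod z) / (1 + cmod w)) ^ m"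
    by (simp add: wt_def power_divide)
  also have "exp (Re (cnj w * z) - (cmod w)\<^sup>2 / 2) * exp (- (cmod z)\<^sup>2 / 2) = exp (- (cmod (z - w))\<^sup>2 / 2)"
    by (simp only: exp_add[symmetric] sq)
  finally show ?thesis .
qed

lemma norm_kern_diag: "cmod (kern m w w) * wt m w = 1"
proof -
  have "1 + cmod w > 0" by (simp add: add_pos_nonneg)
  then show ?thesis unfolding norm_kern_wt by simp
qed

lemma norm_kern_le: "cmod (kern m w z) * wt m z \<le> wt m (z - w)"
proof -
  have w1: "1 + cmod w > 0" by (simp add: add_pos_nonneg)
  have "(1 + cmod z) / (1 + cmod w) \<le> 1 + cmod (z - w)"
    using one_plus_norm_le[of z w] w1 by (simp add: field_simps)
  then have "((1 + cmod z) / (1 + cmod w)) ^ m \<le> (1 + cmod (z - w)) ^ m"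
    using w1 by (intro power_mono) auto
  then show ?thesis
    unfolding norm_kern_wt by (simp add: wt_def)
qed

text \<open>The weighted modulus of the kernel is dominated by a translate of the fixed function
  \<open>wt m\<close>, so translation invariance gives one bound for all \<open>w\<close>.\<close>

lemma kern_norm_bounded:
  assumes p: "p > 0"
  obtains B where "B > 0" "\<And>w. kern m w \<in> FS p m \<and> fs_norm p m (kern m w) \<le> B"
proof -
  define G where "G = (\<integral>\<^sup>+z. ennreal (wt m z powr p) \<partial>lborel)"
  have Gfin: "G < \<infinity>" unfolding G_def by (rule nn_integral_wt_powr_finite[OF p])
  have le: "fs_integral p m (kern m w) \<le> G" for w
  proof -
    have "fs_integral p m (kern m w) \<le> (\<integral>\<^sup>+z. ennreal (wt m (- w + z) powr p) \<partial>lborel)"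
      unfolding fs_integral_wt using p norm_kern_le[of m w]
      by (intro nn_integral_mono ennreal_leI powr_mono2) auto
    also have "\<dots> = G" unfolding G_def
      by (rule nn_integral_lborel_translate[where f="\<lambda>z. ennreal (wt m z powr p)"]) measurable
    finally show ?thesis .
  qed
  have FS: "kern m w \<in> FS p m" for w
    using le[of w] Gfin kern_entire by (auto simp: FS_iff intro: order.strict_trans1)
  have "fs_norm p m (kern m w) \<le> 1 + enn2real G powr (1 / p)" for w
  proof -
    have "enn2real (fs_integral p m (kern m w)) \<le> enn2real G"
      using le[of w] Gfin by (intro enn2real_mono) auto
    then have "fs_norm p m (kern m w) \<le> enn2real G powr (1 / p)"
      unfolding fs_norm_def using p by (intro powr_mono2) auto
    then show ?thesis by simp
  qed
  then show thesis using FS that[of "1 + enn2real G powr (1 / p)"] by (simp add: add_pos_nonneg)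
qed

section \<open>Growth of the derivative of the symbol\<close>

lemma deriv_quadratic:
  assumes "\<And>z. g z = a * z\<^sup>2 + b * z + (c::complex)"
  shows "deriv g z = 2 * a * z + b"
proof -
  have "g = (\<lambda>z. a * z\<^sup>2 + b * z + c)" using assms by auto
  then have "(g has_field_derivative 2 * a * z + b) (at z)"
    by (auto intro!: derivative_eq_intros)
  then show ?thesis by (rule DERIV_imp_deriv)
qed

text \<open>Linear growth of \<open>g'\<close> gives quadratic growth of \<open>g\<close> along
  segments from 0, and Liouville's theorem leaves a polynomial of degree at most 2.\<close>

lemma quadratic_of_deriv_growth:
  assumes g: "g holomorphic_on UNIV" and C: "\<And>w. cmod (deriv g w) \<le> C * (1 + cmod w)"
  shows "\<exists>a b c. \<forall>z. g z = a * z\<^sup>2 + b * z + c"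
proof -
  have C0: "C \<ge> 0" using C[of 0] by (simp add: order.trans[OF norm_ge_zero])
  have bd: "cmod (g z) \<le> (cmod (g 0) + 2 * C) * cmod z ^ 2" if z: "1 \<le> cmod z" for z
  proof -
    obtain v where v: "v \<in> closed_segment 0 z" "cmod (g z - g 0) \<le> cmod (deriv g v) * cmod (z - 0)"
      using mean_value_segment[OF g] by blast
    have "cmod v \<le> cmod z" using segment_bound(1)[OF v(1)] by simp
    then have "cmod (deriv g v) \<le> C * (1 + cmod z)"
      using C[of v] C0 by (smt (verit) mult_left_mono)
    also have "\<dots> \<le> C * (2 * cmod z)" using z C0 by (intro mult_left_mono) auto
    finally have "cmod (deriv g v) * cmod z \<le> C * (2 * cmod z) * cmod z" by (intro mult_right_mono) auto
    then have 1: "cmod (g z - g 0) \<le> 2 * C * cmod z ^ 2" using v(2) by (simp add: power2_eq_square mult_ac)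
    have "1 \<le> cmod z ^ 2" using z by simp
    then have "cmod (g 0) * 1 \<le> cmod (g 0) * cmod z ^ 2" by (intro mult_left_mono) auto
    then show ?thesis using 1 norm_triangle_ineq[of "g z - g 0" "g 0"] by (simp add: distrib_right)
  qed
  define d where "d k = (deriv ^^ k) g 0 / fact k" for k
  have "g z = (\<Sum>k\<le>2. d k * z ^ k)" for z
    unfolding d_def using Liouville_polynomial[OF g bd] by simp
  then have "g z = d 2 * z\<^sup>2 + d 1 * z + d 0" for z
    by (simp add: numeral_2_eq_2)
  then show ?thesis by blast
qed

text \<open>The pointwise bound for derivatives is applied to the image of \<open>kern m w\<close>
  at the point \<open>w\<close> itself. There the derivative is
  \<open>kern m w w * deriv g w\<close>, and the normalisation leaves exactly
  \<open>|g' w| / (1 + |w|)\<close>. The case \<open>q < p\<close> starts from this result as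
  well.\<close>

lemma Vol_bounded_imp_quadratic:
  assumes g: "g holomorphic_on UNIV" and p: "p > 0" and q: "q > 0" and bdd: "Vol_bounded m p q g"
  shows "\<exists>a b c. \<forall>z. g z = a * z\<^sup>2 + b * z + c"
proof -
  obtain C where C: "\<And>f. f \<in> FS p m \<Longrightarrow> Volterra g f \<in> FS q m \<and> fs_norm q m (Volterra g f) \<le> C * fs_norm p m f"
    using bdd unfolding Vol_bounded_def by blast
  obtain B where B: "B > 0" "\<And>w. kern m w \<in> FS p m \<and> fs_norm p m (kern m w) \<le> B"
    using kern_norm_bounded[OF p] by blast
  obtain D where D: "D > 0" "\<And>f z. f \<in> FS q m \<Longrightarrow> cmod (deriv f z) * wt m z / (1 + cmod z) \<le> D * fs_norm q m f"
    using deriv_pointwise_norm[OF q] by blast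
  show ?thesis
  proof (rule quadratic_of_deriv_growth[OF g])
    fix w
    let ?k = "kern m w"
    have w1: "1 + cmod w > 0" by (simp add: add_pos_nonneg)
    have V: "Volterra g ?k \<in> FS q m" "fs_norm q m (Volterra g ?k) \<le> C * fs_norm p m ?k"
      using C B by blast+
    have "cmod (deriv g w) / (1 + cmod w) = cmod (deriv (Volterra g ?k) w) * wt m w / (1 + cmod w)"
      using norm_kern_diag[of m w] by (simp add: Volterra_entire(2)[OF kern_entire g] norm_mult mult.commute mult.left_commute)
    also have "\<dots> \<le> D * fs_norm q m (Volterra g ?k)" by (rule D(2)[OF V(1)])
    also have "\<dots> \<le> D * (\<bar>C\<bar> * B)"
    proof (intro mult_left_mono)
      have "C * fs_norm p m ?k \<le> \<bar>C\<bar> * fs_norm p m ?k" by (intro mult_right_mono) auto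
      also have "\<dots> \<le> \<bar>C\<bar> * B" using B by (intro mult_left_mono) auto
      finally show "fs_norm q m (Volterra g ?k) \<le> \<bar>C\<bar> * B" using V(2) by simp
    qed (use D in simp)
    finally show "cmod (deriv g w) \<le> D * (\<bar>C\<bar> * B) * (1 + cmod w)"
      using w1 by (simp add: field_simps)
  qed
qed

text \<open>For quadratic \<open>g\<close> the multiplier \<open>|g'| / (1 + |z|)\<close> is bounded
  by \<open>K\<close>, so the inclusion of the spaces does the rest.\<close>

lemma Vol_bounded_of_quadratic:
  assumes g: "g holomorphic_on UNIV" and p: "0 < p" "p \<le> q"
    and quad: "\<And>z. g z = a * z\<^sup>2 + b * z + c"
  shows "Vol_bounded m p q g"
proof -
  have q: "q > 0" using p by simp
  define K where "K = 2 * cmod a + cmod b"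
  have K: "cmod (deriv g z) / (1 + cmod z) \<le> K" for z
  proof -
    have "cmod (deriv g z) \<le> cmod (2 * a * z) + cmod b"
      unfolding deriv_quadratic[of g, OF quad] by (rule norm_triangle_ineq)
    also have "\<dots> \<le> K * (1 + cmod z)"
      by (simp add: K_def norm_mult algebra_simps add_increasing)
    finally show ?thesis by (simp add: field_simps add_pos_nonneg)
  qed
  have K0: "K \<ge> 0" by (simp add: K_def)
  obtain C where C: "C > 0" "\<And>f. f holomorphic_on UNIV \<Longrightarrow> fs_integral q m (Volterra g f) \<le> ennreal C *
      (\<integral>\<^sup>+z. ennreal ((cmod (f z) * wt m z * (cmod (deriv g z) / (1 + cmod z))) powr q) \<partial>lborel)"
    using Volterra_integral_le[OF g q] by blast
  obtain E where E: "E > 0" "\<And>f. f \<in> FS p m \<Longrightarrow> f \<in> FS q m \<and> fs_norm q m f \<le> E * fs_norm p m f"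
    using FS_embedding[OF p] by blast
  show ?thesis
    unfolding Vol_bounded_def
  proof (intro exI ballI)
    fix f assume f: "f \<in> FS p m"
    then have fh: "f holomorphic_on UNIV" by (simp add: FS_iff)
    note [measurable] = entire_measurable[OF fh]
    have fq: "f \<in> FS q m" "fs_norm q m f \<le> E * fs_norm p m f" using E f by auto
    have "fs_integral q m (Volterra g f) \<le> ennreal C *
      (\<integral>\<^sup>+z. ennreal ((cmod (f z) * wt m z * (cmod (deriv g z) / (1 + cmod z))) powr q) \<partial>lborel)"
      by (rule C(2)[OF fh])
    also have "\<dots> \<le> ennreal C * (\<integral>\<^sup>+z. ennreal (K powr q) * fw m q f z \<partial>lborel)"
    proof (intro mult_left_mono nn_integral_mono)
      fix z
      have "(cmod (f z) * wt m z * (cmod (deriv g z) / (1 + cmod z))) powr q \<le> (K * (cmod (f z) * wt m z)) powr q"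
        using mult_left_mono[OF K, of "cmod (f z) * wt m z" z] q by (intro powr_mono2) (auto simp: mult_ac)
      then show "ennreal ((cmod (f z) * wt m z * (cmod (deriv g z) / (1 + cmod z))) powr q)
         \<le> ennreal (K powr q) * fw m q f z"
        using K0 by (simp add: ennreal_mult[symmetric] powr_mult)
    qed simp
    also have "\<dots> = ennreal C * (ennreal (K powr q) * fs_integral q m f)"
      unfolding fs_integral_wt by (subst nn_integral_cmult) auto
    also have "\<dots> = ennreal (C * (K powr q * fs_norm q m f powr q))"
      using C by (simp add: fs_integral_eq_norm[OF fq(1) q] ennreal_mult)
    also have "C * (K powr q * fs_norm q m f powr q) = (C powr (1/q) * (K * fs_norm q m f)) powr q"
      using C q K0 by (simp add: powr_mult powr_powr)
    finally have *: "fs_integral q m (Volterra g f) \<le> ennreal ((C powr (1/q) * (K * fs_norm q m f)) powr q)" .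
    have "Volterra g f \<in> FS q m"
      using * Volterra_entire(1)[OF fh g] by (auto simp: FS_iff intro: order.strict_trans1)
    moreover have "fs_norm q m (Volterra g f) \<le> C powr (1/q) * (K * fs_norm q m f)"
      using * q K0 by (intro fs_norm_leI) auto
    moreover have "C powr (1/q) * (K * fs_norm q m f) \<le> C powr (1/q) * (K * (E * fs_norm p m f))"
      using fq K0 by (intro mult_left_mono) auto
    ultimately show "Volterra g f \<in> FS q m \<and> fs_norm q m (Volterra g f) \<le> (C powr (1/q) * (K * E)) * fs_norm p m f"
      by (simp add: mult.assoc)
  qed
qed

text \<open>If no bound exists, normalised functions \<open>h n\<close> have images of norm above
  \<open>n\<close>; but along a subsequence the images converge, hence stay bounded.\<close>

lemma Vol_compact_imp_bounded:
  assumes g: "g holomorphic_on UNIV" and p: "p > 0" and q: "q > 0" and comp: "Vol_compact m p q g"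
  shows "Vol_bounded m p q g"
proof (rule ccontr)
  assume nb: "\<not> Vol_bounded m p q g"
  have V: "Volterra g f \<in> FS q m" if "f \<in> FS p m" for f
    using comp that by (auto simp: Vol_compact_def)
  have "\<exists>f. f \<in> FS p m \<and> fs_norm q m (Volterra g f) > real n * fs_norm p m f" for n :: nat
  proof (rule ccontr)
    assume "\<nexists>f. f \<in> FS p m \<and> fs_norm q m (Volterra g f) > real n * fs_norm p m f"
    then have "Vol_bounded m p q g"
      unfolding Vol_bounded_def using V by (intro exI[of _ "real n"]) (auto simp: not_less)
    then show False using nb by simp
  qed
  then obtain f where f: "\<And>n::nat. f n \<in> FS p m" "\<And>n. fs_norm q m (Volterra g (f n)) > real n * fs_norm p m (f n)"
    by metis
  have fh: "f n holomorphic_on UNIV" for n using f by (simp add: FS_iff)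
  obtain P where P: "P > 0" "\<And>f z. f \<in> FS p m \<Longrightarrow> cmod (f z) * wt m z \<le> P * fs_norm p m f"
    using pointwise_norm[OF p] by blast
  \<comment> \<open>Otherwise \<open>f n\<close> vanishes identically and so does its image, against
    the strict inequality that selected \<open>f n\<close>.\<close>
  have pos: "fs_norm p m (f n) > 0" for n
  proof (rule ccontr)
    assume "\<not> fs_norm p m (f n) > 0"
    then have "fs_norm p m (f n) = 0" by (simp add: order.antisym)
    then have "f n z = 0" for z
      using P(2)[OF f(1), of n z] wt_pos[of m z] by (simp add: mult_le_0_iff not_le)
    then have "f n = (\<lambda>z. 0 * f n z)" by auto
    then have "Volterra g (f n) z = 0" for z
      using Volterra_scale[OF fh g, of 0 n z] by simp
    then have "fs_norm q m (Volterra g (f n)) = 0"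
      using q by (simp add: fs_norm_def fs_integral_def)
    then show False using f(2)[of n] by (simp add: \<open>fs_norm p m (f n) = 0\<close>)
  qed
  define c where "c n = complex_of_real (1 / fs_norm p m (f n))" for n
  define h where "h n = (\<lambda>z. c n * f n z)" for n
  have h: "h n \<in> FS p m" "fs_norm p m (h n) \<le> 1" for n
  proof -
    show "h n \<in> FS p m" unfolding h_def by (rule FS_scale[OF f(1)])
    have "fs_norm p m (h n) = cmod (c n) * fs_norm p m (f n)"
      unfolding h_def by (rule fs_norm_scale[OF f(1) p])
    then show "fs_norm p m (h n) \<le> 1" using pos[of n] by (simp add: c_def norm_divide)
  qed
  have Vh: "fs_norm q m (Volterra g (h n)) > real n" for n
  proof -
    have "Volterra g (h n) = (\<lambda>z. c n * Volterra g (f n) z)"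
      unfolding h_def using Volterra_scale[OF fh g] by auto
    then have "fs_norm q m (Volterra g (h n)) = cmod (c n) * fs_norm q m (Volterra g (f n))"
      using fs_norm_scale[OF V[OF f(1)] q] by simp
    then have "fs_norm q m (Volterra g (h n)) = fs_norm q m (Volterra g (f n)) / fs_norm p m (f n)"
      by (simp add: c_def norm_divide)
    then show ?thesis using f(2)[of n] pos[of n] by (simp add: pos_less_divide_eq)
  qed
  obtain r k where r: "strict_mono r" "k \<in> FS q m"
    "(\<lambda>n. fs_norm q m (\<lambda>z. Volterra g (h (r n)) z - k z)) \<longlonglongrightarrow> 0"
    using comp h unfolding Vol_compact_def by blast
  have kh: "k holomorphic_on UNIV" using r by (simp add: FS_iff)
  \<comment> \<open>The bound for \<open>|d + k|\<close> in quasi-norm when \<open>d\<close> has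
    norm below 1; the sum is written as a difference with \<open>(-1) * k\<close> so that
    \<open>fs_integral_diff_le\<close> applies.\<close>
  define A where "A = 2 powr q * (1 + fs_norm q m k powr q)"
  have "\<forall>\<^sub>F n in sequentially. fs_norm q m (\<lambda>z. Volterra g (h (r n)) z - k z) < 1"
    using r(3) by (simp add: order_tendsto_iff)
  moreover have "\<forall>\<^sub>F n in sequentially. n > nat \<lceil>A powr (1/q)\<rceil>" by (rule eventually_gt_at_top)
  ultimately have "\<forall>\<^sub>F n in sequentially. fs_norm q m (\<lambda>z. Volterra g (h (r n)) z - k z) < 1 \<and> n > nat \<lceil>A powr (1/q)\<rceil>"
    by (rule eventually_conj)
  then obtain n where n: "fs_norm q m (\<lambda>z. Volterra g (h (r n)) z - k z) < 1" "n > nat \<lceil>A powr (1/q)\<rceil>"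
    using eventually_happens'[OF sequentially_bot] by blast
  define d where "d = (\<lambda>z. Volterra g (h (r n)) z - k z)"
  have d: "d \<in> FS q m" unfolding d_def using V[OF h(1)] r(2) q by (rule FS_diff)
  have mk: "(\<lambda>z. (-1) * k z) \<in> FS q m" by (rule FS_scale[OF r(2)])
  have "fs_integral q m (\<lambda>z. d z - (-1) * k z) \<le> ennreal (2 powr q) * (fs_integral q m d + fs_integral q m (\<lambda>z. (-1) * k z))"
    using d mk q by (intro fs_integral_diff_le) (auto simp: FS_iff)
  also have "(\<lambda>z. d z - (-1) * k z) = Volterra g (h (r n))" by (auto simp: d_def)
  also have "fs_integral q m (\<lambda>z. (-1) * k z) = fs_integral q m k"
    by (subst fs_integral_scale[OF kh]) simp
  also have "fs_integral q m k = ennreal (fs_norm q m k powr q)" by (rule fs_integral_eq_norm[OF r(2) q])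
  also have "fs_integral q m d \<le> ennreal (1 powr q)"
    using n(1) by (intro fs_integral_le_norm[OF d q]) (simp add: d_def)
  finally have "fs_integral q m (Volterra g (h (r n))) \<le> ennreal (2 powr q) * (ennreal (1 powr q) + ennreal (fs_norm q m k powr q))"
    by (auto simp: mult_left_mono add_right_mono)
  also have "\<dots> = ennreal ((A powr (1/q)) powr q)"
    using q by (simp add: A_def powr_powr ennreal_mult add_nonneg_nonneg)
  finally have "fs_norm q m (Volterra g (h (r n))) \<le> A powr (1/q)"
    using q by (intro fs_norm_leI) auto
  moreover have "real (r n) \<ge> real n" using seq_suble[OF r(1), of n] by simp
  moreover have "real n > A powr (1/q)" using n(2) by linarith
  ultimately show False using Vh[of "r n"] by linarith
qed

text \<open>Kernels centred at the integers tend to 0 pointwise, so any limit \<open>h\<close> of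
  their images has derivative 0. The derivative estimate at the centres then forces
  \<open>|2 a n + b| / (1 + n)\<close> to tend to 0 along a subsequence, whereas its limit is
  \<open>|2 a|\<close>.\<close>

lemma Vol_compact_imp_linear:
  assumes g: "g holomorphic_on UNIV" and p: "p > 0" and q: "q > 0" and comp: "Vol_compact m p q g"
  shows "\<exists>a b. \<forall>z. g z = a * z + b"
proof -
  obtain a b c where quad: "\<And>z. g z = a * z\<^sup>2 + b * z + c"
    using Vol_bounded_imp_quadratic[OF g p q Vol_compact_imp_bounded[OF g p q comp]] by blast
  have dg: "deriv g z = 2 * a * z + b" for z by (rule deriv_quadratic[OF quad])
  obtain B where B: "B > 0" "\<And>w. kern m w \<in> FS p m \<and> fs_norm p m (kern m w) \<le> B"
    using kern_norm_bounded[OF p] by blast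
  define k where "k n = (\<lambda>z. complex_of_real (1 / B) * kern m (of_nat n) z)" for n
  have k: "k n \<in> FS p m" "fs_norm p m (k n) \<le> 1" for n
  proof -
    have K: "kern m (of_nat n) \<in> FS p m" "fs_norm p m (kern m (of_nat n)) \<le> B" using B by auto
    show "k n \<in> FS p m" unfolding k_def by (rule FS_scale[OF K(1)])
    have "fs_norm p m (k n) = cmod (complex_of_real (1 / B)) * fs_norm p m (kern m (of_nat n))"
      unfolding k_def by (rule fs_norm_scale[OF K(1) p])
    then show "fs_norm p m (k n) \<le> 1" using K(2) B(1) by (simp add: norm_divide)
  qed
  have kh: "k n holomorphic_on UNIV" for n using k by (simp add: FS_iff)
  obtain r h where r: "strict_mono r" "h \<in> FS q m"
    "(\<lambda>n. fs_norm q m (\<lambda>z. Volterra g (k (r n)) z - h z)) \<longlonglongrightarrow> 0"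
    using comp k unfolding Vol_compact_def by blast
  have hh: "h holomorphic_on UNIV" using r by (simp add: FS_iff)
  define \<delta> where "\<delta> n = fs_norm q m (\<lambda>z. Volterra g (k (r n)) z - h z)" for n
  obtain D where D: "D > 0" "\<And>f z. f \<in> FS q m \<Longrightarrow> cmod (deriv f z) * wt m z / (1 + cmod z) \<le> D * fs_norm q m f"
    using deriv_pointwise_norm[OF q] by blast
  have est: "cmod (k (r n) z * deriv g z - deriv h z) * wt m z / (1 + cmod z) \<le> D * \<delta> n" for n z
  proof -
    have "(\<lambda>z. Volterra g (k (r n)) z - h z) \<in> FS q m"
      using comp k r q by (intro FS_diff) (auto simp: Vol_compact_def)
    moreover have "deriv (\<lambda>z. Volterra g (k (r n)) z - h z) z = k (r n) z * deriv g z - deriv h z"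
    proof -
      have "Volterra g (k (r n)) field_differentiable at z" "h field_differentiable at z"
        using Volterra_entire(1)[OF kh g] hh by (auto intro: holomorphic_on_imp_differentiable_at)
      then show ?thesis by (simp add: deriv_diff Volterra_entire(2)[OF kh g])
    qed
    ultimately show ?thesis using D(2) unfolding \<delta>_def by metis
  qed
  have k0: "(\<lambda>n. k (r n) z) \<longlonglongrightarrow> 0" for z
  proof -
    define E where "E = exp ((real (m + 1))\<^sup>2 / 2)"
    have "cmod (k n z) \<le> E / (B * wt m z) * inverse (1 + cmod (z - of_nat n))" for n
    proof -
      have pos: "1 + cmod (z - of_nat n) > 0" by (simp add: add_pos_nonneg)
      have "cmod (kern m (of_nat n) z) * wt m z \<le> wt m (z - of_nat n)" by (rule norm_kern_le)
      also have "\<dots> \<le> E / (1 + cmod (z - of_nat n))"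
        using wt_bound[of m "z - of_nat n" 1] pos by (simp add: E_def field_simps)
      finally have "cmod (kern m (of_nat n) z) \<le> E / (1 + cmod (z - of_nat n)) / wt m z"
        by (simp only: pos_le_divide_eq[OF wt_pos])
      then have "cmod (kern m (of_nat n) z) / B \<le> E / (1 + cmod (z - of_nat n)) / wt m z / B"
        using B(1) by (intro divide_right_mono) auto
      also have "\<dots> = E / (B * wt m z) * inverse (1 + cmod (z - of_nat n))"
        by (simp add: divide_inverse mult_ac)
      finally show ?thesis using B(1) by (simp add: k_def norm_mult norm_divide)
    qed
    then have 1: "cmod (k n z) \<le> E / (B * wt m z) * inverse (1 + cmod (z - of_nat n))" for n .
    have "filterlim (\<lambda>n. 1 + cmod (z - of_nat n)) at_top sequentially"
    proof (rule filterlim_at_top_mono)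
      show "filterlim (\<lambda>n. (1 - cmod z) + real n) at_top sequentially"
        by (rule filterlim_tendsto_add_at_top[OF tendsto_const filterlim_real_sequentially])
      show "\<forall>\<^sub>F n in sequentially. (1 - cmod z) + real n \<le> 1 + cmod (z - of_nat n)"
      proof (intro always_eventually allI)
        fix n
        show "(1 - cmod z) + real n \<le> 1 + cmod (z - of_nat n)"
          using norm_triangle_ineq2[of "of_nat n" z] by (simp add: norm_minus_commute)
      qed
    qed
    then have "(\<lambda>n. inverse (1 + cmod (z - of_nat n))) \<longlonglongrightarrow> 0"
      by (rule tendsto_inverse_0_at_top)
    then have "(\<lambda>n. E / (B * wt m z) * inverse (1 + cmod (z - of_nat n))) \<longlonglongrightarrow> E / (B * wt m z) * 0"
      by (intro tendsto_mult tendsto_const)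
    then have "(\<lambda>n. k n z) \<longlonglongrightarrow> 0"
      using 1 by (intro Lim_null_comparison[of "\<lambda>n. k n z"]) auto
    then show ?thesis using LIMSEQ_subseq_LIMSEQ[OF _ r(1)] by (auto simp: o_def)
  qed
  have d0: "(\<lambda>n. D * \<delta> n) \<longlonglongrightarrow> 0"
    using tendsto_mult[OF tendsto_const r(3), of D] by (simp add: \<delta>_def)
  \<comment> \<open>Only the derivative is compared: convergence in norm gives pointwise convergence
    of derivatives, and those of the images tend to 0 because the kernels do.\<close>
  have h0: "deriv h z = 0" for z
  proof -
    have "(\<lambda>n. cmod (k (r n) z * deriv g z - deriv h z) * wt m z / (1 + cmod z)) \<longlonglongrightarrow> cmod (0 * deriv g z - deriv h z) * wt m z / (1 + cmod z)"
      by (intro tendsto_intros k0) (use add_pos_nonneg[of 1 "cmod z"] in auto)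
    then have "cmod (0 * deriv g z - deriv h z) * wt m z / (1 + cmod z) \<le> 0"
      using d0 est by (intro LIMSEQ_le[of _ _ "\<lambda>n. D * \<delta> n"]) auto
    then have "cmod (deriv h z) * wt m z \<le> 0" using add_pos_nonneg[of 1 "cmod z"] by (simp add: divide_le_0_iff)
    then show ?thesis using wt_pos[of m z] by (simp add: mult_le_0_iff)
  qed
  have "cmod (2 * a * of_nat (r n) + b) / (1 + real (r n)) \<le> B * (D * \<delta> n)" for n
  proof -
    let ?w = "of_nat (r n) :: complex"
    have "cmod (k (r n) ?w * deriv g ?w) * wt m ?w / (1 + cmod ?w) \<le> D * \<delta> n"
      using est[of n ?w] by (simp add: h0)
    moreover have "cmod (k (r n) ?w * deriv g ?w) * wt m ?w / (1 + cmod ?w)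
      = (cmod (kern m ?w ?w) * wt m ?w) * cmod (deriv g ?w) / (B * (1 + cmod ?w))"
      using B by (simp add: k_def norm_mult norm_divide)
    ultimately have "cmod (deriv g ?w) / (B * (1 + cmod ?w)) \<le> D * \<delta> n"
      unfolding norm_kern_diag by simp
    then have "cmod (deriv g ?w) / (1 + cmod ?w) \<le> B * (D * \<delta> n)"
      using B(1) by (simp add: field_simps add_pos_nonneg)
    then show ?thesis by (simp add: dg)
  qed
  moreover have "(\<lambda>n. B * (D * \<delta> n)) \<longlonglongrightarrow> 0" using tendsto_mult[OF tendsto_const d0, of B] by simp
  moreover have "(\<lambda>n. cmod (2 * a * of_nat (r n) + b) / (1 + real (r n))) \<longlonglongrightarrow> cmod (2 * a)"
  proof -
    have i: "(\<lambda>n. inverse (1 + of_nat n) :: complex) \<longlonglongrightarrow> 0"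
      using tendsto_of_real[OF LIMSEQ_inverse_real_of_nat, where ?'a=complex] by simp
    have "(\<lambda>n. 2 * a + (b - 2 * a) * inverse (1 + of_nat n)) \<longlonglongrightarrow> 2 * a + (b - 2 * a) * 0"
      by (intro tendsto_intros i)
    moreover have "2 * a + (b - 2 * a) * inverse (1 + of_nat n) = (2 * a * of_nat n + b) / (1 + of_nat n)" for n
    proof -
      have "(1 + of_nat n :: complex) \<noteq> 0" by (metis of_nat_Suc of_nat_neq_0)
      then show ?thesis by (simp add: field_simps)
    qed
    ultimately have "(\<lambda>n. (2 * a * of_nat n + b) / (1 + of_nat n)) \<longlonglongrightarrow> 2 * a" by simp
    then have "(\<lambda>n. cmod ((2 * a * of_nat n + b) / (1 + of_nat n))) \<longlonglongrightarrow> cmod (2 * a)"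
      by (rule tendsto_norm)
    moreover have "cmod (1 + of_nat n) = 1 + real n" for n
      by (metis norm_of_nat of_nat_Suc)
    ultimately have "(\<lambda>n. cmod (2 * a * of_nat n + b) / (1 + real n)) \<longlonglongrightarrow> cmod (2 * a)"
      by (simp add: norm_divide)
    then show ?thesis using LIMSEQ_subseq_LIMSEQ[OF _ r(1)] by (auto simp: o_def)
  qed
  ultimately have "cmod (2 * a) \<le> 0"
    by (intro LIMSEQ_le[of _ _ "\<lambda>n. B * (D * \<delta> n)"]) auto
  then have "a = 0" by simp
  then show ?thesis using quad by auto
qed

section \<open>Compactness for affine symbols\<close>

text \<open>
  The one property of the pair \<open>(p, q)\<close> that compactness for affine symbols depends on.
\<close>

definition uniform_tails :: "nat \<Rightarrow> real \<Rightarrow> real \<Rightarrow> bool" where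
  "uniform_tails m p q \<longleftrightarrow> (\<forall>M. \<forall>\<epsilon>>0. \<exists>R\<ge>0. \<forall>f\<in>FS p m. fs_norm p m f \<le> M \<longrightarrow>
     (\<integral>\<^sup>+z. dw m q f z * indicator {z. R < cmod z} z \<partial>lborel) \<le> ennreal \<epsilon>)"

text \<open>Beyond radius \<open>R\<close> the divisor contributes at most
  \<open>(1 + R) powr (- q)\<close>, and the embedding bounds the rest uniformly; \<open>R\<close>
  is then solved from \<epsilon>.\<close>

lemma uniform_tails_le:
  assumes p: "0 < p" "p \<le> q"
  shows "uniform_tails m p q"
  unfolding uniform_tails_def
proof (intro allI impI)
  fix M \<epsilon> :: real assume \<epsilon>: "\<epsilon> > 0"
  have q: "q > 0" using p by simp
  obtain E where E: "E > 0" "\<And>f. f \<in> FS p m \<Longrightarrow> f \<in> FS q m \<and> fs_norm q m f \<le> E * fs_norm p m f"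
    using FS_embedding[OF p] by blast
  define A where "A = (E * \<bar>M\<bar>) powr q"
  define R where "R = (A / \<epsilon>) powr (1 / q)"
  have R: "R \<ge> 0" by (simp add: R_def)
  have "A / \<epsilon> = R powr q" using q \<epsilon> by (simp add: R_def powr_powr A_def)
  also have "\<dots> \<le> (1 + R) powr q" using q R by (intro powr_mono2) auto
  finally have AR: "A / (1 + R) powr q \<le> \<epsilon>" using \<epsilon> R by (simp add: field_simps)
  show "\<exists>R\<ge>0. \<forall>f\<in>FS p m. fs_norm p m f \<le> M \<longrightarrow>
     (\<integral>\<^sup>+z. dw m q f z * indicator {z. R < cmod z} z \<partial>lborel) \<le> ennreal \<epsilon>"
  proof (intro exI[of _ R] conjI R ballI impI)
    fix f assume f: "f \<in> FS p m" "fs_norm p m f \<le> M"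
    then have fh: "f holomorphic_on UNIV" by (simp add: FS_iff)
    note [measurable] = entire_measurable[OF fh]
    have fq: "f \<in> FS q m" "fs_norm q m f \<le> E * \<bar>M\<bar>"
    proof -
      have "E * fs_norm p m f \<le> E * \<bar>M\<bar>" using f E by (intro mult_left_mono) auto
      then show "f \<in> FS q m" "fs_norm q m f \<le> E * \<bar>M\<bar>" using E(2)[OF f(1)] by auto
    qed
    have "(\<integral>\<^sup>+z. dw m q f z * indicator {z. R < cmod z} z \<partial>lborel)
      \<le> (\<integral>\<^sup>+z. ennreal (1 / (1 + R) powr q) * fw m q f z \<partial>lborel)"
    proof (intro nn_integral_mono)
      fix z
      have "(cmod (f z) * wt m z / (1 + cmod z)) powr q \<le> (cmod (f z) * wt m z / (1 + R)) powr q" if "R < cmod z"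
        using q R that by (intro powr_mono2 divide_left_mono) (auto simp: add_pos_nonneg)
      then show "dw m q f z * indicator {z. R < cmod z} z
        \<le> ennreal (1 / (1 + R) powr q) * fw m q f z"
        using R by (auto simp: indicator_def ennreal_mult[symmetric] powr_divide)
    qed
    also have "\<dots> = ennreal (1 / (1 + R) powr q) * fs_integral q m f"
      unfolding fs_integral_wt by (rule nn_integral_cmult) measurable
    also have "\<dots> \<le> ennreal (1 / (1 + R) powr q) * ennreal A"
      unfolding A_def by (intro mult_left_mono fs_integral_le_norm[OF fq(1) q fq(2)]) auto
    also have "\<dots> \<le> ennreal \<epsilon>"
      using AR by (simp add: ennreal_mult[symmetric] A_def ennreal_leI)
    finally show "(\<integral>\<^sup>+z. dw m q f z * indicator {z. R < cmod z} z \<partial>lborel) \<le> ennreal \<epsilon>" .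
  qed
qed

text \<open>Young's inequality for the exponent \<open>p / q\<close> and its conjugate. The proof
  only asks which of the two terms dominates, so the constants are not the sharp ones.\<close>

lemma young_powr:
  fixes x y \<delta> :: real
  assumes "x \<ge> 0" "y > 0" "\<delta> > 0" and q: "0 < q" "q < p"
  shows "(x * y) powr q \<le> \<delta> * x powr p + \<delta> powr (- (q / (p - q))) * y powr (p * q / (p - q))"
proof (cases "y powr q \<le> \<delta> * x powr (p - q)")
  case True
  have "(x * y) powr q = x powr q * y powr q" using assms by (simp add: powr_mult)
  also have "\<dots> \<le> x powr q * (\<delta> * x powr (p - q))" using True by (intro mult_left_mono) auto
  also have "\<dots> = \<delta> * x powr p" by (simp add: powr_add[symmetric])
  finally show ?thesis using assms by (simp add: add_increasing2)
next
  case False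
  then have "x powr (p - q) \<le> y powr q / \<delta>" using assms by (simp add: field_simps)
  then have "(x powr (p - q)) powr (q / (p - q)) \<le> (y powr q / \<delta>) powr (q / (p - q))"
    using q by (intro powr_mono2) auto
  then have "x powr q \<le> (y powr q / \<delta>) powr (q / (p - q))"
    using q by (simp add: powr_powr)
  also have "\<dots> = \<delta> powr (- (q / (p - q))) * y powr (q * (q / (p - q)))"
    using assms by (simp add: powr_divide powr_powr powr_minus_divide)
  finally have "x powr q * y powr q \<le> \<delta> powr (- (q / (p - q))) * y powr (q * (q / (p - q))) * y powr q"
    by (intro mult_right_mono) auto
  also have "\<dots> = \<delta> powr (- (q / (p - q))) * y powr (q * (q / (p - q)) + q)"
    by (simp add: powr_add)
  also have "q * (q / (p - q)) + q = p * q / (p - q)"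
    using q by (simp add: field_simps)
  finally show ?thesis using assms by (simp add: powr_mult add_increasing)
qed

text \<open>Young's inequality with \<open>y = 1 / (1 + |z|)\<close> separates \<open>f\<close> from
  the divisor. First \<delta> is taken small enough for the norm bound \<open>M\<close>, then
  \<open>R\<close> large enough for the tail of \<open>(1 + |z|) powr (- r)\<close>, which is
  integrable because the assumption says exactly \<open>r > 2\<close>.\<close>

lemma uniform_tails_gt:
  assumes q: "0 < q" "q < p" and pq: "q / 2 > (p - q) / p"
  shows "uniform_tails m p q"
  unfolding uniform_tails_def
proof (intro allI impI)
  fix M \<epsilon> :: real assume \<epsilon>: "\<epsilon> > 0"
  have p: "p > 0" using q by simp
  define r where "r = p * q / (p - q)"
  have r: "r > 2" using pq q by (simp add: r_def field_simps)
  define X where "X = \<bar>M\<bar> powr p + 1"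
  have X: "X > 0" by (simp add: X_def add_nonneg_pos)
  define \<delta> where "\<delta> = \<epsilon> / (2 * X)"
  have \<delta>: "\<delta> > 0" using \<epsilon> X by (simp add: \<delta>_def)
  have "\<delta> * \<bar>M\<bar> powr p \<le> \<delta> * X" using \<delta> by (simp add: X_def)
  also have "\<dots> = \<epsilon> / 2" using X by (simp add: \<delta>_def)
  finally have dM: "\<delta> * \<bar>M\<bar> powr p \<le> \<epsilon> / 2" .
  define K where "K = \<delta> powr (- (q / (p - q)))"
  have K: "K > 0" using \<delta> by (simp add: K_def)
  have mH [measurable]: "(\<lambda>z::complex. ennreal ((1 + cmod z) powr (- r))) \<in> borel_measurable borel" by measurable
  have "ennreal (\<epsilon> / (2 * K)) > 0" using \<epsilon> K by simp
  then obtain R where R: "R \<ge> 0"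
    "(\<integral>\<^sup>+z. ennreal ((1 + cmod z) powr (- r)) * indicator {z. R < cmod z} z \<partial>lborel) < ennreal (\<epsilon> / (2 * K))"
    using nn_integral_tail_small[OF mH nn_integral_power_decay[OF r]] by blast
  have [measurable]: "{z. R < cmod z} \<in> sets borel" by measurable
  show "\<exists>R\<ge>0. \<forall>f\<in>FS p m. fs_norm p m f \<le> M \<longrightarrow>
     (\<integral>\<^sup>+z. dw m q f z * indicator {z. R < cmod z} z \<partial>lborel) \<le> ennreal \<epsilon>"
  proof (intro exI[of _ R] conjI R ballI impI)
    fix f assume f: "f \<in> FS p m" "fs_norm p m f \<le> M"
    then have fh: "f holomorphic_on UNIV" by (simp add: FS_iff)
    note [measurable] = entire_measurable[OF fh]
    have "(\<integral>\<^sup>+z. dw m q f z * indicator {z. R < cmod z} z \<partial>lborel)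
      \<le> (\<integral>\<^sup>+z. ennreal \<delta> * fw m p f z +
           ennreal K * (ennreal ((1 + cmod z) powr (- r)) * indicator {z. R < cmod z} z) \<partial>lborel)"
    proof (intro nn_integral_mono)
      fix z
      have z1: "1 + cmod z > 0" by (simp add: add_pos_nonneg)
      have "(cmod (f z) * wt m z * (1 / (1 + cmod z))) powr q \<le> \<delta> * (cmod (f z) * wt m z) powr p + K * (1 / (1 + cmod z)) powr r"
        unfolding K_def r_def using \<delta> q z1 by (intro young_powr) auto
      also have "(1 / (1 + cmod z)) powr r = (1 + cmod z) powr (- r)"
        using z1 by (simp add: powr_divide powr_minus_divide)
      finally show "dw m q f z * indicator {z. R < cmod z} z
        \<le> ennreal \<delta> * fw m p f z +
           ennreal K * (ennreal ((1 + cmod z) powr (- r)) * indicator {z. R < cmod z} z)"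
        using \<delta> K by (auto simp: indicator_def ennreal_mult[symmetric] ennreal_plus[symmetric] simp del: ennreal_plus)
    qed
    also have "\<dots> = ennreal \<delta> * fs_integral p m f + ennreal K * (\<integral>\<^sup>+z. ennreal ((1 + cmod z) powr (- r)) * indicator {z. R < cmod z} z \<partial>lborel)"
      unfolding fs_integral_wt by (simp add: nn_integral_add nn_integral_cmult)
    also have "\<dots> \<le> ennreal \<delta> * ennreal (\<bar>M\<bar> powr p) + ennreal K * ennreal (\<epsilon> / (2 * K))"
      using R(2) f by (intro add_mono mult_left_mono fs_integral_le_norm[OF f(1) p]) auto
    also have "\<dots> = ennreal (\<delta> * \<bar>M\<bar> powr p + \<epsilon> / 2)"
      using \<delta> K \<epsilon> by (simp add: ennreal_mult[symmetric] ennreal_plus[symmetric] del: ennreal_plus)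
    also have "\<dots> \<le> ennreal \<epsilon>" using dM by (intro ennreal_leI) auto
    finally show "(\<integral>\<^sup>+z. dw m q f z * indicator {z. R < cmod z} z \<partial>lborel) \<le> ennreal \<epsilon>" .
  qed
qed

lemma nn_integral_split_disc_le:
  assumes f: "f holomorphic_on UNIV" and q: "q > 0" and B: "B \<ge> 0" and R: "R \<ge> 0"
    and fB: "\<And>z. z \<in> cball 0 R \<Longrightarrow> cmod (f z) \<le> B"
    and tail: "(\<integral>\<^sup>+z. dw m q f z * indicator {z. R < cmod z} z \<partial>lborel) \<le> ennreal \<epsilon>"
  shows "(\<integral>\<^sup>+z. dw m q f z \<partial>lborel)
    \<le> ennreal ((B * exp ((real m)\<^sup>2 / 2)) powr q * (pi * R\<^sup>2)) + ennreal \<epsilon>"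
proof -
  note [measurable] = entire_measurable[OF f]
  have [measurable]: "{z. R < cmod z} \<in> sets borel" by measurable
  have [measurable]: "(indicator (cball (0::complex) R) :: _ \<Rightarrow> ennreal) \<in> borel_measurable borel"
    by (rule borel_measurable_indicator) auto
  let ?h = "\<lambda>z. dw m q f z"
  have "(\<integral>\<^sup>+z. ?h z \<partial>lborel) \<le> (\<integral>\<^sup>+z. ennreal ((B * exp ((real m)\<^sup>2 / 2)) powr q) * indicator (cball 0 R) z
      + ?h z * indicator {z. R < cmod z} z \<partial>lborel)"
  proof (intro nn_integral_mono)
    fix z
    show "?h z \<le> ennreal ((B * exp ((real m)\<^sup>2 / 2)) powr q) * indicator (cball 0 R) z + ?h z * indicator {z. R < cmod z} z"
    proof (cases "R < cmod z")
      case False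
      have "cmod (f z) * wt m z / (1 + cmod z) \<le> cmod (f z) * wt m z"
        using divide_left_mono[of 1 "1 + cmod z" "cmod (f z) * wt m z"] by (simp add: add_pos_nonneg)
      also have "\<dots> \<le> B * exp ((real m)\<^sup>2 / 2)"
        using False wt_bound[of m z 0] B by (intro mult_mono fB) auto
      finally have "(cmod (f z) * wt m z / (1 + cmod z)) powr q \<le> (B * exp ((real m)\<^sup>2 / 2)) powr q"
        using q by (intro powr_mono2) auto
      then show ?thesis using False by (simp add: ennreal_leI)
    qed simp
  qed
  also have "\<dots> = ennreal ((B * exp ((real m)\<^sup>2 / 2)) powr q * (pi * R\<^sup>2)) + (\<integral>\<^sup>+z. ?h z * indicator {z. R < cmod z} z \<partial>lborel)"
    using R by (simp add: nn_integral_add nn_integral_cmult emeasure_lborel_ball_complex ennreal_mult)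
  also have "\<dots> \<le> ennreal ((B * exp ((real m)\<^sup>2 / 2)) powr q * (pi * R\<^sup>2)) + ennreal \<epsilon>"
    using tail by (rule add_left_mono)
  finally show ?thesis .
qed

lemma uniform_tails_finite:
  assumes ut: "uniform_tails m p q" and q: "q > 0" and f: "f \<in> FS p m"
  shows "(\<integral>\<^sup>+z. dw m q f z \<partial>lborel) < \<infinity>"
proof -
  have fh: "f holomorphic_on UNIV" using f by (simp add: FS_iff)
  obtain R where R: "R \<ge> 0" "(\<integral>\<^sup>+z. dw m q f z * indicator {z. R < cmod z} z \<partial>lborel) \<le> ennreal 1"
    using ut[unfolded uniform_tails_def, rule_format, of 1 "fs_norm p m f"] f by auto
  have "compact (f ` cball 0 R)"
    using holomorphic_on_imp_continuous_on[OF fh] by (intro compact_continuous_image) (auto intro: continuous_on_subset)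
  then obtain B where "\<forall>x\<in>f ` cball 0 R. norm x \<le> B"
    using compact_imp_bounded bounded_iff by blast
  then have B: "cmod (f z) \<le> \<bar>B\<bar>" if "z \<in> cball 0 R" for z
    using that by (meson abs_ge_self imageI order.trans)
  have "(\<integral>\<^sup>+z. dw m q f z \<partial>lborel)
     \<le> ennreal ((\<bar>B\<bar> * exp ((real m)\<^sup>2 / 2)) powr q * (pi * R\<^sup>2)) + ennreal 1"
    by (rule nn_integral_split_disc_le[OF fh q _ R(1) B R(2)]) auto
  then show ?thesis by (rule order.strict_trans1) simp
qed

text \<open>\<open>R\<close> is fixed first, by the uniform tails; on the remaining disc uniform
  convergence suffices.\<close>

lemma uniform_tails_null:
  assumes ut: "uniform_tails m p q" and q: "q > 0"
    and f: "\<And>n. f n \<in> FS p m" "\<And>n. fs_norm p m (f n) \<le> M"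
    and lim: "\<And>R. uniform_limit (cball 0 R) f (\<lambda>_. 0) sequentially"
  shows "(\<lambda>n. \<integral>\<^sup>+z. dw m q (f n) z \<partial>lborel) \<longlonglongrightarrow> 0"
proof (rule tendsto_zero_ennreal)
  fix \<epsilon> :: real assume \<epsilon>: "0 < \<epsilon>"
  have fh: "f n holomorphic_on UNIV" for n using f by (simp add: FS_iff)
  obtain R where R: "R \<ge> 0" "\<And>f. f \<in> FS p m \<Longrightarrow> fs_norm p m f \<le> M \<Longrightarrow>
     (\<integral>\<^sup>+z. dw m q f z * indicator {z. R < cmod z} z \<partial>lborel) \<le> ennreal (\<epsilon> / 3)"
    using ut[unfolded uniform_tails_def, rule_format, of "\<epsilon> / 3" M] \<epsilon> by auto
  define W where "W = exp ((real m)\<^sup>2 / 2)"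
  define A where "A = pi * R\<^sup>2 + 1"
  have A: "A > 0" by (simp add: A_def add_nonneg_pos)
  \<comment> \<open>Solved from \<open>(\<eta> * W) powr q * A = \<epsilon> / 3\<close>, where
    \<open>W\<close> bounds the weight and \<open>A\<close> exceeds the area of the disc. The added
    1 in \<open>A\<close> avoids division by 0 when \<open>R = 0\<close>.\<close>
  define \<eta> where "\<eta> = (\<epsilon> / (3 * A)) powr (1 / q) / W"
  have \<eta>: "\<eta> > 0" using \<epsilon> A by (simp add: \<eta>_def W_def)
  have e: "(\<eta> * W) powr q = \<epsilon> / (3 * A)"
    using q \<epsilon> A by (simp add: \<eta>_def W_def powr_powr)
  have "(\<eta> * W) powr q * (pi * R\<^sup>2) \<le> \<epsilon> / (3 * A) * A"
    unfolding e using \<epsilon> A by (intro mult_left_mono) (auto simp: A_def)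
  also have "\<dots> = \<epsilon> / 3" using A by simp
  finally have small: "(\<eta> * W) powr q * (pi * R\<^sup>2) \<le> \<epsilon> / 3" .
  have "\<forall>\<^sub>F n in sequentially. \<forall>z\<in>cball 0 R. dist (f n z) 0 < \<eta>"
    using lim[of R] \<eta> by (auto simp: uniform_limit_iff)
  then show "\<forall>\<^sub>F n in sequentially. (\<integral>\<^sup>+z. dw m q (f n) z \<partial>lborel) < ennreal \<epsilon>"
  proof (rule eventually_mono)
    fix n assume n: "\<forall>z\<in>cball 0 R. dist (f n z) 0 < \<eta>"
    have "(\<integral>\<^sup>+z. dw m q (f n) z \<partial>lborel)
       \<le> ennreal ((\<eta> * exp ((real m)\<^sup>2 / 2)) powr q * (pi * R\<^sup>2)) + ennreal (\<epsilon> / 3)"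
    proof (rule nn_integral_split_disc_le[OF fh q _ R(1) _ R(2)[OF f]])
      show "cmod (f n z) \<le> \<eta>" if "z \<in> cball 0 R" for z
        using bspec[OF n that] by simp
    qed (use \<eta> in simp)
    also have "\<dots> = ennreal ((\<eta> * W) powr q * (pi * R\<^sup>2) + \<epsilon> / 3)"
      using \<epsilon> by (simp add: W_def)
    also have "\<dots> < ennreal \<epsilon>" using small \<epsilon> by (intro ennreal_lessI) auto
    finally show "(\<integral>\<^sup>+z. dw m q (f n) z \<partial>lborel) < ennreal \<epsilon>" .
  qed
qed

lemma Volterra_linear_integral_le:
  assumes g: "g holomorphic_on UNIV" and q: "q > 0" and lin: "\<And>z. g z = a * z + b"
  obtains C where "C > 0" "\<And>f. f holomorphic_on UNIV \<Longrightarrow> fs_integral q m (Volterra g f) \<le> ennreal C *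
      (\<integral>\<^sup>+z. dw m q f z \<partial>lborel)"
proof -
  obtain C where C: "C > 0" "\<And>f. f holomorphic_on UNIV \<Longrightarrow> fs_integral q m (Volterra g f) \<le> ennreal C *
      (\<integral>\<^sup>+z. ennreal ((cmod (f z) * wt m z * (cmod (deriv g z) / (1 + cmod z))) powr q) \<partial>lborel)"
    using Volterra_integral_le[OF g q] by blast
  have dg: "deriv g z = a" for z using deriv_quadratic[of g 0 a b z] lin by simp
  define K where "K = cmod a powr q + 1"
  have K: "K > 0" by (simp add: K_def add_nonneg_pos)
  show thesis
  proof (rule that[of "C * K"])
    fix f :: "complex \<Rightarrow> complex" assume f: "f holomorphic_on UNIV"
    note [measurable] = entire_measurable[OF f]
    have "fs_integral q m (Volterra g f) \<le> ennreal C *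
      (\<integral>\<^sup>+z. ennreal ((cmod (f z) * wt m z * (cmod (deriv g z) / (1 + cmod z))) powr q) \<partial>lborel)"
      by (rule C(2)[OF f])
    also have "\<dots> \<le> ennreal C * (\<integral>\<^sup>+z. ennreal K * dw m q f z \<partial>lborel)"
    proof (intro mult_left_mono nn_integral_mono)
      fix z
      have "(cmod (f z) * wt m z * (cmod (deriv g z) / (1 + cmod z))) powr q
         = (cmod a * (cmod (f z) * wt m z / (1 + cmod z))) powr q" by (simp add: dg mult_ac)
      also have "\<dots> = cmod a powr q * (cmod (f z) * wt m z / (1 + cmod z)) powr q"
        by (rule powr_mult)
      also have "\<dots> \<le> K * (cmod (f z) * wt m z / (1 + cmod z)) powr q"
        by (intro mult_right_mono) (auto simp: K_def)
      finally show "ennreal ((cmod (f z) * wt m z * (cmod (deriv g z) / (1 + cmod z))) powr q)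
         \<le> ennreal K * dw m q f z"
        using K by (simp add: ennreal_mult[symmetric])
    qed simp
    also have "\<dots> = ennreal (C * K) * (\<integral>\<^sup>+z. dw m q f z \<partial>lborel)"
      using C K by (simp add: nn_integral_cmult ennreal_mult mult.assoc)
    finally show "fs_integral q m (Volterra g f) \<le> ennreal (C * K) *
      (\<integral>\<^sup>+z. dw m q f z \<partial>lborel)" .
  qed (use C K in simp)
qed

text \<open>Used twice: for differences with a Montel limit, which gives compactness, and for Taylor
  remainders, which gives convergence of the Schmidt expansion.\<close>

lemma Volterra_linear_null:
  assumes g: "g holomorphic_on UNIV" and lin: "\<And>z. g z = a * z + b"
    and ut: "uniform_tails m p q" and q: "q > 0"
    and f: "\<And>n. f n \<in> FS p m" "\<And>n. fs_norm p m (f n) \<le> M"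
    and lim: "\<And>R. uniform_limit (cball 0 R) f (\<lambda>_. 0) sequentially"
  shows "(\<lambda>n. fs_norm q m (Volterra g (f n))) \<longlonglongrightarrow> 0"
proof -
  obtain C where C: "C > 0" "\<And>f. f holomorphic_on UNIV \<Longrightarrow> fs_integral q m (Volterra g f) \<le> ennreal C *
      (\<integral>\<^sup>+z. dw m q f z \<partial>lborel)"
    using Volterra_linear_integral_le[OF g q lin] by blast
  have fh: "f n holomorphic_on UNIV" for n using f by (simp add: FS_iff)
  have "(\<lambda>n. ennreal C * (\<integral>\<^sup>+z. dw m q (f n) z \<partial>lborel)) \<longlonglongrightarrow> ennreal C * 0"
    by (intro ennreal_tendsto_cmult uniform_tails_null[OF ut q f lim]) auto
  then have up: "(\<lambda>n. ennreal C * (\<integral>\<^sup>+z. dw m q (f n) z \<partial>lborel)) \<longlonglongrightarrow> 0"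
    by simp
  have "(\<lambda>n. fs_integral q m (Volterra g (f n))) \<longlonglongrightarrow> ennreal 0"
    unfolding ennreal_0
    by (rule tendsto_sandwich[OF always_eventually always_eventually tendsto_const up])
      (auto intro: C(2)[OF fh])
  then have "(\<lambda>n. enn2real (fs_integral q m (Volterra g (f n)))) \<longlonglongrightarrow> 0"
    by (rule tendsto_enn2real) simp
  then show ?thesis unfolding fs_norm_def
    by (rule tendsto_zero_powrI[OF _ tendsto_const]) (use q in auto)
qed

text \<open>Fatou's lemma; it places the locally uniform limit provided by Montel's theorem in the
  space.\<close>

lemma FS_pointwise_limit:
  assumes p: "p > 0" and f: "\<And>n. f n \<in> FS p m" "\<And>n. fs_norm p m (f n) \<le> B"
    and h: "h holomorphic_on UNIV" and lim: "\<And>z. (\<lambda>n. f n z) \<longlonglongrightarrow> h z"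
  shows "h \<in> FS p m" "fs_integral p m h \<le> ennreal (B powr p)"
proof -
  have fh: "f n holomorphic_on UNIV" for n using f by (simp add: FS_iff)
  have [measurable]: "f n \<in> borel_measurable borel" for n by (rule entire_measurable[OF fh])
  have "fs_integral p m h = (\<integral>\<^sup>+z. liminf (\<lambda>n. fw m p (f n) z) \<partial>lborel)"
    unfolding fs_integral_wt
  proof (intro nn_integral_cong)
    fix z
    have "(\<lambda>n. fw m p (f n) z) \<longlonglongrightarrow> fw m p h z"
      using p by (intro tendsto_ennrealI tendsto_powr' tendsto_mult tendsto_norm lim tendsto_const) auto
    then show "fw m p h z = liminf (\<lambda>n. fw m p (f n) z)"
      by (rule lim_imp_Liminf[OF sequentially_bot, symmetric])
  qed
  also have "\<dots> \<le> liminf (\<lambda>n. fs_integral p m (f n))"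
    unfolding fs_integral_wt by (rule nn_integral_liminf) measurable
  also have "\<dots> \<le> liminf (\<lambda>n. ennreal (B powr p))"
    by (intro Liminf_mono always_eventually allI fs_integral_le_norm[OF f(1) p f(2)])
  also have "\<dots> = ennreal (B powr p)" by (simp add: Liminf_const)
  finally show *: "fs_integral p m h \<le> ennreal (B powr p)" .
  then show "h \<in> FS p m" using h by (auto simp: FS_iff intro: order.strict_trans1)
qed

text \<open>The unit ball is locally bounded by \<open>pointwise_norm\<close>, so Montel's theorem
  gives a locally uniformly convergent subsequence. Its differences with the limit are bounded in
  norm and locally null, and the operator sends them to 0 in norm.\<close>

lemma Vol_compact_of_linear:
  assumes g: "g holomorphic_on UNIV" and lin: "\<And>z. g z = a * z + b"
    and p: "p > 0" and q: "q > 0" and ut: "uniform_tails m p q"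
  shows "Vol_compact m p q g"
  unfolding Vol_compact_def
proof (intro conjI ballI allI impI)
  obtain C where C: "C > 0" "\<And>f. f holomorphic_on UNIV \<Longrightarrow> fs_integral q m (Volterra g f) \<le> ennreal C *
      (\<integral>\<^sup>+z. dw m q f z \<partial>lborel)"
    using Volterra_linear_integral_le[OF g q lin] by blast
  have VFS: "Volterra g f \<in> FS q m" if f: "f \<in> FS p m" for f
  proof -
    have fh: "f holomorphic_on UNIV" using f by (simp add: FS_iff)
    have "ennreal C * (\<integral>\<^sup>+z. dw m q f z \<partial>lborel) < \<infinity>"
      using uniform_tails_finite[OF ut q f] by (simp add: ennreal_mult_less_top)
    then show ?thesis
      using C(2)[OF fh] Volterra_entire(1)[OF fh g] by (auto simp: FS_iff intro: order.strict_trans1)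
  qed
  show "Volterra g f \<in> FS q m" if "f \<in> FS p m" for f using VFS that .
  fix fs :: "nat \<Rightarrow> complex \<Rightarrow> complex"
  assume fs: "\<forall>n. fs n \<in> FS p m \<and> fs_norm p m (fs n) \<le> 1"
  obtain P where P: "P > 0" "\<And>f z. f \<in> FS p m \<Longrightarrow> cmod (f z) * wt m z \<le> P * fs_norm p m f"
    using pointwise_norm[OF p] by blast
  define \<H> where "\<H> = {f. f \<in> FS p m \<and> fs_norm p m f \<le> 1}"
  have Hh: "h holomorphic_on UNIV" if "h \<in> \<H>" for h using that by (simp add: \<H>_def FS_iff)
  have Hb: "\<exists>B. \<forall>h\<in>\<H>. \<forall>z\<in>K. cmod (h z) \<le> B" if K: "compact K" for K
  proof -
    have "continuous_on K (\<lambda>z. P / wt m z)"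
      by (intro continuous_intros) (auto simp: less_imp_neq[OF wt_pos, symmetric])
    then have "bounded ((\<lambda>z. P / wt m z) ` K)"
      using K by (intro compact_imp_bounded compact_continuous_image)
    then obtain B where B: "\<forall>x\<in>(\<lambda>z. P / wt m z) ` K. norm x \<le> B" unfolding bounded_iff by blast
    have "cmod (h z) \<le> B" if "h \<in> \<H>" "z \<in> K" for h z
    proof -
      have "cmod (h z) * wt m z \<le> P * fs_norm p m h" using that P by (simp add: \<H>_def)
      also have "\<dots> \<le> P" using that P by (simp add: \<H>_def mult_left_le)
      finally have "cmod (h z) \<le> P / wt m z" by (simp only: pos_le_divide_eq[OF wt_pos])
      also have "\<dots> \<le> norm (P / wt m z)" by (simp only: real_norm_def abs_ge_self)
      also have "\<dots> \<le> B" using B that by blast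
      finally show ?thesis .
    qed
    then show ?thesis by blast
  qed
  have rng: "range fs \<subseteq> \<H>" using fs by (auto simp: \<H>_def)
  obtain f r where f: "f holomorphic_on UNIV" "strict_mono (r :: nat \<Rightarrow> nat)"
     "\<And>x. x \<in> UNIV \<Longrightarrow> ((\<lambda>n. fs (r n) x) \<longlongrightarrow> f x) sequentially"
     "\<And>K. \<lbrakk>compact K; K \<subseteq> UNIV\<rbrakk> \<Longrightarrow> uniform_limit K (fs \<circ> r) f sequentially"
    by (rule Montel[OF open_UNIV Hh Hb rng]) auto
  have fsr: "fs (r n) \<in> FS p m" "fs_norm p m (fs (r n)) \<le> 1" for n using fs by auto
  have fFS: "f \<in> FS p m" "fs_integral p m f \<le> ennreal (1 powr p)"
    using FS_pointwise_limit[where f="\<lambda>n. fs (r n)", OF p fsr f(1) f(3)] by auto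
  define d where "d n = (\<lambda>z. fs (r n) z - f z)" for n
  have dFS: "d n \<in> FS p m" for n unfolding d_def by (rule FS_diff[OF fsr(1) fFS(1) p])
  have dn: "fs_norm p m (d n) \<le> (2 powr p * 2) powr (1 / p)" for n
  proof (rule fs_norm_leI)
    have "fs_integral p m (d n) \<le> ennreal (2 powr p) * (fs_integral p m (fs (r n)) + fs_integral p m f)"
      unfolding d_def using fsr fFS p by (intro fs_integral_diff_le) (auto simp: FS_iff)
    also have "\<dots> \<le> ennreal (2 powr p) * (ennreal (1 powr p) + ennreal (1 powr p))"
      by (intro mult_left_mono add_mono fFS fs_integral_le_norm[OF fsr(1) p fsr(2)]) auto
    also have "\<dots> = ennreal (((2 powr p * 2) powr (1 / p)) powr p)"
      using p by (simp add: powr_powr ennreal_mult)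
    finally show "fs_integral p m (d n) \<le> ennreal (((2 powr p * 2) powr (1 / p)) powr p)" .
  qed (use p in auto)
  have dlim: "uniform_limit (cball 0 R) d (\<lambda>_. 0) sequentially" for R
  proof -
    have "uniform_limit (cball 0 R) (fs \<circ> r) f sequentially" by (rule f(4)) auto
    then show ?thesis by (simp add: uniform_limit_iff d_def dist_norm)
  qed
  have "(\<lambda>n. fs_norm q m (Volterra g (d n))) \<longlonglongrightarrow> 0"
    by (rule Volterra_linear_null[OF g lin ut q dFS dn dlim])
  moreover have "Volterra g (d n) = (\<lambda>z. Volterra g (fs (r n)) z - Volterra g f z)" for n
    unfolding d_def using Volterra_diff[OF _ f(1) g] fsr(1)[of n] by (auto simp: FS_iff)
  ultimately show "\<exists>r h. strict_mono r \<and> h \<in> FS q m \<and>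
     (\<lambda>n. fs_norm q m (\<lambda>z. Volterra g (fs (r n)) z - h z)) \<longlonglongrightarrow> 0"
    using f(2) VFS[OF fFS(1)] by (intro exI[of _ r] exI[of _ "Volterra g f"]) auto
qed

section \<open>Test functions concentrated on annuli\<close>

text \<open>With \<open>t = r / \<rho>\<close> the inequality \<open>t \<le> exp (t - 1)\<close>
  turns the exponent into exactly \<open>- (r - \<rho>)^2 / 2\<close>.\<close>

lemma annular_profile_upper:
  fixes r \<rho> :: real
  assumes "r \<ge> 0" "\<rho> > 0" "real n = \<rho>\<^sup>2"
  shows "(r / \<rho>) ^ n * exp ((\<rho>\<^sup>2 - r\<^sup>2) / 2) \<le> exp (- (r - \<rho>)\<^sup>2 / 2)"
proof -
  have "r / \<rho> \<le> exp (r / \<rho> - 1)" using exp_ge_add_one_self[of "r / \<rho> - 1"] by simp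
  then have "(r / \<rho>) ^ n \<le> exp (r / \<rho> - 1) ^ n" using assms by (intro power_mono) auto
  also have "\<dots> = exp (real n * (r / \<rho> - 1))" by (simp only: exp_of_nat_mult)
  finally have "(r / \<rho>) ^ n * exp ((\<rho>\<^sup>2 - r\<^sup>2) / 2) \<le> exp (real n * (r / \<rho> - 1)) * exp ((\<rho>\<^sup>2 - r\<^sup>2) / 2)"
    by (intro mult_right_mono) auto
  also have "\<dots> = exp (real n * (r / \<rho> - 1) + (\<rho>\<^sup>2 - r\<^sup>2) / 2)" by (simp only: exp_add)
  also have "real n * (r / \<rho> - 1) + (\<rho>\<^sup>2 - r\<^sup>2) / 2 = - (r - \<rho>)\<^sup>2 / 2"
    unfolding assms(3) using assms(2) by (simp add: field_simps power2_eq_square)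
  finally show ?thesis .
qed

text \<open>The reversed inequality \<open>exp (1 - 1 / t) \<le> t\<close> gives the exponent
  \<open>- (r - \<rho>)^2 (r + 2 \<rho>) / (2 r)\<close>, and \<open>\<rho> \<le> 2 r\<close> bounds
  the last quotient by \<open>5 / 2\<close>.\<close>

lemma annular_profile_lower:
  fixes r \<rho> :: real
  assumes r: "\<bar>r - \<rho>\<bar> \<le> 1" and \<rho>: "\<rho> \<ge> 2" and n: "real n = \<rho>\<^sup>2"
  shows "exp (- 5 / 2) \<le> (r / \<rho>) ^ n * exp ((\<rho>\<^sup>2 - r\<^sup>2) / 2)"
proof -
  have r0: "r > 0" "\<rho> \<le> 2 * r" using r \<rho> by linarith+
  have "\<rho> / r \<le> exp (\<rho> / r - 1)" using exp_ge_add_one_self[of "\<rho> / r - 1"] by simp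
  then have "inverse (exp (\<rho> / r - 1)) \<le> inverse (\<rho> / r)"
    using r0 \<rho> by (intro le_imp_inverse_le) auto
  then have "exp (1 - \<rho> / r) \<le> r / \<rho>" by (simp add: exp_minus[symmetric])
  then have "exp (1 - \<rho> / r) ^ n \<le> (r / \<rho>) ^ n" by (intro power_mono) auto
  then have 1: "exp (real n * (1 - \<rho> / r)) \<le> (r / \<rho>) ^ n" by (simp only: exp_of_nat_mult)
  have eq: "real n * (1 - \<rho> / r) + (\<rho>\<^sup>2 - r\<^sup>2) / 2 = - ((r - \<rho>)\<^sup>2 * ((r + 2 * \<rho>) / (2 * r)))"
    unfolding n using r0 by (simp add: field_simps power2_eq_square)
  have "(r - \<rho>)\<^sup>2 * ((r + 2 * \<rho>) / (2 * r)) \<le> 1 * (5 / 2)"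
  proof (intro mult_mono)
    show "(r - \<rho>)\<^sup>2 \<le> 1" using r by (metis abs_square_le_1)
    show "(r + 2 * \<rho>) / (2 * r) \<le> 5 / 2" using r0 by (simp add: field_simps)
  qed (use r0 \<rho> in auto)
  then have "exp (- 5 / 2) \<le> exp (real n * (1 - \<rho> / r) + (\<rho>\<^sup>2 - r\<^sup>2) / 2)"
    unfolding eq by simp
  also have "\<dots> = exp (real n * (1 - \<rho> / r)) * exp ((\<rho>\<^sup>2 - r\<^sup>2) / 2)" by (simp only: exp_add)
  also have "\<dots> \<le> (r / \<rho>) ^ n * exp ((\<rho>\<^sup>2 - r\<^sup>2) / 2)" using 1 by (intro mult_right_mono) auto
  finally show ?thesis .
qed

text \<open>
  Normalised so that the weighted modulus is about 1 where \<open>|z| = \<rho>\<close>.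
\<close>

definition annular :: "nat \<Rightarrow> nat \<Rightarrow> complex \<Rightarrow> complex" where
  "annular m \<rho> z = of_real (exp ((real \<rho>)\<^sup>2 / 2) / (real \<rho> ^ (\<rho>\<^sup>2) * (1 + real \<rho>) ^ m)) * z ^ (\<rho>\<^sup>2)"

lemma norm_annular_wt:
  assumes "\<rho> > 0"
  shows "cmod (annular m \<rho> z) * wt m z =
    ((cmod z / real \<rho>) ^ (\<rho>\<^sup>2) * exp (((real \<rho>)\<^sup>2 - (cmod z)\<^sup>2) / 2)) * ((1 + cmod z) / (1 + real \<rho>)) ^ m"
proof -
  have e: "exp (((real \<rho>)\<^sup>2 - (cmod z)\<^sup>2) / 2) = exp ((real \<rho>)\<^sup>2 / 2) * exp (- (cmod z)\<^sup>2 / 2)"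
    by (simp add: exp_add[symmetric] diff_divide_distrib)
  have "cmod (annular m \<rho> z) = exp ((real \<rho>)\<^sup>2 / 2) / (real \<rho> ^ (\<rho>\<^sup>2) * (1 + real \<rho>) ^ m) * cmod z ^ (\<rho>\<^sup>2)"
    unfolding annular_def norm_mult norm_of_real norm_power by simp
  then show ?thesis
    unfolding e wt_def power_divide by (simp add: field_simps)
qed

text \<open>The polynomial factor costs at most \<open>exp (m x)\<close> at distance
  \<open>x\<close> from the circle. The Gaussian profile pays for it by completing the square, with
  one factor \<open>exp (- x)\<close> to spare; exponential decay is enough for the sums
  below.\<close>

lemma norm_annular_upper:
  assumes "\<rho> > 0"
  shows "cmod (annular m \<rho> z) * wt m z \<le> exp ((real (m + 1))\<^sup>2 / 2) * exp (- \<bar>cmod z - real \<rho>\<bar>)"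
proof -
  define x where "x = \<bar>cmod z - real \<rho>\<bar>"
  have x0: "x \<ge> 0" by (simp add: x_def)
  have "1 + cmod z \<le> (1 + x) * (1 + real \<rho>)"
  proof -
    have "0 \<le> x * real \<rho>" using x0 by simp
    moreover have "cmod z \<le> x + real \<rho>" by (simp add: x_def)
    ultimately show ?thesis unfolding distrib_left distrib_right mult_1 mult_1_right by linarith
  qed
  then have "(1 + cmod z) / (1 + real \<rho>) \<le> 1 + x" by (simp add: pos_divide_le_eq add_pos_nonneg)
  also have "\<dots> \<le> exp x" by (rule exp_ge_add_one_self)
  finally have "((1 + cmod z) / (1 + real \<rho>)) ^ m \<le> exp x ^ m" by (intro power_mono) auto
  also have "\<dots> = exp (real m * x)" by (simp only: exp_of_nat_mult)
  finally have 2: "((1 + cmod z) / (1 + real \<rho>)) ^ m \<le> exp (real m * x)" .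
  have 1: "(cmod z / real \<rho>) ^ (\<rho>\<^sup>2) * exp (((real \<rho>)\<^sup>2 - (cmod z)\<^sup>2) / 2) \<le> exp (- x\<^sup>2 / 2)"
    using annular_profile_upper[of "cmod z" "real \<rho>" "\<rho>\<^sup>2"] assms by (simp add: x_def)
  have "cmod (annular m \<rho> z) * wt m z \<le> exp (- x\<^sup>2 / 2) * exp (real m * x)"
    unfolding norm_annular_wt[OF assms] using 1 2 by (intro mult_mono) auto
  also have "\<dots> = exp (- x\<^sup>2 / 2 + real m * x)" by (simp only: exp_add)
  also have "\<dots> \<le> exp ((real (m + 1))\<^sup>2 / 2 + - x)"
  proof -
    have "0 \<le> (x - real (m + 1))\<^sup>2" by simp
    also have "\<dots> = x\<^sup>2 - 2 * (real m * x + x) + (real (m + 1))\<^sup>2"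
      by (simp add: power2_eq_square algebra_simps)
    finally show ?thesis by (subst exp_le_cancel_iff) simp
  qed
  also have "\<dots> = exp ((real (m + 1))\<^sup>2 / 2) * exp (- x)" by (simp only: exp_add)
  finally show ?thesis by (simp add: x_def)
qed

lemma norm_annular_lower:
  assumes "\<rho> \<ge> 2" and x: "\<bar>cmod z - real \<rho>\<bar> \<le> 1"
  shows "exp (- 5 / 2) / 2 ^ m \<le> cmod (annular m \<rho> z) * wt m z"
proof -
  have 1: "exp (- 5 / 2) \<le> (cmod z / real \<rho>) ^ (\<rho>\<^sup>2) * exp (((real \<rho>)\<^sup>2 - (cmod z)\<^sup>2) / 2)"
    using annular_profile_lower[of "cmod z" "real \<rho>" "\<rho>\<^sup>2"] assms by simp
  have "1 + real \<rho> \<le> 2 * (1 + cmod z)"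
  proof -
    have "real \<rho> \<le> 1 + cmod z" using abs_le_D2[OF x] by simp
    then show ?thesis using norm_ge_zero[of z] unfolding distrib_left by linarith
  qed
  then have "1 / 2 \<le> (1 + cmod z) / (1 + real \<rho>)" by (simp add: field_simps)
  then have "(1 / 2) ^ m \<le> ((1 + cmod z) / (1 + real \<rho>)) ^ m" by (intro power_mono) auto
  then have "exp (- 5 / 2) * (1 / 2) ^ m \<le> cmod (annular m \<rho> z) * wt m z"
    using 1 assms(1) by (subst norm_annular_wt) (auto intro!: mult_mono)
  then show ?thesis by (simp add: power_divide)
qed

section \<open>Sums and integrals of exponentials of distances\<close>

lemma sum_exp_geometric_le:
  fixes F :: "nat set"
  assumes "finite F" "a > 0"
  shows "(\<Sum>i\<in>F. exp (- a * real i)) \<le> 1 / (1 - exp (- a))"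
proof -
  have e: "exp (- a * real i) = exp (- a) ^ i" for i
    by (simp add: exp_of_nat_mult[symmetric] mult.commute)
  have lt: "exp (- a) < 1" using assms by simp
  have "(\<Sum>i\<in>F. exp (- a * real i)) \<le> (\<Sum>i. exp (- a) ^ i)"
    unfolding e using assms lt by (intro sum_le_suminf summable_geometric) auto
  also have "\<dots> = 1 / (1 - exp (- a))" using lt by (intro suminf_geometric) auto
  finally show ?thesis .
qed

lemma sum_exp_two_sided_le:
  fixes K :: "nat set"
  assumes K: "finite K" and a: "a > 0"
  shows "(\<Sum>k\<in>K. exp (- a * \<bar>real k - real j\<bar>)) \<le> 2 / (1 - exp (- a))"
proof -
  have "(\<Sum>k\<in>K. exp (- a * \<bar>real k - real j\<bar>)) = (\<Sum>k\<in>K \<inter> {..j}. exp (- a * \<bar>real k - real j\<bar>)) + (\<Sum>k\<in>K \<inter> {j<..}. exp (- a * \<bar>real k - real j\<bar>))"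
  proof -
    have "K = (K \<inter> {..j}) \<union> (K \<inter> {j<..})" by auto
    then show ?thesis using K by (subst \<open>K = _\<close>, subst sum.union_disjoint) auto
  qed
  also have "(\<Sum>k\<in>K \<inter> {..j}. exp (- a * \<bar>real k - real j\<bar>)) = (\<Sum>i\<in>(\<lambda>k. j - k) ` (K \<inter> {..j}). exp (- a * real i))"
    by (subst sum.reindex) (auto simp: inj_on_def of_nat_diff intro!: sum.cong)
  also have "\<dots> \<le> 1 / (1 - exp (- a))" using K a by (intro sum_exp_geometric_le) auto
  also have "(\<Sum>k\<in>K \<inter> {j<..}. exp (- a * \<bar>real k - real j\<bar>)) = (\<Sum>i\<in>(\<lambda>k. k - j) ` (K \<inter> {j<..}). exp (- a * real i))"
    by (subst sum.reindex) (auto simp: inj_on_def of_nat_diff intro!: sum.cong)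
  also have "\<dots> \<le> 1 / (1 - exp (- a))" using K a by (intro sum_exp_geometric_le) auto
  finally show ?thesis by simp
qed

lemma nn_integral_exp_abs:
  assumes b: "b > 0"
  shows "(\<integral>\<^sup>+t. ennreal (exp (- b * \<bar>t - s\<bar>)) \<partial>lborel) = ennreal (2 / b)"
proof -
  have half: "(\<integral>\<^sup>+t. ennreal (exp (- b * t)) * indicator {0..} t \<partial>lborel) = ennreal (1 / b)"
  proof -
    have "(\<integral>\<^sup>+t. ennreal (exp (- b * t)) * indicator {0..} t \<partial>lborel) = ennreal (0 - (- exp (- b * 0) / b))"
    proof (rule nn_integral_FTC_atLeast)
      show "((\<lambda>t. - exp (- b * t) / b) has_real_derivative exp (- b * t)) (at t)" for t
        using b by (auto intro!: derivative_eq_intros)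
      have "filterlim (\<lambda>t. b * t) at_top at_top"
        using b by (intro filterlim_tendsto_pos_mult_at_top[OF tendsto_const]) (auto intro: filterlim_ident)
      then have "filterlim (\<lambda>t. - (b * t)) at_bot at_top"
        by (simp add: filterlim_uminus_at_bot)
      then have "((\<lambda>t. exp (- (b * t))) \<longlongrightarrow> 0) at_top"
        by (rule filterlim_compose[OF exp_at_bot])
      then have "((\<lambda>t. - exp (- (b * t)) / b) \<longlongrightarrow> - 0 / b) at_top"
        using b by (intro tendsto_divide tendsto_minus tendsto_const) auto
      then show "((\<lambda>t. - exp (- b * t) / b) \<longlongrightarrow> 0) at_top" by simp
    qed auto
    then show ?thesis by simp
  qed
  have "(\<integral>\<^sup>+t. ennreal (exp (- b * \<bar>t - s\<bar>)) \<partial>lborel) = (\<integral>\<^sup>+t. ennreal (exp (- b * \<bar>t\<bar>)) \<partial>lborel)"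
    using nn_integral_lborel_translate[of "\<lambda>t. ennreal (exp (- b * \<bar>t\<bar>))" "- s"] by simp
  also have "\<dots> = (\<integral>\<^sup>+t. ennreal (exp (- b * t)) * indicator {0..} t + ennreal (exp (b * t)) * indicator {..<0} t \<partial>lborel)"
    by (intro nn_integral_cong) (auto simp: indicator_def)
  also have "\<dots> = ennreal (1 / b) + (\<integral>\<^sup>+t. ennreal (exp (b * t)) * indicator {..<0} t \<partial>lborel)"
    by (subst nn_integral_add) (auto simp: half[simplified])
  also have "(\<integral>\<^sup>+t. ennreal (exp (b * t)) * indicator {..<0} t \<partial>lborel)
      = ennreal \<bar>-1\<bar> * (\<integral>\<^sup>+t. ennreal (exp (b * (0 + -1 * t))) * indicator {..<0} (0 + -1 * t) \<partial>lborel)"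
    by (rule nn_integral_real_affine) auto
  also have "(\<integral>\<^sup>+t. ennreal (exp (b * (0 + -1 * t))) * indicator {..<0} (0 + -1 * t) \<partial>lborel)
      = (\<integral>\<^sup>+t. ennreal (exp (- b * t)) * indicator {0..} t \<partial>lborel)"
    by (rule nn_integral_cong_AE, rule AE_mp[OF AE_lborel_singleton[of 0]], rule AE_I2)
      (auto simp: indicator_def)
  finally show ?thesis using b unfolding half by (simp add: ennreal_plus[symmetric] del: ennreal_plus)
qed

text \<open>The linear growth is that of the circumference. For \<open>r \<le> 2 \<rho>\<close> one
  has \<open>|r^2 - \<rho>^2| \<le> 4 \<rho> |r - \<rho>|\<close>, so in the variable
  \<open>r^2\<close> the decay rate is \<open>a / (4 \<rho>)\<close> and the integral is of order
  \<rho>. For larger \<open>r\<close> one has \<open>|r - \<rho>| \<ge> r / 2\<close>, which leaves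
  an integral \<open>J\<close> independent of \<rho>.\<close>

lemma nn_integral_annular_decay:
  assumes a: "a > 0"
  obtains C where "C > 0" "\<And>\<rho>. \<rho> \<ge> 1 \<Longrightarrow> (\<integral>\<^sup>+z. ennreal (exp (- a * \<bar>cmod z - \<rho>\<bar>)) \<partial>lborel) \<le> ennreal (C * \<rho>)"
proof -
  define J where "J = (\<integral>\<^sup>+z. ennreal (exp (- (a / 2) * cmod z)) \<partial>lborel)"
  have J: "J < \<infinity>"
  proof -
    \<comment> \<open>The cube of \<open>exp (- x) \<le> 1 / x\<close> at
      \<open>x = a / 6 * (1 + |z|)\<close> yields the integrable power -3.\<close>
    define B where "B = exp (a / 2) * (1 / (a / 6) ^ 3)"
    have "J \<le> (\<integral>\<^sup>+z. ennreal B * ennreal ((1 + cmod z) powr (- 3)) \<partial>lborel)"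
      unfolding J_def
    proof (intro nn_integral_mono)
      fix z
      define y where "y = 1 + cmod z"
      have y: "y > 0" by (simp add: y_def add_pos_nonneg)
      have ay: "a / 6 * y > 0" using a y by simp
      have "a / 6 * y \<le> exp (a / 6 * y)" using exp_ge_add_one_self[of "a / 6 * y"] by linarith
      then have "exp (- (a / 6 * y)) \<le> 1 / (a / 6 * y)"
        using ay by (simp add: exp_minus field_simps)
      then have "exp (- (a / 6 * y)) ^ 3 \<le> (1 / (a / 6 * y)) ^ 3" by (intro power_mono) auto
      also have "exp (- (a / 6 * y)) ^ 3 = exp (- (a / 2 * y))" by (simp add: exp_of_nat_mult[symmetric])
      also have "(1 / (a / 6 * y)) ^ 3 = 1 / (a / 6) ^ 3 * y powr (- 3)"
        using y by (simp add: power_divide power_mult_distrib powr_minus_divide powr_numeral)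
      finally have "exp (- (a / 2 * y)) \<le> 1 / (a / 6) ^ 3 * y powr (- 3)" .
      from mult_left_mono[OF this, of "exp (a / 2)"]
      have "exp (a / 2) * exp (- (a / 2 * y)) \<le> B * y powr (- 3)" by (simp add: B_def)
      moreover have "exp (a / 2) * exp (- (a / 2 * y)) = exp (- (a / 2) * cmod z)"
        by (simp add: exp_add[symmetric] y_def algebra_simps)
      ultimately show "ennreal (exp (- (a / 2) * cmod z)) \<le> ennreal B * ennreal ((1 + cmod z) powr (- 3))"
        using a by (simp add: y_def ennreal_mult[symmetric] B_def)
    qed
    also have "\<dots> = ennreal B * (\<integral>\<^sup>+z. ennreal ((1 + cmod z) powr (- 3)) \<partial>lborel)"
      by (rule nn_integral_cmult) measurable
    also have "\<dots> < \<infinity>" using nn_integral_power_decay[of 3] by (simp add: ennreal_mult_less_top)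
    finally show ?thesis .
  qed
  then obtain j where j: "J = ennreal j" "j \<ge> 0" by (cases J) auto
  show thesis
  proof (rule that[of "pi * (8 / a) + j"])
    show "pi * (8 / a) + j > 0" using a j by (simp add: add_pos_nonneg)
    fix \<rho> :: real assume \<rho>: "\<rho> \<ge> 1"
    define b where "b = a / (4 * \<rho>)"
    have b: "b > 0" using a \<rho> by (simp add: b_def)
    have key: "exp (- a * \<bar>r - \<rho>\<bar>) \<le> exp (- b * \<bar>r\<^sup>2 - \<rho>\<^sup>2\<bar>) + exp (- (a / 2) * r)" if r: "r \<ge> 0" for r
    proof (cases "r \<le> 2 * \<rho>")
      case True
      have "\<bar>r\<^sup>2 - \<rho>\<^sup>2\<bar> = \<bar>r - \<rho>\<bar> * (r + \<rho>)"
        using r \<rho> by (simp add: power2_eq_square square_diff_square_factored abs_mult mult.commute)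
      also have "\<dots> \<le> \<bar>r - \<rho>\<bar> * (4 * \<rho>)" using True r \<rho> by (intro mult_left_mono) auto
      finally have "b * \<bar>r\<^sup>2 - \<rho>\<^sup>2\<bar> \<le> b * (\<bar>r - \<rho>\<bar> * (4 * \<rho>))" using b by (intro mult_left_mono) auto
      also have "\<dots> = a * \<bar>r - \<rho>\<bar>" using \<rho> by (simp add: b_def)
      finally show ?thesis by (simp add: add_increasing2)
    next
      case False
      then have "r / 2 \<le> \<bar>r - \<rho>\<bar>" by linarith
      from mult_left_mono[OF this, of a] have "a / 2 * r \<le> a * \<bar>r - \<rho>\<bar>" using a by simp
      then show ?thesis by (simp add: add_increasing)
    qed
    have "(\<integral>\<^sup>+z. ennreal (exp (- a * \<bar>cmod z - \<rho>\<bar>)) \<partial>lborel) \<le>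
       (\<integral>\<^sup>+z. ennreal (exp (- b * \<bar>(cmod z)\<^sup>2 - \<rho>\<^sup>2\<bar>)) + ennreal (exp (- (a / 2) * cmod z)) \<partial>lborel)"
      using key by (intro nn_integral_mono) (auto simp: ennreal_plus[symmetric] simp del: ennreal_plus intro!: ennreal_leI)
    also have "\<dots> = (\<integral>\<^sup>+z. ennreal (exp (- b * \<bar>(cmod z)\<^sup>2 - \<rho>\<^sup>2\<bar>)) \<partial>lborel) + J"
      unfolding J_def by (rule nn_integral_add) auto
    also have "(\<integral>\<^sup>+z. ennreal (exp (- b * \<bar>(cmod z)\<^sup>2 - \<rho>\<^sup>2\<bar>)) \<partial>lborel)
        = ennreal pi * (\<integral>\<^sup>+t. ennreal (exp (- b * \<bar>t - \<rho>\<^sup>2\<bar>)) * indicator {0..} t \<partial>lborel)"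
      by (rule nn_integral_lborel_radial) measurable
    also have "\<dots> \<le> ennreal pi * (\<integral>\<^sup>+t. ennreal (exp (- b * \<bar>t - \<rho>\<^sup>2\<bar>)) \<partial>lborel)"
      by (intro mult_left_mono nn_integral_mono) (auto simp: indicator_def)
    also have "\<dots> = ennreal (pi * (8 / a) * \<rho>)"
      unfolding nn_integral_exp_abs[OF b] using a \<rho> by (simp add: b_def ennreal_mult[symmetric])
    finally have "(\<integral>\<^sup>+z. ennreal (exp (- a * \<bar>cmod z - \<rho>\<bar>)) \<partial>lborel) \<le> ennreal (pi * (8 / a) * \<rho>) + J"
      by (auto simp: add_right_mono)
    also have "\<dots> = ennreal (pi * (8 / a) * \<rho> + j)" using a \<rho> j by (simp add: ennreal_plus[symmetric] del: ennreal_plus)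
    also have "\<dots> \<le> ennreal ((pi * (8 / a) + j) * \<rho>)"
      using \<rho> j mult_left_mono[of 1 \<rho> j] by (intro ennreal_leI) (simp add: distrib_right)
    finally show "(\<integral>\<^sup>+z. ennreal (exp (- a * \<bar>cmod z - \<rho>\<bar>)) \<partial>lborel) \<le> ennreal ((pi * (8 / a) + j) * \<rho>)" .
  qed
qed

text \<open>Takes the place of Hoelder's inequality for every \<open>p > 0\<close>: the factors
  \<open>u\<close> are replaced by their maximum, whose \<open>p\<close>-th power is one term of the
  sum on the right.\<close>

lemma sum_mult_powr_le:
  fixes u v :: "'a \<Rightarrow> real"
  assumes K: "finite K" and u: "\<And>k. k \<in> K \<Longrightarrow> u k \<ge> 0" and v: "\<And>k. k \<in> K \<Longrightarrow> v k \<ge> 0"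
    and S: "(\<Sum>k\<in>K. v k) \<le> S" and p: "p > 0"
  shows "(\<Sum>k\<in>K. u k * v k) powr p \<le> S powr p * (\<Sum>k\<in>K. u k powr p)"
proof (cases "K = {}")
  case False
  define U where "U = Max (u ` K)"
  have "U \<in> u ` K" unfolding U_def using K False by (intro Max_in) auto
  then obtain k0 where k0: "k0 \<in> K" "U = u k0" by auto
  have le: "u k \<le> U" if "k \<in> K" for k unfolding U_def using K that by (intro Max_ge) auto
  have U0: "U \<ge> 0" using k0 u by auto
  have "(\<Sum>k\<in>K. u k * v k) \<le> (\<Sum>k\<in>K. U * v k)"
    using le v by (intro sum_mono mult_right_mono) auto
  also have "\<dots> = U * (\<Sum>k\<in>K. v k)" by (simp add: sum_distrib_left)
  also have "\<dots> \<le> U * S" using S U0 by (intro mult_left_mono)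
  finally have "(\<Sum>k\<in>K. u k * v k) powr p \<le> (S * U) powr p"
    using p u v by (intro powr_mono2 sum_nonneg) (auto simp: mult.commute)
  also have "\<dots> = S powr p * u k0 powr p"
    by (simp only: powr_mult k0)
  also have "\<dots> \<le> S powr p * (\<Sum>k\<in>K. u k powr p)"
    using k0 K by (intro mult_left_mono member_le_sum) auto
  finally show ?thesis .
qed simp

text \<open>
  For \<open>\<beta> = 2 / p\<close> the \<open>p\<close>-th power of the norm is at most of the order of the harmonic sum, and in the
  cases to be excluded the \<open>q\<close>-th power of the norm of the image is at least of that order, which
  is impossible for \<open>q < p\<close> as \<open>N\<close> grows.
\<close>

definition test_fun :: "nat \<Rightarrow> real \<Rightarrow> nat \<Rightarrow> nat \<Rightarrow> complex \<Rightarrow> complex" where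
  "test_fun m \<beta> R N z = (\<Sum>k\<in>{1..N}. of_real (real k powr (- \<beta>)) * annular m (R * k) z)"

lemma test_fun_entire: "test_fun m \<beta> R N holomorphic_on UNIV"
proof -
  have "(\<lambda>z. \<Sum>k\<in>{1..N}. of_real (real k powr (- \<beta>)) * annular m (R * k) z) holomorphic_on UNIV"
    unfolding annular_def by (intro holomorphic_intros)
  then show ?thesis unfolding test_fun_def[abs_def] .
qed

text \<open>Each exponential is split into two halves: one has a sum over \<open>k\<close> that is
  bounded uniformly in \<open>z\<close>, the other stays with its coefficient and is integrated. The
  \<open>k\<close>-th term then contributes \<open>k^(-2)\<close> times the size \<open>R k\<close>
  of its annulus, hence \<open>1 / k\<close>.\<close>

lemma test_fun_upper:
  assumes p: "p > 0" and R: "R \<ge> (1::nat)"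
  obtains C where "C > 0" "\<And>N. fs_integral p m (test_fun m (2 / p) R N) \<le> ennreal (C * harm N)"
proof -
  define A where "A = exp ((real (m + 1))\<^sup>2 / 2)"
  define S where "S = A * (exp (1 / 2) * (2 / (1 - exp (- (1 / 2)))))"
  have A: "A > 0" by (simp add: A_def)
  have e1: "exp (- (1 / 2)) < (1::real)" by simp
  have S: "S > 0" unfolding S_def using A e1 by (intro mult_pos_pos divide_pos_pos) auto
  obtain D where D: "D > 0" "\<And>\<rho>. \<rho> \<ge> 1 \<Longrightarrow> (\<integral>\<^sup>+z. ennreal (exp (- (p / 2) * \<bar>cmod z - \<rho>\<bar>)) \<partial>lborel) \<le> ennreal (D * \<rho>)"
    using nn_integral_annular_decay[of "p / 2"] p by auto
  show thesis
  proof (rule that[of "S powr p * (D * real R)"])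
    show "S powr p * (D * real R) > 0" using S D R by simp
    fix N :: nat
    let ?K = "{1..N}"
    let ?c = "\<lambda>k. real k powr (- (2 / p))"
    have pt: "(cmod (test_fun m (2 / p) R N z) * wt m z) powr p
        \<le> S powr p * (\<Sum>k\<in>?K. (?c k) powr p * exp (- (p / 2) * \<bar>cmod z - real (R * k)\<bar>))" for z
    proof -
      let ?x = "\<lambda>k. \<bar>cmod z - real (R * k)\<bar>"
      have "cmod (test_fun m (2 / p) R N z) \<le> (\<Sum>k\<in>?K. cmod (of_real (?c k) * annular m (R * k) z))"
        unfolding test_fun_def by (rule norm_sum)
      then have "cmod (test_fun m (2 / p) R N z) * wt m z \<le> (\<Sum>k\<in>?K. cmod (of_real (?c k) * annular m (R * k) z)) * wt m z"
        by (intro mult_right_mono) auto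
      also have "\<dots> = (\<Sum>k\<in>?K. ?c k * (cmod (annular m (R * k) z) * wt m z))"
        by (simp add: sum_distrib_right norm_mult mult.assoc)
      also have "\<dots> \<le> (\<Sum>k\<in>?K. ?c k * (A * exp (- ?x k)))"
      proof (rule sum_mono, rule mult_left_mono)
        fix k assume "k \<in> ?K"
        then have "R * k > 0" using R by simp
        then show "cmod (annular m (R * k) z) * wt m z \<le> A * exp (- ?x k)"
          unfolding A_def by (rule norm_annular_upper)
      qed simp
      also have "\<dots> = (\<Sum>k\<in>?K. (?c k * exp (- ?x k / 2)) * (A * exp (- ?x k / 2)))"
      proof (intro sum.cong refl)
        fix k
        have "exp (- ?x k) = exp (- ?x k / 2) * exp (- ?x k / 2)" by (simp add: exp_add[symmetric])
        then show "?c k * (A * exp (- ?x k)) = (?c k * exp (- ?x k / 2)) * (A * exp (- ?x k / 2))" by simp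
      qed
      finally have le: "cmod (test_fun m (2 / p) R N z) * wt m z \<le> (\<Sum>k\<in>?K. (?c k * exp (- ?x k / 2)) * (A * exp (- ?x k / 2)))" .
      have sumS: "(\<Sum>k\<in>?K. A * exp (- ?x k / 2)) \<le> S"
      proof -
        \<comment> \<open>\<open>|z|\<close> lies between \<open>R * j\<close> and
          \<open>R * (j + 1)\<close>, so the distance from \<open>|z|\<close> to
          \<open>R * k\<close> is at least \<open>|k - j| - 1\<close>.\<close>
        define j where "j = nat \<lfloor>cmod z / real R\<rfloor>"
        have R0: "real R \<ge> 1" using R by simp
        have "0 \<le> cmod z / real R" by simp
        then have j: "real j \<le> cmod z / real R" "cmod z / real R < real j + 1"
          unfolding j_def by linarith+
        have "exp (- ?x k / 2) \<le> exp (1 / 2) * exp (- (1 / 2) * \<bar>real k - real j\<bar>)" for k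
        proof -
          have "\<bar>real k - real j\<bar> - 1 \<le> \<bar>cmod z / real R - real k\<bar>" using j by linarith
          also have "\<dots> \<le> real R * \<bar>cmod z / real R - real k\<bar>" using R0 mult_right_mono[OF R0, of "\<bar>cmod z / real R - real k\<bar>"] by simp
          also have "\<dots> = \<bar>real R * (cmod z / real R - real k)\<bar>" using R0 by (simp add: abs_mult)
          also have "real R * (cmod z / real R - real k) = cmod z - real (R * k)" using R0 by (simp add: right_diff_distrib)
          finally have "\<bar>real k - real j\<bar> - 1 \<le> ?x k" .
          then have "exp (- ?x k / 2) \<le> exp (1 / 2 + - (1 / 2) * \<bar>real k - real j\<bar>)" by (subst exp_le_cancel_iff) simp
          then show ?thesis by (simp only: exp_add)
        qed
        then have "(\<Sum>k\<in>?K. exp (- ?x k / 2)) \<le> (\<Sum>k\<in>?K. exp (1 / 2) * exp (- (1 / 2) * \<bar>real k - real j\<bar>))"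
          by (intro sum_mono)
        also have "\<dots> = exp (1 / 2) * (\<Sum>k\<in>?K. exp (- (1 / 2) * \<bar>real k - real j\<bar>))"
          by (rule sum_distrib_left[symmetric])
        also have "\<dots> \<le> exp (1 / 2) * (2 / (1 - exp (- (1 / 2))))"
          by (intro mult_left_mono sum_exp_two_sided_le) auto
        finally have "A * (\<Sum>k\<in>?K. exp (- ?x k / 2)) \<le> S"
          unfolding S_def using A by (intro mult_left_mono) auto
        then show ?thesis by (simp only: sum_distrib_left)
      qed
      have "(cmod (test_fun m (2 / p) R N z) * wt m z) powr p \<le> (\<Sum>k\<in>?K. (?c k * exp (- ?x k / 2)) * (A * exp (- ?x k / 2))) powr p"
        using le p by (intro powr_mono2) auto
      also have "\<dots> \<le> S powr p * (\<Sum>k\<in>?K. (?c k * exp (- ?x k / 2)) powr p)"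
        using A by (intro sum_mult_powr_le sumS p) auto
      also have "(\<Sum>k\<in>?K. (?c k * exp (- ?x k / 2)) powr p) = (\<Sum>k\<in>?K. (?c k) powr p * exp (- (p / 2) * ?x k))"
        by (intro sum.cong refl) (simp add: powr_mult exp_powr_real mult.commute)
      finally show ?thesis .
    qed
    have "fs_integral p m (test_fun m (2 / p) R N) \<le>
       (\<integral>\<^sup>+z. ennreal (S powr p) * (\<Sum>k\<in>?K. ennreal ((?c k) powr p) * ennreal (exp (- (p / 2) * \<bar>cmod z - real (R * k)\<bar>))) \<partial>lborel)"
      unfolding fs_integral_wt
    proof (intro nn_integral_mono)
      fix z
      have "ennreal ((cmod (test_fun m (2 / p) R N z) * wt m z) powr p)
        \<le> ennreal (S powr p * (\<Sum>k\<in>?K. (?c k) powr p * exp (- (p / 2) * \<bar>cmod z - real (R * k)\<bar>)))"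
        using pt by (intro ennreal_leI)
      also have "\<dots> = ennreal (S powr p) * (\<Sum>k\<in>?K. ennreal ((?c k) powr p) * ennreal (exp (- (p / 2) * \<bar>cmod z - real (R * k)\<bar>)))"
        by (simp add: ennreal_mult[symmetric] sum_nonneg)
      finally show "ennreal ((cmod (test_fun m (2 / p) R N z) * wt m z) powr p)
        \<le> ennreal (S powr p) * (\<Sum>k\<in>?K. ennreal ((?c k) powr p) * ennreal (exp (- (p / 2) * \<bar>cmod z - real (R * k)\<bar>)))" .
    qed
    also have "\<dots> = ennreal (S powr p) * (\<Sum>k\<in>?K. ennreal ((?c k) powr p) * (\<integral>\<^sup>+z. ennreal (exp (- (p / 2) * \<bar>cmod z - real (R * k)\<bar>)) \<partial>lborel))"
      by (simp add: nn_integral_cmult nn_integral_sum)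
    also have "\<dots> \<le> ennreal (S powr p) * (\<Sum>k\<in>?K. ennreal ((?c k) powr p) * ennreal (D * real (R * k)))"
    proof (intro mult_left_mono sum_mono D(2))
      fix k assume "k \<in> ?K"
      then have "R * k \<ge> 1" using R by (simp add: Suc_le_eq)
      from of_nat_mono[OF this, where ?'a=real] show "1 \<le> real (R * k)" by (simp only: of_nat_1)
    qed auto
    also have "\<dots> = ennreal (S powr p * (\<Sum>k\<in>?K. (?c k) powr p * (D * real (R * k))))"
      using D by (simp add: ennreal_mult[symmetric] sum_nonneg)
    also have "S powr p * (\<Sum>k\<in>?K. (?c k) powr p * (D * real (R * k))) = S powr p * (D * real R) * harm N"
    proof -
      have "(\<Sum>k\<in>?K. (?c k) powr p * (D * real (R * k))) = (\<Sum>k\<in>?K. D * real R * inverse (real k))"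
      proof (intro sum.cong refl)
        fix k assume "k \<in> ?K"
        then have k: "real k > 0" by simp
        have "(?c k) powr p * real k = real k powr (- 2) * real k powr 1"
          using p k by (simp add: powr_powr)
        also have "\<dots> = inverse (real k)" using k by (simp only: powr_add[symmetric]) (simp add: powr_minus)
        finally show "(?c k) powr p * (D * real (R * k)) = D * real R * inverse (real k)"
          by (simp add: mult_ac)
      qed
      then show ?thesis by (simp add: sum_distrib_left[symmetric] harm_def)
    qed
    finally show "fs_integral p m (test_fun m (2 / p) R N) \<le> ennreal (S powr p * (D * real R) * harm N)" .
  qed
qed

text \<open>If the radii are spaced widely enough, all other terms together amount to at most half
  of the one whose annulus contains \<open>z\<close>. The spacing \<open>R\<close> depends on
  \<beta> and \<open>m\<close> but not on \<open>N\<close>.\<close>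

lemma test_fun_lower:
  assumes \<beta>: "\<beta> > 0"
  obtains R :: nat and c :: real where "R \<ge> 3" "c > 0"
    "\<And>N k z. k \<in> {1..N} \<Longrightarrow> \<bar>cmod z - real (R * k)\<bar> \<le> 1 \<Longrightarrow>
       c * real k powr (- \<beta>) \<le> cmod (test_fun m \<beta> R N z) * wt m z"
proof -
  define A where "A = exp ((real (m + 1))\<^sup>2 / 2)"
  define c1 :: real where "c1 = exp (- 5 / 2) / 2 ^ m"
  define K where "K = A * exp 1 * (2 / (1 - exp (- 1)))"
  have A: "A > 0" by (simp add: A_def)
  have c1: "c1 > 0" by (simp add: c1_def)
  have e1: "exp (- 1) < (1::real)" by simp
  have K: "K > 0" unfolding K_def using A e1 by (intro mult_pos_pos divide_pos_pos) auto
  define L where "L = ln (2 * K / c1)"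
  have KL: "K * exp (- L) \<le> c1 / 2"
    using K c1 by (simp add: L_def exp_minus)
  \<comment> \<open>At index distance \<open>d\<close> a term has decayed by about
    \<open>exp (- R d)\<close>, while the coefficients may differ by \<open>exp (\<beta> d)\<close>.
    One further \<open>exp (- d)\<close> is reserved for summing over the indices, so
    \<open>R - \<beta> - 1\<close> has to exceed \<open>L\<close>, which solves
    \<open>K exp (- L) = c1 / 2\<close>.\<close>
  obtain R :: nat where R: "max 3 (\<beta> + 1 + \<bar>L\<bar>) \<le> real R" using real_arch_simple by blast
  have R3: "R \<ge> 3" using R by simp
  have RL: "real R - \<beta> - 1 \<ge> L" "real R - \<beta> - 1 \<ge> 0" using R by linarith+
  have KR: "K * exp (- (real R - \<beta> - 1)) \<le> c1 / 2"
  proof -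
    have "K * exp (- (real R - \<beta> - 1)) \<le> K * exp (- L)" using K RL by (intro mult_left_mono) auto
    then show ?thesis using KL by simp
  qed
  show thesis
  proof (rule that[of R "c1 / 2"])
    show "R \<ge> 3" by (rule R3)
    show "c1 / 2 > 0" using c1 by simp
    fix N k :: nat and z :: complex
    assume k: "k \<in> {1..N}" and z: "\<bar>cmod z - real (R * k)\<bar> \<le> 1"
    let ?c = "\<lambda>k. real k powr (- \<beta>)"
    let ?r = "\<lambda>j. cmod (annular m (R * j) z) * wt m z"
    have k0: "real k > 0" using k by simp
    have Rk: "R * k \<ge> 2"
    proof -
      have "3 * 1 \<le> R * k" using R3 k by (intro mult_le_mono) auto
      then show ?thesis by simp
    qed
    have main: "c1 \<le> ?r k" unfolding c1_def using norm_annular_lower[OF Rk z] by simp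
    have oth: "?c j * ?r j \<le> ?c k * (A * exp 1 * exp (- (real R - \<beta> - 1))) * exp (- 1 * \<bar>real j - real k\<bar>)"
      if j: "j \<in> {1..N} - {k}" for j
    proof -
      define d where "d = \<bar>real j - real k\<bar>"
      have d1: "d \<ge> 1" using j unfolding d_def by (cases "j < k") auto
      have j0: "real j \<ge> 1" using j by simp
      have Rj: "R * j > 0" using R3 j by auto
      have "real R * d = \<bar>real (R * j) - real (R * k)\<bar>"
        unfolding d_def by (simp add: abs_mult right_diff_distrib[symmetric])
      then have x: "real R * d - 1 \<le> \<bar>cmod z - real (R * j)\<bar>" using z by linarith
      have "?r j \<le> A * exp (- \<bar>cmod z - real (R * j)\<bar>)" unfolding A_def by (rule norm_annular_upper[OF Rj])
      also have "\<dots> \<le> A * exp (1 - real R * d)" using x A by (intro mult_left_mono) auto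
      finally have 1: "?r j \<le> A * exp (1 - real R * d)" .
      have "real k \<le> real j * (1 + d)"
      proof -
        have "d * 1 \<le> d * real j" using j0 d1 by (intro mult_left_mono) auto
        moreover have "real k \<le> real j + d" by (simp add: d_def)
        ultimately show ?thesis by (simp add: distrib_left mult.commute)
      qed
      also have "\<dots> \<le> real j * exp d" using exp_ge_add_one_self[of d] j0 by (intro mult_left_mono) auto
      finally have "real k powr \<beta> \<le> (real j * exp d) powr \<beta>" using \<beta> k0 by (intro powr_mono2) auto
      also have "\<dots> = real j powr \<beta> * exp (\<beta> * d)" by (simp add: powr_mult exp_powr_real mult.commute)
      finally have 2: "?c j \<le> ?c k * exp (\<beta> * d)"
        using k0 j0 by (simp add: powr_minus field_simps)
      have "?c j * ?r j \<le> (?c k * exp (\<beta> * d)) * (A * exp (1 - real R * d))"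
        by (rule mult_mono[OF 2 1]) (use A in auto)
      also have "\<dots> = ?c k * A * exp (\<beta> * d + (1 - real R * d))" by (simp add: exp_add)
      also have "\<dots> \<le> ?c k * A * exp (1 + - (real R - \<beta> - 1) + - 1 * d)"
      proof (intro mult_left_mono)
        have "(real R - \<beta> - 1) * 1 \<le> (real R - \<beta> - 1) * d" using RL d1 by (intro mult_left_mono) auto
        then have "\<beta> * d + (1 - real R * d) \<le> 1 + - (real R - \<beta> - 1) + - 1 * d" by (simp add: algebra_simps)
        then show "exp (\<beta> * d + (1 - real R * d)) \<le> exp (1 + - (real R - \<beta> - 1) + - 1 * d)" by simp
      qed (use A in auto)
      also have "\<dots> = ?c k * (A * exp 1 * exp (- (real R - \<beta> - 1))) * exp (- 1 * d)"
        by (simp only: exp_add mult.assoc)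
      finally show ?thesis unfolding d_def .
    qed
    have "(\<Sum>j\<in>{1..N} - {k}. ?c j * ?r j) \<le> (\<Sum>j\<in>{1..N} - {k}. ?c k * (A * exp 1 * exp (- (real R - \<beta> - 1))) * exp (- 1 * \<bar>real j - real k\<bar>))"
      by (intro sum_mono oth)
    also have "\<dots> = ?c k * (A * exp 1 * exp (- (real R - \<beta> - 1))) * (\<Sum>j\<in>{1..N} - {k}. exp (- 1 * \<bar>real j - real k\<bar>))"
      by (rule sum_distrib_left[symmetric])
    also have "\<dots> \<le> ?c k * (A * exp 1 * exp (- (real R - \<beta> - 1))) * (2 / (1 - exp (- 1)))"
      using A by (intro mult_left_mono sum_exp_two_sided_le) auto
    also have "\<dots> = ?c k * (K * exp (- (real R - \<beta> - 1)))" by (simp add: K_def mult_ac)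
    also have "\<dots> \<le> ?c k * (c1 / 2)" using KR by (intro mult_left_mono) auto
    finally have rest: "(\<Sum>j\<in>{1..N} - {k}. ?c j * ?r j) \<le> ?c k * (c1 / 2)" .
    have split: "test_fun m \<beta> R N z = of_real (?c k) * annular m (R * k) z + (\<Sum>j\<in>{1..N} - {k}. of_real (?c j) * annular m (R * j) z)"
      unfolding test_fun_def using k by (intro sum.remove) auto
    have "cmod (of_real (?c k) * annular m (R * k) z) \<le> cmod (test_fun m \<beta> R N z) + cmod (\<Sum>j\<in>{1..N} - {k}. of_real (?c j) * annular m (R * j) z)"
      using norm_triangle_ineq4[of "test_fun m \<beta> R N z" "\<Sum>j\<in>{1..N} - {k}. of_real (?c j) * annular m (R * j) z"] unfolding split by simp
    also have "cmod (\<Sum>j\<in>{1..N} - {k}. of_real (?c j) * annular m (R * j) z) \<le> (\<Sum>j\<in>{1..N} - {k}. cmod (of_real (?c j) * annular m (R * j) z))"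
      by (rule norm_sum)
    finally have "?c k * cmod (annular m (R * k) z) \<le> cmod (test_fun m \<beta> R N z) + (\<Sum>j\<in>{1..N} - {k}. ?c j * cmod (annular m (R * j) z))"
      by (simp add: norm_mult)
    then have "?c k * cmod (annular m (R * k) z) * wt m z \<le> (cmod (test_fun m \<beta> R N z) + (\<Sum>j\<in>{1..N} - {k}. ?c j * cmod (annular m (R * j) z))) * wt m z"
      by (intro mult_right_mono) auto
    then have "?c k * ?r k \<le> cmod (test_fun m \<beta> R N z) * wt m z + (\<Sum>j\<in>{1..N} - {k}. ?c j * ?r j)"
      by (simp add: distrib_right sum_distrib_right mult.assoc)
    moreover have "?c k * c1 \<le> ?c k * ?r k" using main by (intro mult_left_mono) auto
    ultimately show "c1 / 2 * ?c k \<le> cmod (test_fun m \<beta> R N z) * wt m z"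
      using rest by (simp add: field_simps)
  qed
qed

lemma emeasure_annulus:
  assumes "\<rho> \<ge> 1"
  shows "emeasure lborel {z::complex. \<bar>cmod z - \<rho>\<bar> \<le> 1} = ennreal (4 * pi * \<rho>)"
proof -
  have eq: "{z::complex. \<bar>cmod z - \<rho>\<bar> \<le> 1} = cball 0 (\<rho> + 1) - ball 0 (\<rho> - 1)" by auto
  have "emeasure lborel (cball (0::complex) (\<rho> + 1) - ball 0 (\<rho> - 1))
     = emeasure lborel (cball (0::complex) (\<rho> + 1)) - emeasure lborel (ball (0::complex) (\<rho> - 1))"
    using assms by (intro emeasure_Diff) (auto simp: emeasure_lborel_ball_complex)
  also have "\<dots> = ennreal (pi * (\<rho> + 1)\<^sup>2) - ennreal (pi * (\<rho> - 1)\<^sup>2)"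
    using assms by (simp add: emeasure_lborel_ball_complex)
  also have "\<dots> = ennreal (pi * (\<rho> + 1)\<^sup>2 - pi * (\<rho> - 1)\<^sup>2)" by (rule ennreal_minus) simp
  also have "pi * (\<rho> + 1)\<^sup>2 - pi * (\<rho> - 1)\<^sup>2 = 4 * pi * \<rho>" by (simp add: power2_eq_square algebra_simps)
  finally show ?thesis unfolding eq .
qed

text \<open>Here \<gamma> is the decay order of the multiplier. The \<open>k\<close>-th annulus
  contributes about \<open>k powr (1 - (2 / p + \<gamma>) * q)\<close> to the integral for the
  image, which by \<open>cond\<close> is at least \<open>1 / k\<close>. So the harmonic sum
  \<open>h\<close> is bounded, up to constants, by \<open>h powr (q / p)\<close>, with
  \<open>q / p < 1\<close>.\<close>

lemma Vol_not_bounded: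
  assumes g: "g holomorphic_on UNIV" and q: "0 < q" "q < p" and bdd: "Vol_bounded m p q g"
    and c0: "c0 > 0" and \<gamma>: "\<gamma> \<ge> 0" and cond: "(2 / p + \<gamma>) * q \<le> 2"
    and low: "\<And>z. x0 \<le> cmod z \<Longrightarrow> c0 * (1 + cmod z) powr (- \<gamma>) \<le> cmod (deriv g z) / (1 + cmod z)"
  shows False
proof -
  have p: "p > 0" using q by simp
  obtain R :: nat and c :: real where R: "R \<ge> 3" and c: "c > 0" and
    lower: "\<And>N k z. k \<in> {1..N} \<Longrightarrow> \<bar>cmod z - real (R * k)\<bar> \<le> 1 \<Longrightarrow>
       c * real k powr (- (2 / p)) \<le> cmod (test_fun m (2 / p) R N z) * wt m z"
    using test_fun_lower[of "2 / p"] p by (metis divide_pos_pos zero_less_numeral)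
  obtain C2 where C2: "C2 > 0" "\<And>N. fs_integral p m (test_fun m (2 / p) R N) \<le> ennreal (C2 * harm N)"
    using test_fun_upper[OF p, of R m] R by auto
  obtain CV where CV: "\<And>f. f \<in> FS p m \<Longrightarrow> Volterra g f \<in> FS q m \<and> fs_norm q m (Volterra g f) \<le> CV * fs_norm p m f"
    using bdd unfolding Vol_bounded_def by blast
  obtain CG where CG: "CG > 0" "\<And>f. f holomorphic_on UNIV \<Longrightarrow>
      (\<integral>\<^sup>+z. ennreal ((cmod (f z) * wt m z * (cmod (deriv g z) / (1 + cmod z))) powr q) \<partial>lborel)
      \<le> ennreal CG * fs_integral q m (Volterra g f)"
    using Volterra_integral_ge[OF g q(1)] by blast
  \<comment> \<open>Annuli of index below \<open>k0\<close> may lie where \<open>low\<close> says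
    nothing; leaving them out costs at most \<open>k0\<close> in the harmonic sum.\<close>
  define k0 where "k0 = nat \<lceil>max 1 (x0 + 1)\<rceil>"
  have k0: "k0 \<ge> 1" "real k0 \<ge> x0 + 1" unfolding k0_def by linarith+
  define d where "d = c * (c0 * real (R + 2) powr (- \<gamma>))"
  have d: "d > 0" using c c0 by (simp add: d_def)
  define \<kappa> where "\<kappa> = d powr q * (4 * pi * real R)"
  have \<kappa>: "\<kappa> > 0" using d R by (simp add: \<kappa>_def)
  define Cf where "Cf = CG * (\<bar>CV\<bar> powr q * C2 powr (q / p))"
  have Cf: "Cf \<ge> 0" using CG by (simp add: Cf_def)
  have ineq: "\<kappa> * (harm N - real k0) \<le> Cf * harm N powr (q / p)" for N
  proof -
    define f where "f = test_fun m (2 / p) R N"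
    have fh: "f holomorphic_on UNIV" unfolding f_def by (rule test_fun_entire)
    have fi: "fs_integral p m f \<le> ennreal (C2 * harm N)" unfolding f_def by (rule C2)
    have H0: "harm N \<ge> (0::real)" by (simp add: harm_nonneg)
    have fFS: "f \<in> FS p m" using fi fh by (auto simp: FS_iff intro: order.strict_trans1)
    have fn: "fs_norm p m f \<le> (C2 * harm N) powr (1 / p)"
      using fi p C2 H0 by (intro fs_norm_leI) (auto simp: powr_powr)
    let ?K = "{k0..N}"
    let ?A = "\<lambda>k. {z::complex. \<bar>cmod z - real (R * k)\<bar> \<le> 1}"
    define w where "w k = (d * real k powr (- (2 / p + \<gamma>))) powr q" for k
    have [measurable]: "?A k \<in> sets borel" for k by measurable
    \<comment> \<open>Radii that differ by at least \<open>R \<ge> 3\<close> make these annuli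
      disjoint, so at most one term of the sum is nonzero.\<close>
    have pt: "(\<Sum>k\<in>?K. ennreal (w k) * indicator (?A k) z) \<le> ennreal ((cmod (f z) * wt m z * (cmod (deriv g z) / (1 + cmod z))) powr q)" for z
    proof (cases "\<exists>k\<in>?K. z \<in> ?A k")
      case True
      then obtain k where k: "k \<in> ?K" "z \<in> ?A k" by blast
      have k1: "k \<in> {1..N}" "real k \<ge> 1" "real k \<ge> x0 + 1" using k k0 by auto
      have uniq: "z \<notin> ?A j" if "j \<noteq> k" for j
      proof
        assume "z \<in> ?A j"
        then have "\<bar>real (R * j) - real (R * k)\<bar> \<le> 2" using k(2) by simp
        moreover have "\<bar>real (R * j) - real (R * k)\<bar> = real R * \<bar>real j - real k\<bar>"
          by (simp add: abs_mult right_diff_distrib[symmetric])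
        moreover have "\<bar>real j - real k\<bar> \<ge> 1" using that by (cases "j < k") auto
        then have "3 * 1 \<le> real R * \<bar>real j - real k\<bar>" using R by (intro mult_mono) auto
        ultimately show False by linarith
      qed
      have "(\<Sum>k\<in>?K. ennreal (w k) * indicator (?A k) z) = (\<Sum>j\<in>?K. if j = k then ennreal (w k) else 0)"
        using uniq k by (intro sum.cong) (auto simp: indicator_def)
      also have "\<dots> = ennreal (w k)" using k by simp
      also have "\<dots> \<le> ennreal ((cmod (f z) * wt m z * (cmod (deriv g z) / (1 + cmod z))) powr q)"
        unfolding w_def
      proof (intro ennreal_leI powr_mono2)
        have Rk: "real (R * k) \<ge> 3 * real k" using R by (simp add: mult_right_mono)
        have zz: "\<bar>cmod z - real (R * k)\<bar> \<le> 1" using k(2) by simp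
        then have "cmod z \<ge> x0" using Rk k1 by linarith
        from low[OF this] have u: "c0 * (1 + cmod z) powr (- \<gamma>) \<le> cmod (deriv g z) / (1 + cmod z)" .
        have "1 + cmod z \<le> real (R + 2) * real k"
        proof -
          have "1 + cmod z \<le> real (R * k) + 2" using zz by linarith
          also have "\<dots> \<le> real (R + 2) * real k" using k1 by (simp add: distrib_right)
          finally show ?thesis .
        qed
        then have "(real (R + 2) * real k) powr (- \<gamma>) \<le> (1 + cmod z) powr (- \<gamma>)"
          using \<gamma> by (intro powr_mono2') (auto simp: add_pos_nonneg)
        then have "c0 * (real (R + 2) powr (- \<gamma>) * real k powr (- \<gamma>)) \<le> c0 * (1 + cmod z) powr (- \<gamma>)"
          using c0 by (intro mult_left_mono) (auto simp: powr_mult)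
        with u have u': "c0 * (real (R + 2) powr (- \<gamma>) * real k powr (- \<gamma>)) \<le> cmod (deriv g z) / (1 + cmod z)" by linarith
        have "d * real k powr (- (2 / p + \<gamma>)) = (c * real k powr (- (2 / p))) * (c0 * (real (R + 2) powr (- \<gamma>) * real k powr (- \<gamma>)))"
          unfolding d_def minus_add_distrib powr_add by (simp add: mult_ac)
        also have "\<dots> \<le> (cmod (f z) * wt m z) * (cmod (deriv g z) / (1 + cmod z))"
          unfolding f_def by (rule mult_mono[OF lower[OF k1(1) zz] u']) (use c0 in auto)
        finally show "d * real k powr (- (2 / p + \<gamma>)) \<le> cmod (f z) * wt m z * (cmod (deriv g z) / (1 + cmod z))" .
      qed (use q d in auto)
      finally show ?thesis .
    next
      case False
      then show ?thesis by (simp add: sum.neutral)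
    qed
    have "ennreal (\<Sum>k\<in>?K. w k * (4 * pi * real (R * k))) = (\<Sum>k\<in>?K. ennreal (w k) * emeasure lborel (?A k))"
    proof -
      have "emeasure lborel (?A k) = ennreal (4 * pi * real (R * k))" if "k \<in> ?K" for k
      proof (rule emeasure_annulus)
        have "1 * 1 \<le> real R * real k" using that R k0 by (intro mult_mono) auto
        then show "1 \<le> real (R * k)" by simp
      qed
      then show ?thesis by (simp add: w_def ennreal_mult[symmetric])
    qed
    also have "\<dots> = (\<Sum>k\<in>?K. \<integral>\<^sup>+z. ennreal (w k) * indicator (?A k) z \<partial>lborel)"
      by (intro sum.cong refl nn_integral_cmult_indicator[symmetric]) simp
    also have "\<dots> = (\<integral>\<^sup>+z. (\<Sum>k\<in>?K. ennreal (w k) * indicator (?A k) z) \<partial>lborel)"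
      by (rule nn_integral_sum[symmetric]) measurable
    also have "\<dots> \<le> (\<integral>\<^sup>+z. ennreal ((cmod (f z) * wt m z * (cmod (deriv g z) / (1 + cmod z))) powr q) \<partial>lborel)"
      by (intro nn_integral_mono pt)
    also have "\<dots> \<le> ennreal CG * fs_integral q m (Volterra g f)" by (rule CG(2)[OF fh])
    also have "\<dots> \<le> ennreal CG * ennreal ((\<bar>CV\<bar> * (C2 * harm N) powr (1 / p)) powr q)"
    proof (intro mult_left_mono fs_integral_le_norm[OF _ q(1)])
      show "Volterra g f \<in> FS q m" using CV[OF fFS] by simp
      have "fs_norm q m (Volterra g f) \<le> CV * fs_norm p m f" using CV[OF fFS] by simp
      also have "\<dots> \<le> \<bar>CV\<bar> * fs_norm p m f" by (intro mult_right_mono) auto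
      also have "\<dots> \<le> \<bar>CV\<bar> * (C2 * harm N) powr (1 / p)" using fn by (intro mult_left_mono) auto
      finally show "fs_norm q m (Volterra g f) \<le> \<bar>CV\<bar> * (C2 * harm N) powr (1 / p)" .
    qed simp
    also have "\<dots> = ennreal (Cf * harm N powr (q / p))"
      using CG C2 H0 by (simp add: Cf_def powr_mult powr_powr ennreal_mult[symmetric] mult_ac)
    finally have 1: "(\<Sum>k\<in>?K. w k * (4 * pi * real (R * k))) \<le> Cf * harm N powr (q / p)"
      using Cf by (subst (asm) ennreal_le_iff) auto
    have "\<kappa> * (harm N - real k0) \<le> \<kappa> * (\<Sum>k\<in>?K. inverse (real k))"
    proof (intro mult_left_mono)
      have "harm N \<le> (\<Sum>k\<in>{1..k0} \<union> ?K. inverse (real k))"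
        unfolding harm_def by (intro sum_mono2) auto
      also have "\<dots> \<le> (\<Sum>k\<in>{1..k0}. inverse (real k)) + (\<Sum>k\<in>?K. inverse (real k))"
        by (subst sum_Un) (auto intro!: sum_nonneg)
      also have "(\<Sum>k\<in>{1..k0}. inverse (real k)) \<le> (\<Sum>k\<in>{1..k0}. 1)"
        by (intro sum_mono) (auto simp: field_simps)
      finally show "harm N - real k0 \<le> (\<Sum>k\<in>?K. inverse (real k))" by simp
    qed (use \<kappa> in simp)
    also have "\<dots> = (\<Sum>k\<in>?K. \<kappa> * inverse (real k))" by (rule sum_distrib_left)
    also have "\<dots> \<le> (\<Sum>k\<in>?K. w k * (4 * pi * real (R * k)))"
    proof (intro sum_mono)
      fix k assume "k \<in> ?K"
      then have k: "real k \<ge> 1" using k0 by simp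
      have "inverse (real k) = real k powr (- 1)" using k by (simp add: powr_minus)
      also have "\<dots> \<le> real k powr (- ((2 / p + \<gamma>) * q) + 1)"
        using k cond by (intro powr_mono) auto
      also have "\<dots> = real k powr (- ((2 / p + \<gamma>) * q)) * real k"
        unfolding powr_add using k by simp
      finally have "\<kappa> * inverse (real k) \<le> \<kappa> * (real k powr (- ((2 / p + \<gamma>) * q)) * real k)"
        using \<kappa> by (intro mult_left_mono) auto
      also have "\<dots> = w k * (4 * pi * real (R * k))"
      proof -
        have "w k = d powr q * real k powr (- ((2 / p + \<gamma>) * q))"
          by (simp only: w_def powr_mult powr_powr mult_minus_left)
        then show ?thesis by (simp add: \<kappa>_def mult_ac)
      qed
      finally show "\<kappa> * inverse (real k) \<le> w k * (4 * pi * real (R * k))" .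
    qed
    finally show ?thesis using 1 by linarith
  qed
  define s where "s = 1 - q / p"
  have s: "s > 0" using q by (simp add: s_def field_simps)
  \<comment> \<open>The first entry makes \<open>h - k0\<close> at least \<open>h / 2\<close>, the
    second makes \<open>h powr (1 - q / p)\<close> exceed \<open>2 * Cf / \<kappa>\<close>.\<close>
  define B where "B = max (2 * real k0 + 1) ((2 * Cf / \<kappa> + 1) powr (1 / s))"
  have "eventually (\<lambda>N. harm N \<ge> B) sequentially"
    using harm_at_top by (simp add: filterlim_at_top)
  then obtain N where N: "harm N \<ge> B" using eventually_happens'[OF sequentially_bot] by blast
  define h where "h = (harm N :: real)"
  have h: "h \<ge> 2 * real k0 + 1" "h \<ge> (2 * Cf / \<kappa> + 1) powr (1 / s)"
    using N by (auto simp: h_def B_def)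
  have h0: "h > 0" using h(1) by linarith
  have "((2 * Cf / \<kappa> + 1) powr (1 / s)) powr s \<le> h powr s"
    using h(2) s by (intro powr_mono2) auto
  then have hs: "2 * Cf / \<kappa> + 1 \<le> h powr s" using s Cf \<kappa> by (simp add: powr_powr add_nonneg_pos)
  have "\<kappa> * (h / 2) \<le> \<kappa> * (h - real k0)" using h \<kappa> by (intro mult_left_mono) auto
  also have "\<dots> \<le> Cf * h powr (q / p)" unfolding h_def by (rule ineq)
  finally have "\<kappa> * (h / 2) \<le> Cf * h powr (q / p)" .
  moreover have "h = h powr s * h powr (q / p)" using h0 by (simp add: s_def powr_add[symmetric])
  ultimately have "(\<kappa> / 2 * h powr s) * h powr (q / p) \<le> Cf * h powr (q / p)" by (simp add: mult_ac)
  then have "\<kappa> / 2 * h powr s \<le> Cf" using h0 by simp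
  then have "h powr s \<le> 2 * Cf / \<kappa>" using \<kappa> by (simp add: field_simps)
  then show False using hs by linarith
qed

text \<open>A nonzero \<open>a\<close> gives a multiplier of order \<open>\<gamma> = 0\<close>,
  where \<open>cond\<close> reads \<open>q \<le> p\<close>. With \<open>a = 0\<close>, a nonzero
  \<open>b\<close> gives \<open>\<gamma> = 1\<close>, where \<open>cond\<close> reads
  \<open>q / 2 \<le> (p - q) / p\<close>.\<close>

lemma Vol_bounded_gt_imp:
  assumes g: "g holomorphic_on UNIV" and q: "0 < q" "q < p" and bdd: "Vol_bounded m p q g"
  shows "if q / 2 > (p - q) / p then (\<exists>a b. \<forall>z. g z = a * z + b) else (\<exists>c. \<forall>z. g z = c)"
proof -
  have p: "p > 0" using q by simp
  obtain a b c where quad: "\<And>z. g z = a * z\<^sup>2 + b * z + c"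
    using Vol_bounded_imp_quadratic[OF g p q(1) bdd] by blast
  have dg: "deriv g z = 2 * a * z + b" for z by (rule deriv_quadratic[OF quad])
  have a0: "a = 0"
  proof (rule ccontr)
    assume a: "a \<noteq> 0"
    show False
    \<comment> \<open>Beyond this radius \<open>|b| \<le> |a| |z| / 2\<close> and
      \<open>1 + |z| \<le> 2 |z|\<close>, so the leading term of \<open>g'\<close>
      dominates.\<close>
    proof (rule Vol_not_bounded[OF g q bdd, of "cmod a / 2" 0 "max 1 (cmod b / (cmod a / 2))"])
      show "cmod a / 2 > 0" using a by simp
      show "(2 / p + 0) * q \<le> 2" using q by (simp add: field_simps)
      fix z assume z: "max 1 (cmod b / (cmod a / 2)) \<le> cmod z"
      have z1: "cmod z \<ge> 1" and zb: "cmod b / (cmod a / 2) \<le> cmod z" using z by auto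
      define y where "y = cmod a * cmod z"
      have "y \<ge> 0" by (simp add: y_def)
      moreover have "cmod b \<le> y / 2" using zb a by (simp add: y_def field_simps)
      moreover have "cmod (2 * a * z) - cmod b \<le> cmod (2 * a * z + b)"
        using norm_diff_ineq by blast
      moreover have "cmod (2 * a * z) = 2 * y" by (simp add: norm_mult y_def)
      moreover have "cmod a / 2 * (1 + cmod z) \<le> y"
        using mult_left_mono[of "1 + cmod z" "2 * cmod z" "cmod a / 2"] z1 by (simp add: y_def)
      ultimately have "cmod a / 2 * (1 + cmod z) \<le> cmod (2 * a * z + b)" by linarith
      then have "cmod a / 2 * (1 + cmod z) \<le> cmod (deriv g z)" unfolding dg .
      then show "cmod a / 2 * (1 + cmod z) powr (- 0) \<le> cmod (deriv g z) / (1 + cmod z)"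
        using z1 by (simp add: field_simps)
    qed simp
  qed
  show ?thesis
  proof (cases "q / 2 > (p - q) / p")
    case True
    then show ?thesis using quad a0 by auto
  next
    case False
    have "b = 0"
    proof (rule ccontr)
      assume b: "b \<noteq> 0"
      show False
      proof (rule Vol_not_bounded[OF g q bdd, of "cmod b" 1 0])
        show "cmod b > 0" using b by simp
        show "(2 / p + 1) * q \<le> 2" using False p by (simp add: field_simps)
        fix z
        show "cmod b * (1 + cmod z) powr (- 1) \<le> cmod (deriv g z) / (1 + cmod z)"
          by (simp add: dg a0 powr_minus divide_inverse add_pos_nonneg)
      qed simp
    qed
    then show ?thesis using False quad a0 by auto
  qed
qed

section \<open>Monomials in the Hilbert space\<close>

lemma exp_psi_2: "exp (- 2 * psi m z) = (wt m z)\<^sup>2"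
  unfolding exp_psi by (simp add: powr_numeral)

lemma nn_integral_norm_square:
  "(\<integral>\<^sup>+z. ennreal ((cmod (f z) * wt m z)\<^sup>2) \<partial>lborel) = fs_integral 2 m f"
  unfolding fs_integral_wt by (simp add: powr_numeral)

lemma FS2_square_integrable:
  assumes f: "f \<in> FS 2 m"
  shows "integrable lborel (\<lambda>z. (cmod (f z) * wt m z)\<^sup>2)"
proof (rule integrableI_nonneg)
  have [measurable]: "f \<in> borel_measurable borel" using f by (intro entire_measurable) (simp add: FS_iff)
  show "(\<lambda>z. (cmod (f z) * wt m z)\<^sup>2) \<in> borel_measurable lborel" by measurable
  show "(\<integral>\<^sup>+z. ennreal ((cmod (f z) * wt m z)\<^sup>2) \<partial>lborel) < \<infinity>"
    using f by (simp add: nn_integral_norm_square FS_iff)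
qed simp

lemma cnj_measurable [measurable]: "cnj \<in> borel_measurable borel"
  by (intro borel_measurable_continuous_onI continuous_intros)

lemma fs_inner_integrable:
  assumes f: "f \<in> FS 2 m" and h: "h \<in> FS 2 m"
  shows "integrable lborel (\<lambda>z. f z * cnj (h z) * complex_of_real (exp (- 2 * psi m z)))"
proof (rule Bochner_Integration.integrable_bound)
  have [measurable]: "f \<in> borel_measurable borel" "h \<in> borel_measurable borel"
    using f h by (auto intro!: entire_measurable simp: FS_iff)
  show "integrable lborel (\<lambda>z. (cmod (f z) * wt m z)\<^sup>2 + (cmod (h z) * wt m z)\<^sup>2)"
    by (intro Bochner_Integration.integrable_add FS2_square_integrable f h)
  show "(\<lambda>z. f z * cnj (h z) * complex_of_real (exp (- 2 * psi m z))) \<in> borel_measurable lborel"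
    unfolding exp_psi_2 by measurable
  show "AE z in lborel. cmod (f z * cnj (h z) * complex_of_real (exp (- 2 * psi m z)))
      \<le> norm ((cmod (f z) * wt m z)\<^sup>2 + (cmod (h z) * wt m z)\<^sup>2)"
  proof (intro AE_I2)
    fix z
    define x y where "x = cmod (f z) * wt m z" and "y = cmod (h z) * wt m z"
    have xy: "x \<ge> 0" "y \<ge> 0" by (simp_all add: x_def y_def)
    have "0 \<le> (x - y)\<^sup>2" by simp
    then have "2 * (x * y) \<le> x\<^sup>2 + y\<^sup>2" by (simp add: power2_eq_square algebra_simps)
    moreover have "x * y \<ge> 0" using xy by simp
    moreover have "cmod (f z * cnj (h z) * complex_of_real (exp (- 2 * psi m z))) = x * y"
      unfolding exp_psi_2 norm_mult norm_of_real by (simp add: x_def y_def power2_eq_square)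
    ultimately show "cmod (f z * cnj (h z) * complex_of_real (exp (- 2 * psi m z)))
      \<le> norm ((cmod (f z) * wt m z)\<^sup>2 + (cmod (h z) * wt m z)\<^sup>2)"
      unfolding x_def[symmetric] y_def[symmetric] by simp
  qed
qed

lemma fs_inner_commute: "fs_inner m h f = cnj (fs_inner m f h)"
proof -
  have "fs_inner m h f = (LINT z|lborel. cnj (f z * cnj (h z) * complex_of_real (exp (- 2 * psi m z))))"
    unfolding fs_inner_def by (simp add: mult_ac)
  also have "\<dots> = cnj (fs_inner m f h)"
    unfolding fs_inner_def by (rule Bochner_Integration.integral_cnj)
  finally show ?thesis .
qed

lemma fs_inner_diff_left:
  assumes "f \<in> FS 2 m" "h \<in> FS 2 m" "k \<in> FS 2 m"
  shows "fs_inner m (\<lambda>z. f z - h z) k = fs_inner m f k - fs_inner m h k"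
  unfolding fs_inner_def left_diff_distrib
  by (intro Bochner_Integration.integral_diff fs_inner_integrable assms)

lemma fs_inner_scale_left: "fs_inner m (\<lambda>z. c * f z) h = c * fs_inner m f h"
  unfolding fs_inner_def by (simp add: mult.assoc)

lemma fs_inner_scale_right: "fs_inner m f (\<lambda>z. c * h z) = cnj c * fs_inner m f h"
  using fs_inner_commute[of m f "\<lambda>z. c * h z"] fs_inner_commute[of m f h] by (simp add: fs_inner_scale_left)

lemma fs_inner_sum_left:
  assumes "\<And>i. i \<in> S \<Longrightarrow> e i \<in> FS 2 m" "k \<in> FS 2 m"
  shows "fs_inner m (\<lambda>z. \<Sum>i\<in>S. c i * e i z) k = (\<Sum>i\<in>S. c i * fs_inner m (e i) k)"
proof -
  have "fs_inner m (\<lambda>z. \<Sum>i\<in>S. c i * e i z) k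
    = (LINT z|lborel. (\<Sum>i\<in>S. c i * (e i z * cnj (k z) * complex_of_real (exp (- 2 * psi m z)))))"
    unfolding fs_inner_def by (simp add: sum_distrib_right mult.assoc)
  also have "\<dots> = (\<Sum>i\<in>S. LINT z|lborel. c i * (e i z * cnj (k z) * complex_of_real (exp (- 2 * psi m z))))"
    by (intro Bochner_Integration.integral_sum integrable_mult_right fs_inner_integrable assms)
  also have "\<dots> = (\<Sum>i\<in>S. c i * fs_inner m (e i) k)"
    unfolding fs_inner_def by simp
  finally show ?thesis .
qed

lemma FS_sum:
  assumes "finite S" "\<And>i. i \<in> S \<Longrightarrow> e i \<in> FS p m" "p > 0"
  shows "(\<lambda>z. \<Sum>i\<in>S. c i * e i z) \<in> FS p m"
  using assms(1,2)
proof (induction S rule: finite_induct)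
  case empty
  have "(\<lambda>z. 0 * z ^ 0) \<in> FS p m" by (rule FS_scale[OF monomial_in_FS[OF assms(3)]])
  then show ?case by simp
next
  case (insert x F)
  have "(\<lambda>z. c x * e x z - (-1) * (\<Sum>i\<in>F. c i * e i z)) \<in> FS p m"
    using insert assms(3) by (intro FS_diff FS_scale) auto
  then show ?case using insert by simp
qed

lemma fs_inner_self:
  assumes f: "f \<in> FS 2 m"
  shows "fs_inner m f f = of_real ((fs_norm 2 m f)\<^sup>2)"
proof -
  have "fs_inner m f f = (LINT z|lborel. complex_of_real ((cmod (f z) * wt m z)\<^sup>2))"
    unfolding fs_inner_def exp_psi_2
    by (simp add: complex_norm_square[symmetric] power_mult_distrib)
  also have "\<dots> = of_real (LINT z|lborel. (cmod (f z) * wt m z)\<^sup>2)"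
    by (rule integral_complex_of_real)
  also have "(LINT z|lborel. (cmod (f z) * wt m z)\<^sup>2) = enn2real (fs_integral 2 m f)"
    by (subst integral_eq_nn_integral[OF borel_measurable_integrable[OF FS2_square_integrable[OF f]]])
      (auto simp: nn_integral_norm_square)
  also have "\<dots> = (fs_norm 2 m f)\<^sup>2"
    by (simp add: fs_norm_def powr_half_sqrt)
  finally show ?thesis .
qed

text \<open>Besides Bessel's inequality this shows that Taylor remainders never exceed
  \<open>f\<close> in norm, since the Taylor series is the expansion in normalised
  monomials.\<close>

lemma orthogonal_remainder:
  assumes e: "fs_orthonormal m e" and f: "f \<in> FS 2 m" and S: "finite S"
  defines "d \<equiv> (\<lambda>z. f z - (\<Sum>i\<in>S. fs_inner m f (e i) * e i z))"
  shows "d \<in> FS 2 m" "(fs_norm 2 m d)\<^sup>2 = (fs_norm 2 m f)\<^sup>2 - (\<Sum>i\<in>S. (cmod (fs_inner m f (e i)))\<^sup>2)"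
proof -
  let ?c = "\<lambda>i. fs_inner m f (e i)"
  have eF: "e i \<in> FS 2 m" for i using e by (simp add: fs_orthonormal_def)
  have eo: "fs_inner m (e i) (e j) = (if i = j then 1 else 0)" for i j using e by (simp add: fs_orthonormal_def)
  define P where "P = (\<lambda>z. \<Sum>i\<in>S. ?c i * e i z)"
  have P: "P \<in> FS 2 m" unfolding P_def using S eF by (intro FS_sum) auto
  have d: "d = (\<lambda>z. f z - P z)" by (simp add: d_def P_def)
  show dF: "d \<in> FS 2 m" unfolding d by (intro FS_diff f P) simp
  have inner_P: "fs_inner m P k = (\<Sum>i\<in>S. ?c i * fs_inner m (e i) k)" if "k \<in> FS 2 m" for k
    unfolding P_def by (intro fs_inner_sum_left eF that)
  have de: "fs_inner m d (e j) = 0" if "j \<in> S" for j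
  proof -
    have "fs_inner m d (e j) = ?c j - fs_inner m P (e j)"
      unfolding d by (intro fs_inner_diff_left f P eF)
    also have "fs_inner m P (e j) = (\<Sum>i\<in>S. if i = j then ?c j else 0)"
      unfolding inner_P[OF eF] eo by (intro sum.cong) auto
    also have "\<dots> = ?c j" using S that by simp
    finally show ?thesis by simp
  qed
  have Pd: "fs_inner m P d = 0"
    unfolding inner_P[OF dF] using de fs_inner_commute[of m _ d] by (simp add: sum.neutral)
  have "fs_inner m d d = fs_inner m f d - fs_inner m P d"
    using fs_inner_diff_left[OF f P dF] by (simp add: d)
  also have "\<dots> = cnj (fs_inner m d f)" using Pd fs_inner_commute[of m f d] by simp
  also have "fs_inner m d f = fs_inner m f f - fs_inner m P f"
    using fs_inner_diff_left[OF f P f] by (simp add: d)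
  also have "fs_inner m P f = (\<Sum>i\<in>S. of_real ((cmod (?c i))\<^sup>2))"
    unfolding inner_P[OF f] using fs_inner_commute[of m _ f]
    by (simp add: complex_norm_square del: of_real_power)
  finally have "complex_of_real ((fs_norm 2 m d)\<^sup>2) = of_real ((fs_norm 2 m f)\<^sup>2 - (\<Sum>i\<in>S. (cmod (?c i))\<^sup>2))"
    unfolding fs_inner_self[OF dF] fs_inner_self[OF f] by simp
  then show "(fs_norm 2 m d)\<^sup>2 = (fs_norm 2 m f)\<^sup>2 - (\<Sum>i\<in>S. (cmod (?c i))\<^sup>2)"
    by (simp only: of_real_eq_iff)
qed

lemma bessel:
  assumes "fs_orthonormal m e" "f \<in> FS 2 m" "finite S"
  shows "(\<Sum>i\<in>S. (cmod (fs_inner m f (e i)))\<^sup>2) \<le> (fs_norm 2 m f)\<^sup>2"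
proof -
  have "0 \<le> (fs_norm 2 m f)\<^sup>2 - (\<Sum>i\<in>S. (cmod (fs_inner m f (e i)))\<^sup>2)"
    unfolding orthogonal_remainder(2)[OF assms, symmetric] by simp
  then show ?thesis by simp
qed

lemma norm_orthonormal:
  assumes "fs_orthonormal m e"
  shows "fs_norm 2 m (e i) = 1"
proof -
  have "fs_inner m (e i) (e i) = 1" "e i \<in> FS 2 m" using assms by (auto simp: fs_orthonormal_def)
  then have "complex_of_real ((fs_norm 2 m (e i))\<^sup>2) = of_real 1" using fs_inner_self by simp
  then have "(fs_norm 2 m (e i))\<^sup>2 = 1" by (simp only: of_real_eq_iff)
  then show ?thesis by (simp add: power2_eq_1_iff) (smt (verit) fs_norm_nonneg)
qed

section \<open>Norms of monomials and Taylor coefficients as inner products\<close>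

definition mono_norm2 :: "nat \<Rightarrow> nat \<Rightarrow> real" where
  "mono_norm2 m n = (fs_norm 2 m (\<lambda>z. z ^ n))\<^sup>2"

lemma nn_integral_gauss_moment:
  "(\<integral>\<^sup>+z. ennreal (cmod z ^ (2 * n) * exp (- (cmod z)\<^sup>2)) \<partial>lborel) = ennreal (pi * fact n)"
proof -
  have "(\<integral>\<^sup>+z. ennreal (cmod z ^ (2 * n) * exp (- (cmod z)\<^sup>2)) \<partial>lborel)
    = (\<integral>\<^sup>+z. ennreal (((cmod z)\<^sup>2) ^ n * exp (- (cmod z)\<^sup>2)) \<partial>lborel)"
    by (simp add: power_mult)
  also have "\<dots> = ennreal pi * (\<integral>\<^sup>+t. ennreal (t ^ n * exp (- t)) * indicator {0..} t \<partial>lborel)"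
    by (rule nn_integral_lborel_radial[where h="\<lambda>t. ennreal (t ^ n * exp (- t))"]) measurable
  also have "(\<integral>\<^sup>+t. ennreal (t ^ n * exp (- t)) * indicator {0..} t \<partial>lborel)
     = (\<integral>\<^sup>+t. ennreal (indicator {0..} t * t powr (real (Suc n) - 1) / exp t) \<partial>lborel)"
  proof (rule nn_integral_cong_AE, rule AE_mp[OF AE_lborel_singleton[of 0]], rule AE_I2, rule impI)
    fix t :: real assume "t \<noteq> 0"
    then show "ennreal (t ^ n * exp (- t)) * indicator {0..} t = ennreal (indicator {0..} t * t powr (real (Suc n) - 1) / exp t)"
      by (cases "t > 0") (auto simp: indicator_def powr_realpow exp_minus divide_inverse)
  qed
  also have "\<dots> = ennreal (fact n)"
  proof -
    have "Gamma (real (Suc n)) = fact n" using Gamma_fact[of n, where ?'a=real] by (simp add: add.commute)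
    then show ?thesis using Gamma_conv_nn_integral_real[of "real (Suc n)"] by (simp del: of_nat_Suc)
  qed
  finally show ?thesis by (simp add: ennreal_mult)
qed

text \<open>\<open>(1 + |z|)^(2 m)\<close> lies between \<open>|z|^(2 m)\<close> and
  \<open>4^m (1 + |z|^(2 m))\<close>, and for pure powers the Gaussian moments are factorials. Only
  the order of magnitude matters later.\<close>

lemma mono_norm2_bounds:
  "pi * fact (n + m) \<le> mono_norm2 m n" "mono_norm2 m n \<le> 2 * 4 ^ m * (pi * fact (n + m))"
proof -
  let ?D = "\<lambda>k z. cmod z ^ (2 * k) * exp (- (cmod z)\<^sup>2)"
  have FS: "(\<lambda>z. z ^ n) \<in> FS 2 m" by (rule monomial_in_FS) simp
  have I: "ennreal (mono_norm2 m n) = (\<integral>\<^sup>+z. ennreal ((cmod z ^ n * wt m z)\<^sup>2) \<partial>lborel)"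
    using fs_integral_eq_norm[OF FS] nn_integral_norm_square[of "\<lambda>z. z ^ n" m]
    by (simp add: mono_norm2_def norm_power powr_numeral)
  have sq: "(cmod z ^ n * wt m z)\<^sup>2 = cmod z ^ (2 * n) * exp (- (cmod z)\<^sup>2) * (1 + cmod z) ^ (2 * m)" for z
  proof -
    have "(exp (- (cmod z)\<^sup>2 / 2))\<^sup>2 = exp (- (cmod z)\<^sup>2)" by (simp add: power2_eq_square exp_add[symmetric])
    then show ?thesis by (simp add: wt_def power_mult_distrib power_mult[symmetric] mult.commute)
  qed
  have "ennreal (pi * fact (n + m)) = (\<integral>\<^sup>+z. ennreal (?D (n + m) z) \<partial>lborel)"
    by (rule nn_integral_gauss_moment[symmetric])
  also have "\<dots> \<le> (\<integral>\<^sup>+z. ennreal ((cmod z ^ n * wt m z)\<^sup>2) \<partial>lborel)"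
  proof (intro nn_integral_mono ennreal_leI)
    fix z
    have "cmod z ^ (2 * m) \<le> (1 + cmod z) ^ (2 * m)" by (intro power_mono) auto
    then have "?D n z * cmod z ^ (2 * m) \<le> ?D n z * (1 + cmod z) ^ (2 * m)" by (intro mult_left_mono) auto
    then show "?D (n + m) z \<le> (cmod z ^ n * wt m z)\<^sup>2" unfolding sq by (simp add: distrib_left power_add mult_ac)
  qed
  also have "\<dots> = ennreal (mono_norm2 m n)" by (rule I[symmetric])
  finally show "pi * fact (n + m) \<le> mono_norm2 m n"
    by (subst (asm) ennreal_le_iff) (auto simp: mono_norm2_def)
  have "ennreal (mono_norm2 m n) \<le> (\<integral>\<^sup>+z. ennreal (4 ^ m) * (ennreal (?D n z) + ennreal (?D (n + m) z)) \<partial>lborel)"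
    unfolding I
  proof (intro nn_integral_mono)
    fix z
    have "(1 + cmod z) ^ (2 * m) \<le> 4 ^ m * (1 + cmod z ^ (2 * m))"
    proof (cases "cmod z \<le> 1")
      case True
      then have "(1 + cmod z) ^ (2 * m) \<le> 2 ^ (2 * m)" by (intro power_mono) auto
      also have "\<dots> = 4 ^ m * 1" by (simp add: power_mult)
      also have "\<dots> \<le> 4 ^ m * (1 + cmod z ^ (2 * m))" by (intro mult_left_mono) auto
      finally show ?thesis .
    next
      case False
      then have "(1 + cmod z) ^ (2 * m) \<le> (2 * cmod z) ^ (2 * m)" by (intro power_mono) auto
      also have "\<dots> = 4 ^ m * cmod z ^ (2 * m)" by (simp add: power_mult_distrib power_mult)
      also have "\<dots> \<le> 4 ^ m * (1 + cmod z ^ (2 * m))" by (intro mult_left_mono) auto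
      finally show ?thesis .
    qed
    then have "?D n z * (1 + cmod z) ^ (2 * m) \<le> ?D n z * (4 ^ m * (1 + cmod z ^ (2 * m)))" by (intro mult_left_mono) auto
    also have "\<dots> = 4 ^ m * (?D n z + ?D (n + m) z)" by (simp add: distrib_left power_add mult_ac)
    finally show "ennreal ((cmod z ^ n * wt m z)\<^sup>2) \<le> ennreal (4 ^ m) * (ennreal (?D n z) + ennreal (?D (n + m) z))"
      unfolding sq by (simp add: ennreal_mult[symmetric] ennreal_plus[symmetric] del: ennreal_plus)
  qed
  also have "\<dots> = ennreal (4 ^ m) * (ennreal (pi * fact n) + ennreal (pi * fact (n + m)))"
    by (subst nn_integral_cmult, measurable, subst nn_integral_add, measurable) (simp only: nn_integral_gauss_moment)
  also have "\<dots> = ennreal (4 ^ m * (pi * fact n + pi * fact (n + m)))"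
    by (simp add: ennreal_mult)
  finally have "mono_norm2 m n \<le> 4 ^ m * (pi * fact n + pi * fact (n + m))"
    by (subst (asm) ennreal_le_iff) auto
  also have "\<dots> \<le> 4 ^ m * (pi * fact (n + m) + pi * fact (n + m))"
    by (intro mult_left_mono add_mono fact_mono) auto
  finally show "mono_norm2 m n \<le> 2 * 4 ^ m * (pi * fact (n + m))" by simp
qed

lemma mono_norm2_pos: "mono_norm2 m n > 0"
  using mono_norm2_bounds(1)[of n m] by (rule less_le_trans[rotated]) simp

text \<open>Divided by \<open>(Suc n)^2\<close> this ratio is the squared weight of the shift
  \<open>z^n\<close> to \<open>z^(n + 1)\<close>, hence of order at most
  \<open>1 / n\<close>.\<close>

lemma mono_norm2_ratio_upper: "mono_norm2 m (Suc n) \<le> 2 * 4 ^ m * real (m + 1) * real (Suc n) * mono_norm2 m n"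
proof -
  have "mono_norm2 m (Suc n) \<le> 2 * 4 ^ m * (pi * fact (Suc n + m))" by (rule mono_norm2_bounds)
  also have "\<dots> = 2 * 4 ^ m * (real (Suc (n + m)) * (pi * fact (n + m)))"
    by (simp add: fact_Suc mult_ac del: of_nat_Suc)
  also have "\<dots> \<le> 2 * 4 ^ m * ((real (m + 1) * real (Suc n)) * mono_norm2 m n)"
  proof (intro mult_left_mono mult_mono mono_norm2_bounds)
    have "Suc (n + m) \<le> (m + 1) * Suc n" by simp
    then show "real (Suc (n + m)) \<le> real (m + 1) * real (Suc n)" by (metis of_nat_le_iff of_nat_mult)
  qed auto
  finally show ?thesis by (simp add: mult.assoc)
qed

text \<open>The lower bound for the matrix entries \<open>k\<close> places off the diagonal: each
  step multiplies the factorial by at least \<open>Suc n\<close>.\<close>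

lemma mono_norm2_ratio_lower: "real (Suc n) ^ k * mono_norm2 m n \<le> 2 * 4 ^ m * mono_norm2 m (n + k)"
proof -
  have fk: "real (Suc n) ^ k * fact (n + m) \<le> fact (n + k + m)"
  proof (induction k)
    case (Suc k)
    have "real (Suc n) ^ Suc k * fact (n + m) = real (Suc n) * (real (Suc n) ^ k * fact (n + m))" by simp
    also have "\<dots> \<le> real (Suc (n + k + m)) * fact (n + k + m)"
      using Suc by (intro mult_mono) auto
    also have "\<dots> = fact (n + Suc k + m)" by (simp add: fact_Suc del: of_nat_Suc)
    finally show ?case .
  qed simp
  have "real (Suc n) ^ k * mono_norm2 m n \<le> real (Suc n) ^ k * (2 * 4 ^ m * (pi * fact (n + m)))"
    by (intro mult_left_mono mono_norm2_bounds) auto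
  also have "\<dots> = 2 * 4 ^ m * (pi * (real (Suc n) ^ k * fact (n + m)))" by (simp add: mult_ac)
  also have "\<dots> \<le> 2 * 4 ^ m * (pi * fact (n + k + m))"
    using fk by (intro mult_left_mono) auto
  also have "\<dots> \<le> 2 * 4 ^ m * mono_norm2 m (n + k)"
    by (intro mult_left_mono mono_norm2_bounds) auto
  finally show ?thesis .
qed

text \<open>The coefficient formula holds on each disc. Passing to the plane is dominated by the
  full integrand, which is integrable because both factors lie in the Hilbert space.\<close>

lemma fs_inner_monomial:
  assumes f: "f \<in> FS 2 m"
  shows "fs_inner m f (\<lambda>z. z ^ n) = (deriv ^^ n) f 0 / fact n * of_real (mono_norm2 m n)"
proof -
  define W where "W z = complex_of_real (exp (- 2 * psi m z))" for z
  have W2: "W z = of_real ((wt m z)\<^sup>2)" for z unfolding W_def exp_psi_2 ..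
  have Wc: "continuous_on UNIV W" unfolding W2[abs_def] by (intro continuous_intros)
  have Wr: "W (c * z) = W z" if "cmod c = 1" for c z
    using that by (simp add: W2 wt_def norm_mult)
  have fh: "f holomorphic_on UNIV" using f by (simp add: FS_iff)
  have mono: "(\<lambda>z. z ^ n) \<in> FS 2 m" by (rule monomial_in_FS) simp
  have lim: "(\<lambda>k. LINT z:ball 0 (real k)|lborel. h z) \<longlonglongrightarrow> (LINT z|lborel. h z)"
    if h: "integrable lborel h" for h :: "complex \<Rightarrow> complex"
    unfolding set_lebesgue_integral_def
  proof (rule integral_dominated_convergence[where w="\<lambda>z. cmod (h z)"])
    have [measurable]: "h \<in> borel_measurable borel" using h by auto
    show "h \<in> borel_measurable lborel" by measurable
    show "(\<lambda>z. indicator (ball 0 (real k)) z *\<^sub>R h z) \<in> borel_measurable lborel" for k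
      by (intro borel_measurable_scaleR borel_measurable_indicator) auto
    show "integrable lborel (\<lambda>z. cmod (h z))" using h by (rule integrable_norm)
    show "AE z in lborel. (\<lambda>k. indicator (ball 0 (real k)) z *\<^sub>R h z) \<longlonglongrightarrow> h z"
    proof (intro AE_I2 tendsto_eventually)
      fix z
      obtain K :: nat where "cmod z < real K" using reals_Archimedean2 by blast
      then show "\<forall>\<^sub>F k in sequentially. indicator (ball 0 (real k)) z *\<^sub>R h z = h z"
        by (intro eventually_sequentiallyI[of K]) (auto simp: indicator_def)
    qed
    show "AE z in lborel. cmod (indicator (ball 0 (real k)) z *\<^sub>R h z) \<le> cmod (h z)" for k
      by (intro AE_I2) (auto simp: indicator_def)
  qed
  have i1: "integrable lborel (\<lambda>z. f z * cnj z ^ n * W z)"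
    using fs_inner_integrable[OF f mono] by (simp add: W_def)
  have i2: "integrable lborel (\<lambda>z. z ^ n * cnj z ^ n * W z)"
    using fs_inner_integrable[OF mono mono] by (simp add: W_def)
  have "(\<lambda>k. (deriv ^^ n) f 0 / fact n * (LINT z:ball 0 (real k)|lborel. z ^ n * cnj z ^ n * W z))
      \<longlonglongrightarrow> (deriv ^^ n) f 0 / fact n * (LINT z|lborel. z ^ n * cnj z ^ n * W z)"
    by (intro tendsto_mult tendsto_const lim i2)
  then have "(\<lambda>k. LINT z:ball 0 (real k)|lborel. f z * cnj z ^ n * W z)
      \<longlonglongrightarrow> (deriv ^^ n) f 0 / fact n * (LINT z|lborel. z ^ n * cnj z ^ n * W z)"
    by (subst integral_disc_coefficient[OF fh Wc Wr]) auto
  then have "(LINT z|lborel. f z * cnj z ^ n * W z) = (deriv ^^ n) f 0 / fact n * (LINT z|lborel. z ^ n * cnj z ^ n * W z)"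
    using LIMSEQ_unique[OF lim[OF i1]] by blast
  moreover have "(LINT z|lborel. z ^ n * cnj z ^ n * W z) = of_real (mono_norm2 m n)"
    using fs_inner_self[OF mono] by (simp add: fs_inner_def W_def mono_norm2_def)
  ultimately show ?thesis by (simp add: fs_inner_def W_def)
qed

definition mono_basis :: "nat \<Rightarrow> nat \<Rightarrow> complex \<Rightarrow> complex" where
  "mono_basis m n z = of_real (1 / sqrt (mono_norm2 m n)) * z ^ n"

lemma fs_inner_mono_basis:
  assumes f: "f \<in> FS 2 m"
  shows "fs_inner m f (mono_basis m n) = (deriv ^^ n) f 0 / fact n * of_real (sqrt (mono_norm2 m n))"
proof -
  have N: "mono_norm2 m n > 0" by (rule mono_norm2_pos)
  have "fs_inner m f (mono_basis m n) = cnj (of_real (1 / sqrt (mono_norm2 m n))) * fs_inner m f (\<lambda>z. z ^ n)"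
    unfolding mono_basis_def[abs_def] by (rule fs_inner_scale_right)
  also have "\<dots> = (deriv ^^ n) f 0 / fact n * of_real (mono_norm2 m n / sqrt (mono_norm2 m n))"
    unfolding fs_inner_monomial[OF f] by simp
  also have "mono_norm2 m n / sqrt (mono_norm2 m n) = sqrt (mono_norm2 m n)"
    using N by (simp add: real_div_sqrt)
  finally show ?thesis .
qed

lemma mono_basis_orthonormal: "fs_orthonormal m (mono_basis m)"
  unfolding fs_orthonormal_def
proof (intro conjI allI)
  show F: "mono_basis m i \<in> FS 2 m" for i
    unfolding mono_basis_def[abs_def] by (intro FS_scale monomial_in_FS) simp
  fix i j
  let ?c = "\<lambda>n. complex_of_real (1 / sqrt (mono_norm2 m n))"
  have e: "fs_inner m (mono_basis m i) (mono_basis m j) = ?c i * (cnj (?c j) * fs_inner m (\<lambda>z. z ^ i) (\<lambda>z. z ^ j))"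
    unfolding mono_basis_def[abs_def] by (simp only: fs_inner_scale_left fs_inner_scale_right)
  show "fs_inner m (mono_basis m i) (mono_basis m j) = (if i = j then 1 else 0)"
  proof (cases "i = j")
    case True
    have N: "mono_norm2 m i > 0" by (rule mono_norm2_pos)
    have "fs_inner m (\<lambda>z. z ^ i) (\<lambda>z. z ^ i) = of_real (mono_norm2 m i)"
      unfolding mono_norm2_def by (intro fs_inner_self monomial_in_FS) simp
    moreover have "j = i" using True by simp
    ultimately have "fs_inner m (mono_basis m i) (mono_basis m j) = ?c i * (cnj (?c i) * of_real (mono_norm2 m i))"
      using e by metis
    also have "\<dots> = of_real (1 / sqrt (mono_norm2 m i) * (1 / sqrt (mono_norm2 m i) * mono_norm2 m i))"
      by (simp only: complex_cnj_complex_of_real of_real_mult)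
    also have "1 / sqrt (mono_norm2 m i) * (1 / sqrt (mono_norm2 m i) * mono_norm2 m i) = 1"
      using N by (simp add: field_simps)
    finally show ?thesis using True by simp
  next
    case False
    have "(LINT z|lborel. z ^ i * cnj z ^ j * complex_of_real ((wt m z)\<^sup>2)) = 0"
      by (rule integral_monomials_radial[OF _ _ False]) (auto simp: wt_def norm_mult)
    then have "fs_inner m (\<lambda>z. z ^ i) (\<lambda>z. z ^ j) = 0" unfolding fs_inner_def exp_psi_2 by simp
    then show ?thesis unfolding e using False by simp
  qed
qed

section \<open>Schatten classes and the main theorem\<close>

lemma Volterra_eqI:
  assumes "\<And>z. (F has_field_derivative f z * deriv g z) (at z)" "F 0 = 0"
  shows "Volterra g f z = F z"
  unfolding Volterra_def
  using contour_integral_primitive[of UNIV F "\<lambda>w. f w * deriv g w" "linepath 0 z"] assms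
  by (simp add: contour_integral_unique)

lemma taylor_uniform_limit:
  assumes f: "f holomorphic_on UNIV"
  shows "uniform_limit (cball 0 R) (\<lambda>N z. f z - (\<Sum>n<N. (deriv ^^ n) f 0 / fact n * z ^ n)) (\<lambda>_. 0) sequentially"
proof -
  have "uniform_limit (cball 0 R) (\<lambda>N z. \<Sum>n<N. (deriv ^^ n) f 0 / fact n * z ^ n)
      (\<lambda>z. suminf (\<lambda>n. (deriv ^^ n) f 0 / fact n * z ^ n)) sequentially"
  proof (rule Weierstrass_m_test)
    show "cmod ((deriv ^^ n) f 0 / fact n * z ^ n) \<le> cmod ((deriv ^^ n) f 0 / fact n) * R ^ n" if "z \<in> cball 0 R" for n z
      unfolding norm_mult using that by (intro mult_left_mono) (auto simp: norm_power intro!: power_mono)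
    show "summable (\<lambda>n. cmod ((deriv ^^ n) f 0 / fact n) * R ^ n)"
      by (rule entire_power_series_abs_summable[OF f])
  qed
  moreover have "suminf (\<lambda>n. (deriv ^^ n) f 0 / fact n * z ^ n) = f z" for z
    using entire_power_series[OF f] sums_unique by metis
  ultimately show ?thesis
    by (simp add: uniform_limit_iff dist_norm norm_minus_commute)
qed

text \<open>For affine \<open>g\<close> the operator sends the \<open>n\<close>-th normalised
  monomial to a multiple of the next one, so a Schmidt decomposition can be written down, with
  singular values of order at most \<open>n^(-1/2)\<close>. It converges because its remainder is
  the operator applied to the Taylor remainder. The alternative \<open>a = 0\<close> serves the
  constant symbols for small \<open>p\<close>.\<close>

lemma Vol_Schatten_of_linear:
  assumes g: "g holomorphic_on UNIV" and lin: "\<And>z. g z = a * z + b" and p: "p > 2 \<or> a = 0"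
  shows "Vol_Schatten m p g"
proof -
  have ut: "uniform_tails m 2 2" by (rule uniform_tails_le) auto
  have dg: "deriv g z = a" for z using deriv_quadratic[of g 0 a b z] lin by simp
  have VFS: "Volterra g f \<in> FS 2 m" if "f \<in> FS 2 m" for f
    using Vol_compact_of_linear[OF g lin _ _ ut] that by (simp add: Vol_compact_def)
  \<comment> \<open>The phase of \<open>a\<close> is moved into \<sigma> so that the singular values
    are nonnegative. For \<open>a = 0\<close> the value 1 keeps \<sigma> orthonormal.\<close>
  define \<alpha> where "\<alpha> = (if a = 0 then 1 else a / of_real (cmod a))"
  have \<alpha>: "cmod \<alpha> = 1" "of_real (cmod a) * \<alpha> = a" by (auto simp: \<alpha>_def norm_divide)
  let ?N = "mono_norm2 m"
  have N: "?N n > 0" for n by (rule mono_norm2_pos)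
  define s where "s n = cmod a * sqrt (?N (Suc n) / ?N n) / real (Suc n)" for n
  define \<sigma> where "\<sigma> n = (\<lambda>z. \<alpha> * mono_basis m (Suc n) z)" for n
  have s0: "s n \<ge> 0" for n using N[of n] N[of "Suc n"] by (simp add: s_def)
  have e: "fs_orthonormal m (mono_basis m)" by (rule mono_basis_orthonormal)
  have eF: "mono_basis m i \<in> FS 2 m" for i using e by (simp add: fs_orthonormal_def)
  have \<sigma>: "fs_orthonormal m \<sigma>"
    unfolding fs_orthonormal_def
  proof (intro conjI allI)
    show "\<sigma> i \<in> FS 2 m" for i unfolding \<sigma>_def by (intro FS_scale eF)
    fix i j
    have "fs_inner m (\<sigma> i) (\<sigma> j) = (\<alpha> * cnj \<alpha>) * fs_inner m (mono_basis m (Suc i)) (mono_basis m (Suc j))"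
      unfolding \<sigma>_def by (simp only: fs_inner_scale_left fs_inner_scale_right mult.assoc)
    also have "\<alpha> * cnj \<alpha> = 1" using \<alpha>(1) by (simp add: complex_norm_square[symmetric])
    finally show "fs_inner m (\<sigma> i) (\<sigma> j) = (if i = j then 1 else 0)"
      using e by (simp add: fs_orthonormal_def)
  qed
  have summ: "summable (\<lambda>n. s n powr p)"
  proof (cases "a = 0")
    case True
    then show ?thesis by (simp add: s_def)
  next
    case False
    with p have p2: "p > 2" by simp
    define K where "K = cmod a * sqrt (2 * 4 ^ m * real (m + 1))"
    have K0: "K \<ge> 0" by (simp add: K_def)
    have sle: "s n \<le> K * real (Suc n) powr (- (1 / 2))" for n
    proof -
      have "?N (Suc n) / ?N n \<le> 2 * 4 ^ m * real (m + 1) * real (Suc n)"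
        using mono_norm2_ratio_upper[of m n] N[of n] by (simp only: pos_divide_le_eq)
      then have "sqrt (?N (Suc n) / ?N n) \<le> sqrt (2 * 4 ^ m * real (m + 1) * real (Suc n))"
        by (rule real_sqrt_le_mono)
      also have "\<dots> = sqrt (2 * 4 ^ m * real (m + 1)) * sqrt (real (Suc n))" by (rule real_sqrt_mult)
      finally have "cmod a * sqrt (?N (Suc n) / ?N n) \<le> K * sqrt (real (Suc n))"
        unfolding K_def mult.assoc by (intro mult_left_mono) auto
      then have "s n \<le> K * sqrt (real (Suc n)) / real (Suc n)"
        unfolding s_def by (intro divide_right_mono) auto
      also have "\<dots> = K * (real (Suc n) powr (1 / 2) * real (Suc n) powr (- 1))"
        using powr_half_sqrt[of "real (Suc n)"] powr_minus_divide[of "real (Suc n)" 1]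
        by (simp del: of_nat_Suc)
      also have "real (Suc n) powr (1 / 2) * real (Suc n) powr (- 1) = real (Suc n) powr (- (1 / 2))"
        by (simp only: powr_add[symmetric]) simp
      finally show ?thesis .
    qed
    have bound: "s n powr p \<le> K powr p * real (Suc n) powr (- (p / 2))" for n
    proof -
      have "s n powr p \<le> (K * real (Suc n) powr (- (1 / 2))) powr p"
        using sle s0 p2 by (intro powr_mono2) auto
      then show ?thesis by (simp add: powr_mult powr_powr del: of_nat_Suc)
    qed
    have "summable (\<lambda>n. real n powr (- (p / 2)))"
      using p2 by (simp add: summable_real_powr_iff)
    then have "summable (\<lambda>n. real (Suc n) powr (- (p / 2)))"
      by (subst summable_Suc_iff)
    then have "summable (\<lambda>n. K powr p * real (Suc n) powr (- (p / 2)))"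
      by (rule summable_mult)
    then show ?thesis
      by (rule summable_comparison_test'[where N=0]) (use bound in auto)
  qed
  have conv: "(\<lambda>M. fs_norm 2 m (\<lambda>z. Volterra g f z -
        (\<Sum>n<M. complex_of_real (s n) * fs_inner m f (mono_basis m n) * \<sigma> n z))) \<longlonglongrightarrow> 0" if f: "f \<in> FS 2 m" for f
  proof -
    have fh: "f holomorphic_on UNIV" using f by (simp add: FS_iff)
    define d where "d M = (\<lambda>z. f z - (\<Sum>n<M. fs_inner m f (mono_basis m n) * mono_basis m n z))" for M
    have dF: "d M \<in> FS 2 m" for M unfolding d_def by (rule orthogonal_remainder(1)[OF e f]) simp
    have dh: "d M holomorphic_on UNIV" for M using dF by (simp add: FS_iff)
    have dn: "fs_norm 2 m (d M) \<le> fs_norm 2 m f" for M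
    proof -
      have "(fs_norm 2 m (d M))\<^sup>2 \<le> (fs_norm 2 m f)\<^sup>2"
        unfolding d_def orthogonal_remainder(2)[OF e f finite_lessThan] by (simp add: sum_nonneg)
      then show ?thesis by (simp add: power2_le_iff_abs_le)
    qed
    have taylor_term: "fs_inner m f (mono_basis m n) * mono_basis m n z = (deriv ^^ n) f 0 / fact n * z ^ n" for n z
    proof -
      have "complex_of_real (sqrt (?N n)) * complex_of_real (1 / sqrt (?N n)) = 1"
        using N[of n] by (simp add: of_real_mult[symmetric] del: of_real_mult)
      then show ?thesis
        unfolding fs_inner_mono_basis[OF f] mono_basis_def
        by (metis (no_types, lifting) mult.assoc mult.right_neutral)
    qed
    have dlim: "uniform_limit (cball 0 R) d (\<lambda>_. 0) sequentially" for R
      using taylor_uniform_limit[OF fh] unfolding d_def taylor_term .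
    have null: "(\<lambda>M. fs_norm 2 m (Volterra g (d M))) \<longlonglongrightarrow> 0"
      by (rule Volterra_linear_null[OF g lin ut _ dF dn dlim]) simp
    \<comment> \<open>Both sides have the derivative \<open>d M * deriv g\<close> and vanish at
      0.\<close>
    have "Volterra g (d M) z = Volterra g f z - (\<Sum>n<M. complex_of_real (s n) * fs_inner m f (mono_basis m n) * \<sigma> n z)" for M z
    proof (rule Volterra_eqI[where F="\<lambda>z. Volterra g f z - (\<Sum>n<M. complex_of_real (s n) * fs_inner m f (mono_basis m n) * \<sigma> n z)"])
      have s\<sigma>: "complex_of_real (s n) * \<sigma> n z = a * of_real (1 / sqrt (?N n)) * (z ^ Suc n / of_nat (Suc n))" for n z
      proof -
        have "s n * (1 / sqrt (?N (Suc n))) = cmod a * (1 / sqrt (?N n)) * (1 / real (Suc n))"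
          using N[of n] N[of "Suc n"] by (simp add: s_def real_sqrt_divide del: of_nat_Suc)
        then have "complex_of_real (s n) * of_real (1 / sqrt (?N (Suc n))) = of_real (cmod a) * of_real (1 / sqrt (?N n)) * of_real (1 / real (Suc n))"
          by (simp only: of_real_mult[symmetric])
        note E = this
        have "complex_of_real (s n) * \<sigma> n z = (complex_of_real (s n) * of_real (1 / sqrt (?N (Suc n)))) * (\<alpha> * z ^ Suc n)"
          unfolding \<sigma>_def mono_basis_def by (simp only: mult_ac)
        also have "\<dots> = (of_real (cmod a) * \<alpha>) * of_real (1 / sqrt (?N n)) * (of_real (1 / real (Suc n)) * z ^ Suc n)"
          unfolding E by (simp only: mult_ac)
        finally have "complex_of_real (s n) * \<sigma> n z = (of_real (cmod a) * \<alpha>) * of_real (1 / sqrt (?N n)) * (of_real (1 / real (Suc n)) * z ^ Suc n)" .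
        then show ?thesis unfolding \<alpha>(2) by (simp del: of_nat_Suc)
      qed
      have ds: "((\<lambda>z. complex_of_real (s n) * fs_inner m f (mono_basis m n) * \<sigma> n z) has_field_derivative
           fs_inner m f (mono_basis m n) * mono_basis m n w * a) (at w)" for n w
      proof -
        have nz: "(of_nat (Suc n) :: complex) \<noteq> 0" by (rule of_nat_neq_0)
        have "((\<lambda>z. fs_inner m f (mono_basis m n) * (a * of_real (1 / sqrt (?N n)) * (z ^ Suc n / of_nat (Suc n)))) has_field_derivative
           fs_inner m f (mono_basis m n) * (a * of_real (1 / sqrt (?N n)) * (of_nat (Suc n) * w ^ n / of_nat (Suc n)))) (at w)"
        proof (intro DERIV_cmult DERIV_cdivide)
          show "((\<lambda>z. z ^ Suc n) has_field_derivative of_nat (Suc n) * w ^ n) (at w)"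
            using DERIV_power_Suc[OF DERIV_ident, of n w UNIV] by simp
        qed
        moreover have "complex_of_real (s n) * fs_inner m f (mono_basis m n) * \<sigma> n z
            = fs_inner m f (mono_basis m n) * (a * of_real (1 / sqrt (?N n)) * (z ^ Suc n / of_nat (Suc n)))" for z
          unfolding s\<sigma>[symmetric] by (simp only: mult_ac)
        moreover have "fs_inner m f (mono_basis m n) * mono_basis m n w * a
            = fs_inner m f (mono_basis m n) * (a * of_real (1 / sqrt (?N n)) * (of_nat (Suc n) * w ^ n / of_nat (Suc n)))"
          using nz by (simp add: mono_basis_def del: of_nat_Suc)
        ultimately show ?thesis by (simp only:)
      qed
      show "((\<lambda>z. Volterra g f z - (\<Sum>n<M. complex_of_real (s n) * fs_inner m f (mono_basis m n) * \<sigma> n z))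
          has_field_derivative d M w * deriv g w) (at w)" for w
      proof -
        have "(Volterra g f has_field_derivative f w * a) (at w)"
          using holomorphic_derivI[OF Volterra_entire(1)[OF fh g] open_UNIV UNIV_I, of w]
          by (simp add: Volterra_entire(2)[OF fh g] dg)
        then have "((\<lambda>z. Volterra g f z - (\<Sum>n<M. complex_of_real (s n) * fs_inner m f (mono_basis m n) * \<sigma> n z))
          has_field_derivative f w * a - (\<Sum>n<M. fs_inner m f (mono_basis m n) * mono_basis m n w * a)) (at w)"
          by (intro DERIV_diff DERIV_sum ds)
        then show ?thesis by (simp add: d_def dg left_diff_distrib sum_distrib_right)
      qed
      show "Volterra g f 0 - (\<Sum>n<M. complex_of_real (s n) * fs_inner m f (mono_basis m n) * \<sigma> n 0) = 0"
        by (simp add: Volterra_entire(3)[OF fh g] \<sigma>_def mono_basis_def)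
    qed
    then have "Volterra g (d M) = (\<lambda>z. Volterra g f z - (\<Sum>n<M. complex_of_real (s n) * fs_inner m f (mono_basis m n) * \<sigma> n z))" for M
      by auto
    then show ?thesis using null by simp
  qed
  show ?thesis
    unfolding Vol_Schatten_def
    using VFS e \<sigma> s0 summ conv
    by (intro conjI ballI exI[of _ s] exI[of _ "mono_basis m"] exI[of _ \<sigma>]) auto
qed

text \<open>Both sides are the coefficient of index \<open>n + k - 1\<close> in the expansion of the
  derivative \<open>z ^ n * deriv g z\<close>; differentiation accounts for the factors
  \<open>n + k\<close> and \<open>k\<close>, and \<open>k \<ge> 1\<close> keeps the index from being
  truncated.\<close>

lemma Volterra_monomial_coeff:
  assumes g: "g holomorphic_on UNIV" and k: "k \<ge> 1"
  shows "(deriv ^^ (n + k)) (Volterra g (\<lambda>z. z ^ n)) 0 / fact (n + k) * of_nat (n + k)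
     = of_nat k * ((deriv ^^ k) g 0 / fact k)"
proof -
  let ?V = "Volterra g (\<lambda>z. z ^ n)"
  have zh: "(\<lambda>z::complex. z ^ n) holomorphic_on UNIV" by (intro holomorphic_intros)
  define E where "E = fps_expansion ?V 0"
  define G where "G = fps_expansion g 0"
  have E: "?V has_fps_expansion E" unfolding E_def
    by (rule has_fps_expansion_fps_expansion[OF open_UNIV UNIV_I Volterra_entire(1)[OF zh g]])
  have G: "g has_fps_expansion G" unfolding G_def
    by (rule has_fps_expansion_fps_expansion[OF open_UNIV UNIV_I g])
  have "deriv ?V has_fps_expansion fps_deriv E" by (rule has_fps_expansion_deriv[OF E])
  moreover have "deriv ?V = (\<lambda>z. z ^ n * deriv g z)" using Volterra_entire(2)[OF zh g] by auto
  moreover have "(\<lambda>z. z ^ n * deriv g z) has_fps_expansion fps_X ^ n * fps_deriv G"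
    by (intro has_fps_expansion_mult has_fps_expansion_fps_X_power has_fps_expansion_deriv G)
  ultimately have "fps_deriv E = fps_X ^ n * fps_deriv G"
    using fps_expansion_unique_complex by metis
  then have "fps_nth (fps_deriv E) (n + k - 1) = fps_nth (fps_X ^ n * fps_deriv G) (n + k - 1)" by simp
  moreover have "fps_nth (fps_deriv E) (n + k - 1) = of_nat (n + k) * fps_nth E (n + k)"
    using k by (cases k) auto
  moreover have "fps_nth (fps_X ^ n * fps_deriv G) (n + k - 1) = of_nat k * fps_nth G k"
    using k by (cases k) (auto simp: fps_X_power_mult_nth)
  ultimately show ?thesis by (simp add: E_def G_def fps_expansion_def mult.commute)
qed

text \<open>
  For \<open>p < 2\<close> the operator is Hilbert-Schmidt, but if the \<open>k\<close>-th Taylor coefficient of \<open>g\<close> does not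
  vanish then its matrix entries from \<open>z^n\<close> to \<open>z^(n + k)\<close> have squares bounded below by a
  multiple of \<open>1 / n\<close>.
\<close>

lemma Vol_Schatten_imp_const:
  assumes g: "g holomorphic_on UNIV" and p: "0 < p" "p < 2" and sch: "Vol_Schatten m p g"
  shows "\<exists>c. \<forall>z. g z = c"
proof (rule ccontr)
  assume nc: "\<nexists>c. \<forall>z. g z = c"
  define G where "G k = (deriv ^^ k) g 0 / fact k" for k
  have "\<exists>k\<ge>1. G k \<noteq> 0"
  proof (rule ccontr)
    assume "\<not> (\<exists>k\<ge>1. G k \<noteq> 0)"
    then have G0: "G k = 0" if "k \<noteq> 0" for k using that by (metis One_nat_def Suc_leI neq0_conv)
    have "g z = G 0" for z
    proof -
      have "(\<lambda>k. G k * z ^ k) sums g z" unfolding G_def by (rule entire_power_series[OF g])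
      moreover have "(\<lambda>k. G k * z ^ k) sums (\<Sum>k\<in>{0}. G k * z ^ k)"
        by (rule sums_finite) (auto simp: G0)
      ultimately show ?thesis using sums_unique2 by fastforce
    qed
    then show False using nc by blast
  qed
  then obtain k where k: "k \<ge> 1" "G k \<noteq> 0" by blast
  obtain s e \<sigma> where e: "fs_orthonormal m e" and \<sigma>: "fs_orthonormal m \<sigma>" and s: "\<And>n. s n \<ge> 0"
    "summable (\<lambda>n. s n powr p)"
    and conv: "\<And>f. f \<in> FS 2 m \<Longrightarrow> (\<lambda>N. fs_norm 2 m (\<lambda>z. Volterra g f z -
             (\<Sum>n<N. complex_of_real (s n) * fs_inner m f (e n) * \<sigma> n z))) \<longlonglongrightarrow> 0"
    and VFS: "\<And>f. f \<in> FS 2 m \<Longrightarrow> Volterra g f \<in> FS 2 m"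
    using sch unfolding Vol_Schatten_def by blast
  have eF: "e i \<in> FS 2 m" and \<sigma>F: "\<sigma> i \<in> FS 2 m" for i using e \<sigma> by (auto simp: fs_orthonormal_def)
  let ?u = "mono_basis m"
  let ?N = "mono_norm2 m"
  have u: "fs_orthonormal m ?u" by (rule mono_basis_orthonormal)
  have uF: "?u i \<in> FS 2 m" for i using u by (simp add: fs_orthonormal_def)
  have N: "?N n > 0" for n by (rule mono_norm2_pos)
  \<comment> \<open>The singular values tend to 0, so eventually they are below 1, where the
    exponent 2 gives the smaller power.\<close>
  have s2: "summable (\<lambda>n. (s n)\<^sup>2)"
  proof (rule summable_comparison_test_ev[OF _ s(2)])
    have "(\<lambda>n. s n powr p) \<longlonglongrightarrow> 0" by (rule summable_LIMSEQ_zero[OF s(2)])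
    then have "\<forall>\<^sub>F n in sequentially. s n powr p < 1" by (simp add: order_tendsto_iff)
    then show "\<forall>\<^sub>F n in sequentially. norm ((s n)\<^sup>2) \<le> s n powr p"
    proof (rule eventually_mono)
      fix n assume n: "s n powr p < 1"
      have "s n < 1"
      proof (rule ccontr)
        assume "\<not> s n < 1"
        then have "1 powr p \<le> s n powr p" using p by (intro powr_mono2) auto
        then show False using n by simp
      qed
      then have "s n powr 2 \<le> s n powr p"
        using powr_mono'[of p 2 "s n"] s(1)[of n] p by linarith
      then show "norm ((s n)\<^sup>2) \<le> s n powr p" using s(1)[of n] by (simp add: powr_numeral)
    qed
  qed
  define T where "T = (\<Sum>j. (s j)\<^sup>2)"
  define x where "x n = fs_inner m (Volterra g (?u n)) (?u (n + k))" for n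
  \<comment> \<open>\<open>y M n\<close> is the matrix entry \<open>x n\<close> computed from the
    first \<open>M\<close> terms of the Schmidt expansion.\<close>
  define y where "y M n = (\<Sum>j<M. complex_of_real (s j) * fs_inner m (?u n) (e j) * fs_inner m (\<sigma> j) (?u (n + k)))" for M n
  have yx: "(\<lambda>M. y M n) \<longlonglongrightarrow> x n" for n
  proof -
    let ?P = "\<lambda>M z. \<Sum>j<M. complex_of_real (s j) * fs_inner m (?u n) (e j) * \<sigma> j z"
    have PF: "?P M \<in> FS 2 m" for M by (intro FS_sum \<sigma>F) auto
    have dF: "(\<lambda>z. Volterra g (?u n) z - ?P M z) \<in> FS 2 m" for M by (intro FS_diff VFS uF PF) simp
    have "cmod (x n - y M n) \<le> fs_norm 2 m (\<lambda>z. Volterra g (?u n) z - ?P M z)" for M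
    proof -
      have "x n - y M n = fs_inner m (\<lambda>z. Volterra g (?u n) z - ?P M z) (?u (n + k))"
        unfolding x_def y_def fs_inner_diff_left[OF VFS[OF uF] PF uF] fs_inner_sum_left[OF \<sigma>F uF] ..
      \<comment> \<open>Bessel's inequality for a single basis vector serves as the Cauchy-Schwarz
        inequality.\<close>
      moreover have "(cmod (fs_inner m (\<lambda>z. Volterra g (?u n) z - ?P M z) (?u (n + k))))\<^sup>2 \<le> (fs_norm 2 m (\<lambda>z. Volterra g (?u n) z - ?P M z))\<^sup>2"
        using bessel[OF u dF, of "{n + k}"] by simp
      ultimately show ?thesis by (simp add: power2_le_iff_abs_le)
    qed
    then have "(\<lambda>M. x n - y M n) \<longlonglongrightarrow> 0"
      by (intro Lim_null_comparison[OF always_eventually conv[OF uF]]) auto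
    then show ?thesis using tendsto_diff[OF tendsto_const[of "x n"]] by fastforce
  qed
  \<comment> \<open>After Cauchy-Schwarz in \<open>j\<close>, Bessel's inequality is used twice: for
    the sequence \<sigma> against one basis vector, and for the monomial basis against each
    \<open>e j\<close>. What remains is the sum of the squared singular values.\<close>
  have ybound: "(\<Sum>n<L. (cmod (y M n))\<^sup>2) \<le> T" for L M
  proof -
    have "(cmod (y M n))\<^sup>2 \<le> (\<Sum>j<M. (s j)\<^sup>2 * (cmod (fs_inner m (e j) (?u n)))\<^sup>2)" for n
    proof -
      have "cmod (y M n) \<le> (\<Sum>j<M. (s j * cmod (fs_inner m (e j) (?u n))) * cmod (fs_inner m (?u (n + k)) (\<sigma> j)))"
        unfolding y_def
        by (rule order.trans[OF norm_sum]) (simp add: norm_mult s fs_inner_commute[of m "?u _" "e _"] fs_inner_commute[of m "\<sigma> _" "?u _"])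
      then have "(cmod (y M n))\<^sup>2 \<le> (\<Sum>j<M. (s j * cmod (fs_inner m (e j) (?u n))) * cmod (fs_inner m (?u (n + k)) (\<sigma> j)))\<^sup>2"
        by (intro power_mono) auto
      also have "\<dots> \<le> (\<Sum>j<M. (s j * cmod (fs_inner m (e j) (?u n)))\<^sup>2) * (\<Sum>j<M. (cmod (fs_inner m (?u (n + k)) (\<sigma> j)))\<^sup>2)"
        by (rule Cauchy_Schwarz_ineq_sum)
      also have "\<dots> \<le> (\<Sum>j<M. (s j * cmod (fs_inner m (e j) (?u n)))\<^sup>2) * 1"
        using bessel[OF \<sigma> uF[of "n + k"], of "{..<M}"] norm_orthonormal[OF u, of "n + k"]
        by (intro mult_left_mono sum_nonneg) auto
      finally show ?thesis by (simp add: power_mult_distrib)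
    qed
    then have "(\<Sum>n<L. (cmod (y M n))\<^sup>2) \<le> (\<Sum>n<L. \<Sum>j<M. (s j)\<^sup>2 * (cmod (fs_inner m (e j) (?u n)))\<^sup>2)"
      by (rule sum_mono)
    also have "\<dots> = (\<Sum>j<M. (s j)\<^sup>2 * (\<Sum>n<L. (cmod (fs_inner m (e j) (?u n)))\<^sup>2))"
      by (subst sum.swap) (simp add: sum_distrib_left)
    also have "\<dots> \<le> (\<Sum>j<M. (s j)\<^sup>2 * 1)"
      using bessel[OF u eF, of "{..<L}"] norm_orthonormal[OF e] by (intro sum_mono mult_left_mono) auto
    also have "\<dots> \<le> T" unfolding T_def using s2 by (simp add: sum_le_suminf)
    finally show ?thesis .
  qed
  have xbound: "(\<Sum>n<L. (cmod (x n))\<^sup>2) \<le> T" for L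
  proof (rule LIMSEQ_le_const2)
    show "(\<lambda>M. \<Sum>n<L. (cmod (y M n))\<^sup>2) \<longlonglongrightarrow> (\<Sum>n<L. (cmod (x n))\<^sup>2)"
      by (intro tendsto_sum tendsto_power tendsto_norm yx)
  qed (use ybound in blast)
  define \<kappa> where "\<kappa> = (cmod (G k))\<^sup>2 / (2 * 4 ^ m)"
  have \<kappa>: "\<kappa> > 0" using k by (simp add: \<kappa>_def)
  have xlow: "\<kappa> * inverse (real (Suc n)) \<le> (cmod (x n))\<^sup>2" for n
  proof -
    let ?c = "(deriv ^^ (n + k)) (Volterra g (\<lambda>z. z ^ n)) 0 / fact (n + k)"
    have zF: "(\<lambda>z. z ^ n) \<in> FS 2 m" by (rule monomial_in_FS) simp
    have zh: "(\<lambda>z::complex. z ^ n) holomorphic_on UNIV" by (intro holomorphic_intros)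
    have "Volterra g (?u n) = (\<lambda>z. of_real (1 / sqrt (?N n)) * Volterra g (\<lambda>z. z ^ n) z)"
      unfolding mono_basis_def[abs_def] by (rule ext) (rule Volterra_scale[OF zh g])
    then have "x n = of_real (1 / sqrt (?N n)) * fs_inner m (Volterra g (\<lambda>z. z ^ n)) (?u (n + k))"
      unfolding x_def by (simp only: fs_inner_scale_left)
    also have "\<dots> = of_real (1 / sqrt (?N n)) * (?c * of_real (sqrt (?N (n + k))))"
      unfolding fs_inner_mono_basis[OF VFS[OF zF]] ..
    finally have "cmod (x n) = 1 / sqrt (?N n) * (cmod ?c * sqrt (?N (n + k)))"
      using N[of n] N[of "n + k"] by (simp add: norm_mult norm_divide)
    then have x2: "(cmod (x n))\<^sup>2 = (cmod ?c)\<^sup>2 * (?N (n + k) / ?N n)"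
      using N[of n] N[of "n + k"] by (simp add: power_mult_distrib power_divide)
    have "?c * of_nat (n + k) = of_nat k * G k"
      unfolding G_def by (rule Volterra_monomial_coeff[OF g k(1)])
    then have "cmod ?c * real (n + k) = real k * cmod (G k)"
      by (metis norm_mult norm_of_nat)
    then have c: "cmod ?c = real k * cmod (G k) / real (n + k)" using k by (simp add: field_simps)
    have "real (n + k) \<le> real k * real (Suc n)"
    proof -
      have "n + k \<le> k * Suc n" using k by (cases k) auto
      then show ?thesis by (metis of_nat_le_iff of_nat_mult)
    qed
    then have "real k * cmod (G k) / (real k * real (Suc n)) \<le> cmod ?c"
      unfolding c using k by (intro divide_left_mono mult_pos_pos) auto
    then have "cmod (G k) / real (Suc n) \<le> cmod ?c" using k by (simp del: of_nat_Suc)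
    then have 1: "(cmod (G k) / real (Suc n))\<^sup>2 \<le> (cmod ?c)\<^sup>2" by (intro power_mono) auto
    \<comment> \<open>For \<open>k > 1\<close> the entries are even larger; the first power is all
      that divergence of the harmonic series requires.\<close>
    have "real (Suc n) ^ 1 \<le> real (Suc n) ^ k" using k by (intro power_increasing) auto
    also have "\<dots> \<le> 2 * 4 ^ m * ?N (n + k) / ?N n"
      using mono_norm2_ratio_lower[of n k m] N[of n] by (simp only: pos_le_divide_eq)
    finally have 2: "real (Suc n) / (2 * 4 ^ m) \<le> ?N (n + k) / ?N n" by (simp add: field_simps)
    have "(cmod (G k) / real (Suc n))\<^sup>2 * (real (Suc n) / (2 * 4 ^ m)) \<le> (cmod ?c)\<^sup>2 * (?N (n + k) / ?N n)"
      using 1 2 by (intro mult_mono) auto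
    moreover have "(cmod (G k) / real (Suc n))\<^sup>2 * (real (Suc n) / (2 * 4 ^ m)) = \<kappa> * inverse (real (Suc n))"
      by (simp add: \<kappa>_def power2_eq_square field_simps del: of_nat_Suc)
    ultimately show ?thesis unfolding x2 by simp
  qed
  have "harm L \<le> T / \<kappa>" for L :: nat
  proof -
    have "\<kappa> * harm L = (\<Sum>n<L. \<kappa> * inverse (real (Suc n)))"
      unfolding harm_altdef sum_distrib_left ..
    also have "\<dots> \<le> T" by (rule order.trans[OF sum_mono xbound]) (rule xlow)
    finally show ?thesis using \<kappa> by (simp add: pos_le_divide_eq mult.commute)
  qed
  moreover have "\<forall>\<^sub>F L in sequentially. harm L > T / \<kappa>"
    using harm_at_top by (simp add: filterlim_at_top_dense)
  then obtain L :: nat where "harm L > T / \<kappa>" using eventually_happens'[OF sequentially_bot] by blast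
  ultimately show False by (metis not_le)
qed

theorem theorem1:
  fixes m :: nat and g :: "complex \<Rightarrow> complex"
  assumes "g holomorphic_on UNIV"
  shows "(\<forall>p q :: real. 0 < p \<and> p \<le> q \<longrightarrow>
            (Vol_bounded m p q g \<longleftrightarrow> (\<exists>a b c. \<forall>z. g z = a * z^2 + b * z + c)) \<and>
            (Vol_compact m p q g \<longleftrightarrow> (\<exists>a b. \<forall>z. g z = a * z + b)))
       \<and> (\<forall>p q :: real. 0 < q \<and> q < p \<longrightarrow>
            (Vol_bounded m p q g \<longleftrightarrow> Vol_compact m p q g) \<and>
            (Vol_compact m p q g \<longleftrightarrow>
               (if q / 2 > (p - q) / p then (\<exists>a b. \<forall>z. g z = a * z + b)
                else (\<exists>c. \<forall>z. g z = c))))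
       \<and> (Vol_compact m 2 2 g \<longrightarrow> (\<forall>p :: real. p > 2 \<longrightarrow> Vol_Schatten m p g))
       \<and> (\<forall>p :: real. 0 < p \<and> p < 2 \<longrightarrow> (Vol_Schatten m p g \<longleftrightarrow> (\<exists>c. \<forall>z. g z = c)))"
proof (intro conjI allI impI)
  note g = assms
  fix p q :: real assume pq: "0 < p \<and> p \<le> q"
  then have p: "0 < p" "p \<le> q" "0 < q" by auto
  show "Vol_bounded m p q g \<longleftrightarrow> (\<exists>a b c. \<forall>z. g z = a * z^2 + b * z + c)"
    using Vol_bounded_imp_quadratic[OF g p(1,3)] Vol_bounded_of_quadratic[OF g p(1,2)] by blast
  show "Vol_compact m p q g \<longleftrightarrow> (\<exists>a b. \<forall>z. g z = a * z + b)"
    using Vol_compact_imp_linear[OF g p(1,3)] Vol_compact_of_linear[OF g _ p(1,3) uniform_tails_le[OF p(1,2)]] by blast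
next
  note g = assms
  fix p q :: real assume pq: "0 < q \<and> q < p"
  then have q: "0 < q" "q < p" "0 < p" by auto
  let ?C = "if q / 2 > (p - q) / p then (\<exists>a b. \<forall>z. g z = a * z + b) else (\<exists>c. \<forall>z. g z = c)"
  have 1: "Vol_bounded m p q g" if "Vol_compact m p q g" using Vol_compact_imp_bounded[OF g q(3,1) that] .
  have 2: ?C if "Vol_bounded m p q g" using Vol_bounded_gt_imp[OF g q(1,2) that] .
  have 3: "Vol_compact m p q g" if ?C
  proof (cases "q / 2 > (p - q) / p")
    case True
    then obtain a b where "\<And>z. g z = a * z + b" using \<open>?C\<close> by auto
    then show ?thesis by (rule Vol_compact_of_linear[OF g _ q(3,1) uniform_tails_gt[OF q(1,2) True]])
  next
    \<comment> \<open>In this range the tail estimate \<open>uniform_tails_gt\<close> does not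
      apply, but \<open>g\<close> is constant and the operator is zero.\<close>
    case False
    then obtain c where c: "\<And>z. g z = c" using \<open>?C\<close> by auto
    have dg: "deriv g z = 0" for z using deriv_quadratic[of g 0 0 c z] c by simp
    have V0: "Volterra g f = (\<lambda>z. 0)" if "f holomorphic_on UNIV" for f
      by (rule ext, rule Volterra_eqI) (auto simp: dg)
    have Z: "(\<lambda>z. 0) \<in> FS q m" using FS_scale[OF monomial_in_FS[OF q(1)], of 0 0] by simp
    have N0: "fs_norm q m (\<lambda>z. 0) = 0" using q by (simp add: fs_norm_def fs_integral_def)
    show ?thesis
      unfolding Vol_compact_def
    proof (intro conjI ballI allI impI)
      show "Volterra g f \<in> FS q m" if "f \<in> FS p m" for f
        using V0[of f] Z that by (simp add: FS_iff)
      fix fs :: "nat \<Rightarrow> complex \<Rightarrow> complex"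
      assume "\<forall>n. fs n \<in> FS p m \<and> fs_norm p m (fs n) \<le> 1"
      then have "Volterra g (fs n) = (\<lambda>z. 0)" for n by (intro V0) (simp add: FS_iff)
      then have "(\<lambda>n. fs_norm q m (\<lambda>z. Volterra g (fs (id n)) z - 0)) \<longlonglongrightarrow> 0" by (simp add: N0)
      then show "\<exists>r h. strict_mono r \<and> h \<in> FS q m \<and>
          (\<lambda>n. fs_norm q m (\<lambda>z. Volterra g (fs (r n)) z - h z)) \<longlonglongrightarrow> 0"
        using Z strict_mono_id by blast
    qed
  qed
  show "Vol_bounded m p q g \<longleftrightarrow> Vol_compact m p q g" using 1 2 3 by blast
  show "Vol_compact m p q g \<longleftrightarrow> ?C" using 1 2 3 by blast
next
  fix p :: real assume "Vol_compact m 2 2 g" "p > 2"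
  then show "Vol_Schatten m p g"
    using Vol_compact_imp_linear[OF assms, of 2 2 m] Vol_Schatten_of_linear[OF assms] by auto
next
  fix p :: real assume p: "0 < p \<and> p < 2"
  show "Vol_Schatten m p g \<longleftrightarrow> (\<exists>c. \<forall>z. g z = c)"
  proof
    assume "Vol_Schatten m p g"
    then show "\<exists>c. \<forall>z. g z = c" using Vol_Schatten_imp_const[OF assms] p by blast
  next
    assume "\<exists>c. \<forall>z. g z = c"
    then obtain c where "\<And>z. g z = 0 * z + c" by auto
    then show "Vol_Schatten m p g" by (rule Vol_Schatten_of_linear[OF assms]) simp
  qed
qed

end
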